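(* Let $N\ge3$ and $1<k<N$ be integers, and let $\Omega\subset\mathbb R^k$ be a smooth bounded domain. Let $\alpha>-1$ and $\sigma\in(-2\alpha,2)$ with $2\alpha+\sigma k\ge0$. Then for any real $Q$ with $$2\le Q\le Q_{cr}^k:=\frac{2\left(N+\frac{2\alpha+\sigma k}{2-\sigma}\right)}{N+\frac{2\alpha+\sigma k}{2-\sigma}-2},$$ there exists a positive constant $C$, depending only on $Q,N,\alpha,\sigma,k$ and $\Omega$, such that for every $f\in C_0^\infty(B_1\times\Omega)$ $$\left(\int_{B_1\times\Omega}d^\alpha|f|^Q\,dx\right)^{\frac2Q}\le C\int_{B_1\times\Omega}d^\alpha\left(|\nabla_{x'}f|^2+d^\sigma|\nabla_\lambda f|^2\right)dx.$$
   Context: Points $x\in\mathbb R^N$ are written $x=(x',\lambda)$ with $x'\in\mathbb R^{N-k}$ and $\lambda\in\mathbb R^k$. $B_1=\{x'\in\mathbb R^{N-k}:|x'|<1\}$ is the unit ball of $\mathbb R^{N-k}$, and $d=d(\lambda)=\mathrm{dist}(\lambda,\partial\Omega)$. $\nabla_{x'}$ and $\nabla_\lambda$ are the gradients in the $x'$ and $\lambda$ variables. $C_0^\infty(U)$ denotes the smooth real-valued functions with compact support in the open set $U$. *)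

theory Defs
  imports "HOL-Analysis.Analysis"
begin

text \<open>All iterated directional derivatives up to order \<open>n\<close> exist, the function and its derivatives
  of order below \<open>n\<close> are Frechet differentiable on \<open>S\<close>, and those of order \<open>n\<close> are continuous;
  for open \<open>S\<close> this is the usual class \<open>C^n(S)\<close>.\<close>
primrec C_n_on :: "nat \<Rightarrow> 'a::real_normed_vector set \<Rightarrow> ('a \<Rightarrow> 'b::real_normed_vector) \<Rightarrow> bool" where
  "C_n_on 0 S f \<longleftrightarrow> continuous_on S f"
| "C_n_on (Suc n) S f \<longleftrightarrow>
     (\<forall>x\<in>S. f differentiable (at x)) \<and> (\<forall>v. C_n_on n S (\<lambda>x. frechet_derivative f (at x) v))"

definition smooth_on :: "'a::real_normed_vector set \<Rightarrow> ('a \<Rightarrow> 'b::real_normed_vector) \<Rightarrow> bool" where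
  "smooth_on S f \<longleftrightarrow> (\<forall>n. C_n_on n S f)"

text \<open>\<open>C_0^\<infinity>(U)\<close>; its elements are identified with their extensions by zero to the whole space.\<close>
definition test_functions :: "'a::real_normed_vector set \<Rightarrow> ('a \<Rightarrow> real) set" where
  "test_functions U =
     {f. smooth_on UNIV f \<and> compact (closure (support_on UNIV f)) \<and> closure (support_on UNIV f) \<subseteq> U}"

text \<open>Near each boundary point the domain is the region above the graph of a smooth function,
  in coordinates where the unit vector \<open>e\<close> is vertical.  The function of the remaining
  coordinates is \<open>\<gamma>\<close> restricted to the hyperplane orthogonal to \<open>e\<close>; the values of \<open>\<gamma>\<close> off
  that hyperplane are irrelevant.\<close>
definition smooth_boundary :: "'a::euclidean_space set \<Rightarrow> bool" where
  "smooth_boundary \<Omega> \<longleftrightarrow>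
     (\<forall>p\<in>frontier \<Omega>. \<exists>r>0. \<exists>e. \<exists>\<gamma>::'a \<Rightarrow> real. norm e = 1 \<and> smooth_on UNIV \<gamma> \<and>
        \<Omega> \<inter> ball p r = {x \<in> ball p r. \<gamma> (x - (x \<bullet> e) *\<^sub>R e) < x \<bullet> e})"

definition smooth_bounded_domain :: "'a::euclidean_space set \<Rightarrow> bool" where
  "smooth_bounded_domain \<Omega> \<longleftrightarrow>
     open \<Omega> \<and> connected \<Omega> \<and> \<Omega> \<noteq> {} \<and> bounded \<Omega> \<and> smooth_boundary \<Omega>"

definition grad :: "('a::real_inner \<Rightarrow> real) \<Rightarrow> 'a \<Rightarrow> 'a" where
  "grad f x = (THE D. GDERIV f x :> D)"

definition grad_fst :: "('a::real_inner \<times> 'b::real_inner \<Rightarrow> real) \<Rightarrow> 'a \<times> 'b \<Rightarrow> 'a" where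
  "grad_fst f x = grad (\<lambda>y. f (y, snd x)) (fst x)"

definition grad_snd :: "('a::real_inner \<times> 'b::real_inner \<Rightarrow> real) \<Rightarrow> 'a \<times> 'b \<Rightarrow> 'b" where
  "grad_snd f x = grad (\<lambda>y. f (fst x, y)) (snd x)"

lemma grad_eq:
  assumes "GDERIV f x :> D"
  shows "grad f x = D"
  unfolding grad_def
proof (rule the_equality, rule assms)
  fix E assume "GDERIV f x :> E"
  with assms have "(\<lambda>h. inner h E) = (\<lambda>h. inner h D)"
    unfolding gderiv_def by (metis has_derivative_unique)
  then have "inner (E - D) (E - D) = 0"
    by (metis inner_diff_right right_minus_eq)
  then show "E = D" by simp
qed

definition Q_cr :: "nat \<Rightarrow> nat \<Rightarrow> real \<Rightarrow> real \<Rightarrow> real" where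
  "Q_cr N k \<alpha> \<sigma> =
     2 * (real N + (2 * \<alpha> + \<sigma> * real k) / (2 - \<sigma>)) / (real N + (2 * \<alpha> + \<sigma> * real k) / (2 - \<sigma>) - 2)"

end

theory Submission
  imports Defs
begin

text \<open>Write \<open>d\<close> for the distance of the second variable to the boundary of \<open>\<Omega>\<close>,
  \<open>\<beta> = \<alpha> + \<sigma> / 2\<close>, and \<open>n\<close> for the dimension of the whole space. The energy
  scales like the Dirichlet integral in the homogeneous dimension \<open>D = n + (2 * \<alpha> + \<sigma> * k) / (2 -
  \<sigma>)\<close>, which need not be an integer, and the critical exponent is \<open>Q = 2 * D / (D - 2)\<close>.

  The proof works in \<open>L\<^sup>1\<close>, in the manner of Gagliardo and Nirenberg, with the function
  \<open>|f|\<^sup>p\<close> for \<open>p = Q / 2 + 1\<close>. Integrating along coordinate lines bounds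
  \<open>d\<^sup>\<alpha> |f|\<^sup>p\<close> by an integral of \<open>d\<^sup>\<alpha> |\<partial>|f|\<^sup>p|\<close> over
  a line in the ball direction, where the weight is constant, and \<open>d\<^sup>\<beta> |f|\<^sup>p\<close> by an integral
  of \<open>d\<^sup>\<beta> |\<partial>|f|\<^sup>p| + \<beta> d\<^sup>\<beta>\<^sup>-\<^sup>1 |f|\<^sup>p\<close> over a line
  in the other direction. The second integrand contains the Hardy term \<open>d\<^sup>\<beta>\<^sup>-\<^sup>1
  |f|\<^sup>p\<close>, which can itself be controlled by the derivatives because \<open>\<beta> > 0\<close> (this is
  \<open>\<sigma> > - 2 * \<alpha>\<close>): near the boundary one integrates in a transversal direction, and what is left in
  the interior is bounded by the Poincare inequality in the ball (\<open>Hardy_uniform\<close>, \<open>Poincare_fst\<close>).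

  A Loomis--Whitney inequality with general exponents (\<open>Loomis_Whitney_Finner_lborel\<close>) multiplies the
  \<open>n\<close> line bounds with exponent \<open>1 / D\<close> each. Since \<open>D \<ge> n\<close>, which is the
  hypothesis \<open>2 * \<alpha> + \<sigma> * k \<ge> 0\<close>, the Hardy term can be given the exponent \<open>(D - n) /
  D\<close>, and the powers of \<open>d\<close> then match exactly (\<open>weighted_Gagliardo_Nirenberg\<close>). The result
  bounds \<open>I = \<integral> d\<^sup>\<alpha> |f|\<^sup>Q\<close> by \<open>I\<^sup>1\<^sup>/\<^sup>D\<close> times a
  bound for all the \<open>L\<^sup>1\<close> quantities, and by the Cauchy--Schwarz inequality such a bound is a multiple of
  the square root of \<open>I\<close> times the energy. Solving for \<open>I\<close> gives the critical case
  (\<open>critical_bound\<close>). The case \<open>Q = 2\<close> is the Poincare inequality in the ball, and Hoelder's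
  inequality interpolates between the two. \<close>

section \<open>Powers of extended nonnegative reals and Hoelder's inequality\<close>

text \<open>The convention \<open>epow x 0 = 1\<close>, also for \<open>x = \<infinity>\<close>, makes a factor with exponent
  zero disappear from a product; Hoelder's inequality then holds without singling out vanishing exponents.\<close>
definition epow :: "ennreal \<Rightarrow> real \<Rightarrow> ennreal" where
  "epow x a = (if a = 0 then 1 else if x = top then top else ennreal (enn2real x powr a))"

lemma epow_0_right [simp]: "epow x 0 = 1"
  by (simp add: epow_def)

lemma epow_1_right [simp]: "epow x 1 = x"
  by (auto simp: epow_def less_top)

lemma epow_0_left: "a > 0 \<Longrightarrow> epow 0 a = 0"
  by (simp add: epow_def)

lemma epow_top: "a > 0 \<Longrightarrow> epow top a = top"
  by (simp add: epow_def)

lemma epow_ennreal: "a \<noteq> 0 \<Longrightarrow> r \<ge> 0 \<Longrightarrow> epow (ennreal r) a = ennreal (r powr a)"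
  by (simp add: epow_def)

lemma epow_ennreal_pos: "r > 0 \<Longrightarrow> epow (ennreal r) a = ennreal (r powr a)"
  by (simp add: epow_def)

lemma epow_mono: "x \<le> y \<Longrightarrow> a \<ge> 0 \<Longrightarrow> epow x a \<le> epow y a"
  by (cases x; cases y) (auto simp: epow_def top_unique intro!: powr_mono2)

lemma epow_mult: "a \<ge> 0 \<Longrightarrow> epow (x * y) a = epow x a * epow y a"
proof (cases "a = 0")
  case False
  assume "a \<ge> 0"
  then show ?thesis using False
  by (cases x; cases y)
    (auto simp: epow_def ennreal_mult_top ennreal_top_mult ennreal_mult[symmetric] enn2real_mult powr_mult
      enn2real_eq_0_iff)
qed simp

lemma epow_add: "a \<ge> 0 \<Longrightarrow> b \<ge> 0 \<Longrightarrow> epow x (a + b) = epow x a * epow x b"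
  by (cases x) (auto simp: epow_def powr_add ennreal_mult)

lemma epow_epow: "a \<ge> 0 \<Longrightarrow> b \<ge> 0 \<Longrightarrow> epow (epow x a) b = epow x (a * b)"
  by (cases x) (auto simp: epow_def powr_powr)

lemma epow_eq_0_iff: "a > 0 \<Longrightarrow> epow x a = 0 \<longleftrightarrow> x = 0"
  by (cases x) (auto simp: epow_def)

lemma measurable_epow [measurable]: "f \<in> borel_measurable M \<Longrightarrow> (\<lambda>x. epow (f x) a) \<in> borel_measurable M"
  unfolding epow_def by (cases "a = 0") simp_all

text \<open>For positive finite entries this is Jensen's inequality for \<open>exp\<close> at the logarithms; an entry
  \<open>0\<close> kills the left side and an entry \<open>\<infinity>\<close> makes the right side infinite.\<close>
lemma weighted_geom_mean_le_arith_mean: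
  assumes "finite K" "\<And>k. k \<in> K \<Longrightarrow> p k > 0" "sum p K = 1"
  shows "(\<Prod>k\<in>K. epow (x k) (p k)) \<le> (\<Sum>k\<in>K. ennreal (p k) * x k)"
proof (cases "\<exists>k\<in>K. x k = 0 \<or> x k = top")
  case True
  then obtain k where k: "k \<in> K" "x k = 0 \<or> x k = top" by blast
  from k(2) show ?thesis
  proof
    assume "x k = 0"
    then have "(\<Prod>k\<in>K. epow (x k) (p k)) = 0"
      using assms k \<open>x k = 0\<close> by (intro prod_zero bexI[of _ k]) (auto simp: epow_0_left)
    then show ?thesis by (metis zero_le)
  next
    assume "x k = top"
    then have "top = ennreal (p k) * x k"
      using assms(2)[OF k(1)] \<open>x k = top\<close> by (simp add: ennreal_mult_top ennreal_eq_0_iff not_le)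
    also have "\<dots> \<le> (\<Sum>k\<in>K. ennreal (p k) * x k)"
      using assms(1) k(1) by (intro member_le_sum) auto
    finally show ?thesis by (simp add: top_unique)
  qed
next
  case False
  define y where "y k = enn2real (x k)" for k
  have xy: "x k = ennreal (y k)" "y k > 0" if "k \<in> K" for k
    using False that by (auto simp: y_def less_top enn2real_positive_iff zero_less_iff_neq_zero)
  have "exp (\<Sum>k\<in>K. p k *\<^sub>R ln (y k)) \<le> (\<Sum>k\<in>K. p k * exp (ln (y k)))"
    using assms by (intro convex_on_sum[where C=UNIV] exp_convex) (auto simp: less_imp_le)
  moreover have "(\<Sum>k\<in>K. p k * exp (ln (y k))) = (\<Sum>k\<in>K. p k * y k)"
    using xy by (intro sum.cong) auto
  moreover have "exp (\<Sum>k\<in>K. p k *\<^sub>R ln (y k)) = (\<Prod>k\<in>K. y k powr p k)"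
    unfolding exp_sum[OF assms(1)] using xy(2) by (intro prod.cong) (auto simp: powr_def dest!: xy(2))
  ultimately have *: "(\<Prod>k\<in>K. y k powr p k) \<le> (\<Sum>k\<in>K. p k * y k)" by simp
  have "(\<Prod>k\<in>K. epow (x k) (p k)) = (\<Prod>k\<in>K. ennreal (y k powr p k))"
    using xy by (intro prod.cong) (auto simp: epow_ennreal_pos)
  also have "\<dots> = ennreal (\<Prod>k\<in>K. y k powr p k)"
    by (intro prod_ennreal) auto
  also have "\<dots> \<le> ennreal (\<Sum>k\<in>K. p k * y k)"
    using * by (rule ennreal_leI)
  also have "\<dots> = (\<Sum>k\<in>K. ennreal (p k) * x k)"
    using xy assms by (subst sum_ennreal[symmetric]) (auto intro!: sum.cong simp: ennreal_mult' less_imp_le)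
  finally show ?thesis .
qed

text \<open>Dividing each function by its integral reduces the claim to the inequality of weighted means under the integral
  sign. An integral that is \<open>0\<close> or \<open>\<infinity>\<close> cannot be divided by, and is treated
  apart.\<close>
lemma nn_integral_Holder_pos:
  assumes "finite K" "\<And>k. k \<in> K \<Longrightarrow> p k > 0" "sum p K = 1"
    and meas [measurable]: "\<And>k. k \<in> K \<Longrightarrow> f k \<in> borel_measurable M"
  shows "(\<integral>\<^sup>+x. (\<Prod>k\<in>K. epow (f k x) (p k)) \<partial>M) \<le> (\<Prod>k\<in>K. epow (\<integral>\<^sup>+x. f k x \<partial>M) (p k))"
proof -
  define A where "A k = (\<integral>\<^sup>+x. f k x \<partial>M)" for k
  consider (zero) k where "k \<in> K" "A k = 0" | (top) k where "k \<in> K" "A k = top" "\<forall>k\<in>K. A k \<noteq> 0"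
    | (fin) "\<forall>k\<in>K. A k \<noteq> 0 \<and> A k \<noteq> top" by blast
  then show ?thesis
  proof cases
    case zero
    then have "AE x in M. f k x = 0"
      using nn_integral_0_iff_AE[OF meas[of k]] by (simp add: A_def)
    then have "AE x in M. (\<Prod>k\<in>K. epow (f k x) (p k)) = 0"
    proof eventually_elim
      case (elim x)
      then show ?case
        using assms zero by (intro prod_zero) (auto intro!: bexI[of _ k] simp: epow_0_left)
    qed
    then have "(\<integral>\<^sup>+x. (\<Prod>k\<in>K. epow (f k x) (p k)) \<partial>M) = (\<integral>\<^sup>+x. 0 \<partial>M)"
      by (rule nn_integral_cong_AE)
    then show ?thesis by simp
  next
    case top
    have "(\<Prod>k\<in>K. epow (A k) (p k)) = top"
      using assms top by (auto simp: ennreal_prod_eq_top epow_eq_0_iff epow_top intro!: bexI[of _ k])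
    then show ?thesis by (simp add: A_def)
  next
    case fin
    have "(\<Prod>k\<in>K. epow (f k x) (p k)) =
        (\<Prod>k\<in>K. epow (A k) (p k)) * (\<Prod>k\<in>K. epow (f k x / A k) (p k))" for x
      unfolding prod.distrib[symmetric]
    proof (intro prod.cong refl)
      fix k assume k: "k \<in> K"
      have "f k x = A k * (f k x / A k)"
        using fin k by (simp add: ennreal_times_divide ennreal_mult_divide_eq mult.commute[of "A k"])
      then show "epow (f k x) (p k) = epow (A k) (p k) * epow (f k x / A k) (p k)"
        using assms(2)[OF k] by (metis epow_mult less_imp_le)
    qed
    then have "(\<integral>\<^sup>+x. (\<Prod>k\<in>K. epow (f k x) (p k)) \<partial>M) =
        (\<Prod>k\<in>K. epow (A k) (p k)) * (\<integral>\<^sup>+x. (\<Prod>k\<in>K. epow (f k x / A k) (p k)) \<partial>M)"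
      by (simp add: nn_integral_cmult)
    also have "\<dots> \<le> (\<Prod>k\<in>K. epow (A k) (p k)) * (\<integral>\<^sup>+x. (\<Sum>k\<in>K. ennreal (p k) * (f k x / A k)) \<partial>M)"
      using assms by (intro mult_left_mono nn_integral_mono weighted_geom_mean_le_arith_mean) auto
    also have "(\<integral>\<^sup>+x. (\<Sum>k\<in>K. ennreal (p k) * (f k x / A k)) \<partial>M) = (\<Sum>k\<in>K. ennreal (p k) * (A k / A k))"
      by (subst nn_integral_sum)
        (auto intro!: sum.cong simp: nn_integral_cmult divide_ennreal_def nn_integral_multc A_def)
    also have "\<dots> = (\<Sum>k\<in>K. ennreal (p k))"
      using fin by (intro sum.cong) (auto simp: ennreal_divide_self less_top)
    also have "\<dots> = 1"
      using assms by (subst sum_ennreal) (auto simp: less_imp_le)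
    finally show ?thesis by (simp add: A_def)
  qed
qed

lemma nn_integral_Holder:
  assumes "finite K" "\<And>k. k \<in> K \<Longrightarrow> p k \<ge> 0" "sum p K = 1"
    and meas: "\<And>k. k \<in> K \<Longrightarrow> f k \<in> borel_measurable M"
  shows "(\<integral>\<^sup>+x. (\<Prod>k\<in>K. epow (f k x) (p k)) \<partial>M) \<le> (\<Prod>k\<in>K. epow (\<integral>\<^sup>+x. f k x \<partial>M) (p k))"
proof -
  define J where "J = {k\<in>K. p k > 0}"
  have J: "J \<subseteq> K" "\<And>k. k \<in> K - J \<Longrightarrow> p k = 0"
    using assms(2) by (auto simp: J_def less_le)
  have red: "(\<Prod>k\<in>K. epow (h k) (p k)) = (\<Prod>k\<in>J. epow (h k) (p k))" for h
    using J assms(1) by (intro prod.mono_neutral_right) auto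
  have "sum p J = 1"
    using assms J by (subst sum.mono_neutral_left[of K J p]) auto
  moreover have "finite J" "\<And>k. k \<in> J \<Longrightarrow> p k > 0" "\<And>k. k \<in> J \<Longrightarrow> f k \<in> borel_measurable M"
    using assms(1) meas by (auto simp: J_def)
  ultimately show ?thesis
    by (simp only: red nn_integral_Holder_pos)
qed

section \<open>The Loomis--Whitney--Finner inequality\<close>

text \<open>The function with index \<open>i \<in> I\<close> is integrated over its own coordinate and no longer depends on
  it; the indices in \<open>L - I\<close> belong to functions of all coordinates. The condition on \<open>p\<close> says that
  for each coordinate the functions which depend on it have exponents with sum one. Adding a coordinate \<open>j\<close>
  therefore costs one application of Hoelder's inequality in that coordinate to all functions but the \<open>j\<close>-th.
  During the induction on \<open>I\<close> the family indexed by \<open>L\<close> keeps its exponents: after freezing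
  coordinate \<open>j\<close>, the function with index \<open>j\<close> is one of the functions of all remaining
  coordinates.\<close>
theorem Loomis_Whitney_Finner_PiM:
  fixes M :: "'i \<Rightarrow> 'a measure"
  assumes "product_sigma_finite M" "finite L" "I \<subseteq> L"
    and p: "\<And>i. i \<in> L \<Longrightarrow> p i \<ge> (0::real)" "\<And>j. j \<in> I \<Longrightarrow> sum p (L - {j}) = 1"
    and meas: "\<And>i. i \<in> L \<Longrightarrow> v i \<in> borel_measurable (PiM I M)"
  shows "(\<integral>\<^sup>+x. (\<Prod>i\<in>I. epow (\<integral>\<^sup>+t. v i (x(i := t)) \<partial>M i) (p i)) *
             (\<Prod>i\<in>L - I. epow (v i x) (p i)) \<partial>PiM I M)
         \<le> (\<Prod>i\<in>L. epow (\<integral>\<^sup>+x. v i x \<partial>PiM I M) (p i))"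
proof -
  interpret product_sigma_finite M by fact
  have "finite I" using assms finite_subset by blast
  then show ?thesis using \<open>I \<subseteq> L\<close> p(2) meas
  proof (induction I arbitrary: v rule: finite_induct)
    case empty
    then show ?case
      by (simp add: nn_integral_empty)
  next
    case (insert j I)
    note [measurable] = insert.prems(3)
    have sf: "sigma_finite_measure (PiM I M)" using insert.hyps(1) by (rule sigma_finite)
    interpret sigma_finite_measure "PiM I M" by fact
    interpret P: finite_product_sigma_finite M I by standard fact
    have j: "j \<in> L" "I \<subseteq> L" using insert.prems by auto
    define F where "F x = (\<integral>\<^sup>+t. v j (x(j := t)) \<partial>M j)" for x
    have upd [measurable]: "(\<lambda>x. v i (x(j := t))) \<in> borel_measurable (PiM I M)"
      if "t \<in> space (M j)" "i \<in> L" for i t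
      using that by measurable
    have F [measurable]: "F \<in> borel_measurable (PiM I M)"
      unfolding F_def using j by measurable
    have slice: "(\<lambda>t. \<integral>\<^sup>+x. v i (x(j := t)) \<partial>PiM I M) \<in> borel_measurable (M j)"
      if "i \<in> L" for i
    proof -
      have *: "(\<lambda>(t, x). x(j := t)) \<in> M j \<Otimes>\<^sub>M PiM I M \<rightarrow>\<^sub>M PiM (insert j I) M"
        using measurable_compose[OF measurable_pair_swap' measurable_add_dim[of j I M]]
        by (simp add: split_beta')
      from measurable_compose[OF * insert.prems(3)[OF that]]
      have "(\<lambda>(t, x). v i (x(j := t))) \<in> borel_measurable (M j \<Otimes>\<^sub>M PiM I M)"
        by (simp add: split_beta' fun_upd_def)
      then show ?thesis by (rule borel_measurable_nn_integral)
    qed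
    \<comment> \<open>The family for the induction hypothesis at a fixed value \<open>t\<close> of coordinate \<open>j\<close>.\<close>
    define w where "w t i x = (if i = j then F x else v i (x(j := t)))" for t i x
    let ?G = "\<lambda>x. (\<Prod>i\<in>insert j I. epow (\<integral>\<^sup>+t. v i (x(i := t)) \<partial>M i) (p i)) *
             (\<Prod>i\<in>L - insert j I. epow (v i x) (p i))"
    have Gm [measurable]: "?G \<in> borel_measurable (PiM (insert j I) M)"
    proof -
      have "(\<lambda>x. \<integral>\<^sup>+t. v i (x(i := t)) \<partial>M i) \<in> borel_measurable (PiM (insert j I) M)" 
        if "i \<in> insert j I" for i
      proof -
        have "insert i (insert j I) = insert j I" using that by auto
        then have *: "(\<lambda>(x, t). x(i := t)) \<in> PiM (insert j I) M \<Otimes>\<^sub>M M i \<rightarrow>\<^sub>M PiM (insert j I) M"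
          using measurable_add_dim[of i "insert j I" M] by simp
        have "v i \<in> borel_measurable (PiM (insert j I) M)"
          using that insert.prems by blast
        from measurable_compose[OF * this]
        have "(\<lambda>(x, t). v i (x(i := t))) \<in> borel_measurable (PiM (insert j I) M \<Otimes>\<^sub>M M i)"
          by (simp add: split_beta')
        then show ?thesis by (rule sigma_finite_measure.borel_measurable_nn_integral[OF sigma_finite_measures])
      qed
      then show ?thesis
        using insert.prems by (intro borel_measurable_times_ennreal borel_measurable_prod_ennreal measurable_epow) auto
    qed
    have "(\<integral>\<^sup>+x. ?G x \<partial>PiM (insert j I) M) = (\<integral>\<^sup>+t. (\<integral>\<^sup>+x. ?G (x(j := t)) \<partial>PiM I M) \<partial>M j)"
      using insert.hyps by (intro product_nn_integral_insert_rev Gm)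
    also have "\<dots> \<le> (\<integral>\<^sup>+t. (\<Prod>i\<in>L. epow (\<integral>\<^sup>+x. w t i x \<partial>PiM I M) (p i)) \<partial>M j)"
    proof (rule nn_integral_mono)
      fix t assume t: "t \<in> space (M j)"
      have "?G (x(j := t)) = (\<Prod>i\<in>I. epow (\<integral>\<^sup>+s. w t i (x(i := s)) \<partial>M i) (p i)) *
             (\<Prod>i\<in>L - I. epow (w t i x) (p i))" for x
      proof -
        have "(\<Prod>i\<in>I. epow (\<integral>\<^sup>+s. w t i (x(i := s)) \<partial>M i) (p i)) =
            (\<Prod>i\<in>I. epow (\<integral>\<^sup>+s. v i (x(j := t, i := s)) \<partial>M i) (p i))"
        proof (rule prod.cong[OF refl])
          fix i assume "i \<in> I"
          then have "i \<noteq> j" using insert.hyps by auto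
          then show "epow (\<integral>\<^sup>+s. w t i (x(i := s)) \<partial>M i) (p i) = epow (\<integral>\<^sup>+s. v i (x(j := t, i := s)) \<partial>M i) (p i)"
            by (simp add: w_def fun_upd_twist)
        qed
        moreover have "(\<Prod>i\<in>L - I. epow (w t i x) (p i)) =
            epow (F x) (p j) * (\<Prod>i\<in>L - insert j I. epow (v i (x(j := t))) (p i))"
        proof -
          have "(\<Prod>i\<in>L - I. epow (w t i x) (p i)) = (\<Prod>i\<in>insert j (L - insert j I). epow (w t i x) (p i))"
            using j insert.hyps by (intro prod.cong) auto
          also have "\<dots> = epow (F x) (p j) * (\<Prod>i\<in>L - insert j I. epow (w t i x) (p i))"
            using \<open>finite L\<close> by (subst prod.insert) (auto simp: w_def)
          also have "(\<Prod>i\<in>L - insert j I. epow (w t i x) (p i)) = (\<Prod>i\<in>L - insert j I. epow (v i (x(j := t))) (p i))"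
            by (intro prod.cong) (auto simp: w_def)
          finally show ?thesis .
        qed
        ultimately show ?thesis
          using insert.hyps by (simp add: F_def mult_ac)
      qed
      then have "(\<integral>\<^sup>+x. ?G (x(j := t)) \<partial>PiM I M) = (\<integral>\<^sup>+x. (\<Prod>i\<in>I. epow (\<integral>\<^sup>+s. w t i (x(i := s)) \<partial>M i) (p i)) *
             (\<Prod>i\<in>L - I. epow (w t i x) (p i)) \<partial>PiM I M)" by simp
      also have "\<dots> \<le> (\<Prod>i\<in>L. epow (\<integral>\<^sup>+x. w t i x \<partial>PiM I M) (p i))"
      proof (rule insert.IH)
        fix i assume "i \<in> L"
        show "w t i \<in> borel_measurable (PiM I M)"
          unfolding w_def by (cases "i = j") (use F upd[OF t \<open>i \<in> L\<close>] in auto)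
      qed (use j insert.prems in auto)
      finally show "(\<integral>\<^sup>+x. ?G (x(j := t)) \<partial>PiM I M) \<le> (\<Prod>i\<in>L. epow (\<integral>\<^sup>+x. w t i x \<partial>PiM I M) (p i))" .
    qed
    also have "\<dots> = (\<integral>\<^sup>+t. epow (\<integral>\<^sup>+x. F x \<partial>PiM I M) (p j) *
        (\<Prod>i\<in>L - {j}. epow (\<integral>\<^sup>+x. v i (x(j := t)) \<partial>PiM I M) (p i)) \<partial>M j)"
    proof (rule nn_integral_cong)
      fix t
      have "w t j = F" by (simp add: w_def fun_eq_iff)
      have "(\<Prod>i\<in>L. epow (\<integral>\<^sup>+x. w t i x \<partial>PiM I M) (p i)) = epow (\<integral>\<^sup>+x. F x \<partial>PiM I M) (p j) *
         (\<Prod>i\<in>L - {j}. epow (\<integral>\<^sup>+x. w t i x \<partial>PiM I M) (p i))"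
        using j \<open>finite L\<close> \<open>w t j = F\<close> by (subst prod.remove[of L j]) auto
      also have "(\<Prod>i\<in>L - {j}. epow (\<integral>\<^sup>+x. w t i x \<partial>PiM I M) (p i)) =
         (\<Prod>i\<in>L - {j}. epow (\<integral>\<^sup>+x. v i (x(j := t)) \<partial>PiM I M) (p i))"
        by (intro prod.cong) (auto simp: w_def)
      finally show "(\<Prod>i\<in>L. epow (\<integral>\<^sup>+x. w t i x \<partial>PiM I M) (p i)) = epow (\<integral>\<^sup>+x. F x \<partial>PiM I M) (p j) *
        (\<Prod>i\<in>L - {j}. epow (\<integral>\<^sup>+x. v i (x(j := t)) \<partial>PiM I M) (p i))" .
    qed
    also have "\<dots> = epow (\<integral>\<^sup>+x. F x \<partial>PiM I M) (p j) * (\<integral>\<^sup>+t.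
        (\<Prod>i\<in>L - {j}. epow (\<integral>\<^sup>+x. v i (x(j := t)) \<partial>PiM I M) (p i)) \<partial>M j)"
      using slice by (intro nn_integral_cmult borel_measurable_prod_ennreal measurable_epow) auto
    also have "\<dots> \<le> epow (\<integral>\<^sup>+x. F x \<partial>PiM I M) (p j) *
        (\<Prod>i\<in>L - {j}. epow (\<integral>\<^sup>+t. \<integral>\<^sup>+x. v i (x(j := t)) \<partial>PiM I M \<partial>M j) (p i))"
    proof (intro mult_left_mono nn_integral_Holder)
      fix i assume "i \<in> L - {j}"
      then show "(\<lambda>t. \<integral>\<^sup>+x. v i (x(j := t)) \<partial>PiM I M) \<in> borel_measurable (M j)"
        by (simp add: slice)
    qed (use \<open>finite L\<close> p insert.prems in auto)
    also have "(\<integral>\<^sup>+x. F x \<partial>PiM I M) = (\<integral>\<^sup>+x. v j x \<partial>PiM (insert j I) M)"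
      unfolding F_def using insert j by (subst product_nn_integral_insert) auto
    also have "(\<Prod>i\<in>L - {j}. epow (\<integral>\<^sup>+t. \<integral>\<^sup>+x. v i (x(j := t)) \<partial>PiM I M \<partial>M j) (p i)) =
        (\<Prod>i\<in>L - {j}. epow (\<integral>\<^sup>+x. v i x \<partial>PiM (insert j I) M) (p i))"
      using insert by (intro prod.cong refl) (subst product_nn_integral_insert_rev, auto)
    also have "epow (\<integral>\<^sup>+x. v j x \<partial>PiM (insert j I) M) (p j) * \<dots> =
       (\<Prod>i\<in>L. epow (\<integral>\<^sup>+x. v i x \<partial>PiM (insert j I) M) (p i))"
      using \<open>finite L\<close> j by (simp add: prod.remove[of L j])
    finally show ?case .
  qed
qed

text \<open>Coordinates are indexed by \<open>Basis\<close>. The additional function \<open>G\<close> of all coordinates gets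
  the index \<open>0\<close>, which is not a basis vector.\<close>
theorem Loomis_Whitney_Finner_lborel:
  fixes u :: "'a::euclidean_space \<Rightarrow> 'a \<Rightarrow> ennreal" and G :: "'a \<Rightarrow> ennreal" and w p :: real
  assumes w: "w \<ge> 0" "p \<ge> 0" "p + (real DIM('a) - 1) * w = 1"
    and u: "\<And>b. b \<in> Basis \<Longrightarrow> u b \<in> borel_measurable borel" and G: "G \<in> borel_measurable borel"
  shows "(\<integral>\<^sup>+x. epow (G x) p * (\<Prod>b\<in>Basis. epow (\<integral>\<^sup>+t. u b (x + t *\<^sub>R b) \<partial>lborel) w) \<partial>lborel)
     \<le> epow (\<integral>\<^sup>+x. G x \<partial>lborel) p * (\<Prod>b\<in>Basis. epow (\<integral>\<^sup>+x. u b x \<partial>lborel) w)"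
proof -
  define \<Phi> :: "('a \<Rightarrow> real) \<Rightarrow> 'a" where "\<Phi> f = (\<Sum>b\<in>Basis. f b *\<^sub>R b)" for f
  let ?P = "PiM (Basis :: 'a set) (\<lambda>_. lborel :: real measure)"
  have \<Phi>: "\<Phi> \<in> ?P \<rightarrow>\<^sub>M borel"
    unfolding \<Phi>_def by measurable
  have int: "(\<integral>\<^sup>+x. h x \<partial>lborel) = (\<integral>\<^sup>+f. h (\<Phi> f) \<partial>?P)" if "h \<in> borel_measurable borel" for h :: "'a \<Rightarrow> ennreal"
    using \<Phi> that unfolding \<Phi>_def by (subst lborel_eq, subst nn_integral_distr) auto
  define v where "v i f = (if i = 0 then G (\<Phi> f) else u i (\<Phi> f))" for i f
  define q where "q i = (if i = 0 then p else w)" for i :: 'a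
  have upd: "\<Phi> (f(b := t)) = \<Phi> f + (t - f b) *\<^sub>R b" if "b \<in> Basis" for f b t
  proof -
    have "\<Phi> (f(b := t)) = t *\<^sub>R b + (\<Sum>c\<in>Basis - {b}. f c *\<^sub>R c)"
      unfolding \<Phi>_def using that by (subst sum.remove[of _ b]) (auto intro!: sum.cong)
    moreover have "\<Phi> f = f b *\<^sub>R b + (\<Sum>c\<in>Basis - {b}. f c *\<^sub>R c)"
      unfolding \<Phi>_def using that by (subst sum.remove[of _ b]) auto
    ultimately show ?thesis by (simp add: algebra_simps)
  qed
  have slice: "(\<integral>\<^sup>+t. v b (f(b := t)) \<partial>lborel) = (\<integral>\<^sup>+t. u b (\<Phi> f + t *\<^sub>R b) \<partial>lborel)" if b: "b \<in> Basis" for b f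
  proof -
    have "(\<lambda>t. u b (\<Phi> f + t *\<^sub>R b)) \<in> borel_measurable borel"
      using u[OF b] by measurable
    from nn_integral_real_affine[OF this, of 1 "- f b"]
    show ?thesis using b by (simp add: v_def upd nonzero_Basis algebra_simps)
  qed
  have wm: "(\<lambda>x. \<integral>\<^sup>+t. u b (x + t *\<^sub>R b) \<partial>lborel) \<in> borel_measurable borel" if "b \<in> Basis" for b
  proof -
    have [measurable]: "u b \<in> borel_measurable borel" using u that by simp
    show ?thesis by (rule lborel.borel_measurable_nn_integral) measurable
  qed
  have "(\<integral>\<^sup>+x. epow (G x) p * (\<Prod>b\<in>Basis. epow (\<integral>\<^sup>+t. u b (x + t *\<^sub>R b) \<partial>lborel) w) \<partial>lborel)
     = (\<integral>\<^sup>+f. epow (G (\<Phi> f)) p * (\<Prod>b\<in>Basis. epow (\<integral>\<^sup>+t. u b (\<Phi> f + t *\<^sub>R b) \<partial>lborel) w) \<partial>?P)"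
    using G wm by (intro int borel_measurable_times_ennreal borel_measurable_prod_ennreal measurable_epow) auto
  also have "\<dots> = (\<integral>\<^sup>+f. (\<Prod>i\<in>Basis. epow (\<integral>\<^sup>+t. v i (f(i := t)) \<partial>lborel) (q i)) *
             (\<Prod>i\<in>insert 0 Basis - Basis. epow (v i f) (q i)) \<partial>?P)"
  proof -
    have "insert 0 Basis - Basis = {0::'a}" by auto
    moreover have "(\<Prod>b\<in>Basis. epow (\<integral>\<^sup>+t. u b (\<Phi> f + t *\<^sub>R b) \<partial>lborel) w) =
      (\<Prod>i\<in>Basis. epow (\<integral>\<^sup>+t. v i (f(i := t)) \<partial>lborel) (q i))" for f
      by (intro prod.cong) (auto simp: slice q_def)
    ultimately show ?thesis by (simp add: mult.commute v_def q_def)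
  qed
  also have "\<dots> \<le> (\<Prod>i\<in>insert 0 Basis. epow (\<integral>\<^sup>+f. v i f \<partial>?P) (q i))"
  proof (rule Loomis_Whitney_Finner_PiM)
    show "product_sigma_finite (\<lambda>i::'a. lborel :: real measure)"
      by (simp add: product_sigma_finite_def sigma_finite_lborel)
    fix j :: 'a assume j: "j \<in> Basis"
    have "insert 0 Basis - {j} = insert 0 (Basis - {j})" using j by auto
    then have "sum q (insert 0 Basis - {j}) = q 0 + sum q (Basis - {j})" by simp
    also have "sum q (Basis - {j}) = sum (\<lambda>_. w) (Basis - {j})"
      by (intro sum.cong) (auto simp: q_def)
    finally show "sum q (insert 0 Basis - {j}) = 1"
      using w j DIM_positive[where 'a='a] by (simp add: q_def card_Diff_singleton of_nat_diff Suc_leI)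
  next
    fix i :: 'a assume "i \<in> insert 0 Basis"
    then show "v i \<in> borel_measurable ?P"
      unfolding v_def using measurable_compose[OF \<Phi> G] measurable_compose[OF \<Phi> u] by (cases "i = 0") auto
  qed (use w in \<open>auto simp: q_def\<close>)
  also have "\<dots> = epow (\<integral>\<^sup>+f. G (\<Phi> f) \<partial>?P) p * (\<Prod>b\<in>Basis. epow (\<integral>\<^sup>+f. u b (\<Phi> f) \<partial>?P) w)"
  proof -
    have "(\<Prod>i\<in>Basis. epow (\<integral>\<^sup>+f. v i f \<partial>?P) (q i)) = (\<Prod>b\<in>Basis. epow (\<integral>\<^sup>+f. u b (\<Phi> f) \<partial>?P) w)"
      by (intro prod.cong) (auto simp: v_def q_def)
    then show ?thesis by (simp add: v_def q_def)
  qed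
  also have "\<dots> = epow (\<integral>\<^sup>+x. G x \<partial>lborel) p * (\<Prod>b\<in>Basis. epow (\<integral>\<^sup>+x. u b x \<partial>lborel) w)"
    using u G by (simp add: int)
  finally show ?thesis .
qed

section \<open>Upper slopes and their integrals\<close>

text \<open>The distance to the boundary is Lipschitz but need not be differentiable, so increments along lines are
  controlled by an upper bound for the local Lipschitz constant. Such bounds obey a product and a chain rule, and they
  suffice for the inequality in the fundamental theorem of calculus.\<close>
definition slope_le :: "(real \<Rightarrow> real) \<Rightarrow> real \<Rightarrow> real \<Rightarrow> bool" where
  "slope_le h x k \<longleftrightarrow> (\<forall>\<epsilon>>0. \<forall>\<^sub>F z in nhds x. \<bar>h z - h x\<bar> \<le> (k + \<epsilon>) * \<bar>z - x\<bar>)"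

lemma slope_leI_DERIV:
  assumes "(h has_real_derivative D) (at x)"
  shows "slope_le h x \<bar>D\<bar>"
  unfolding slope_le_def
proof (intro allI impI)
  fix \<epsilon> :: real assume "\<epsilon> > 0"
  have "((\<lambda>z. (h z - h x) / (z - x)) \<longlongrightarrow> D) (at x)"
    using assms by (simp add: has_field_derivative_iff)
  then have "\<forall>\<^sub>F z in at x. \<bar>(h z - h x) / (z - x)\<bar> < \<bar>D\<bar> + \<epsilon>"
    using \<open>\<epsilon> > 0\<close> by (intro order_tendstoD(2)[OF tendsto_rabs]) auto
  then have "\<forall>\<^sub>F z in at x. \<bar>h z - h x\<bar> \<le> (\<bar>D\<bar> + \<epsilon>) * \<bar>z - x\<bar>"
    unfolding eventually_at_filter
    by eventually_elim (auto simp: abs_divide divide_simps split: if_splits)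
  then show "\<forall>\<^sub>F z in nhds x. \<bar>h z - h x\<bar> \<le> (\<bar>D\<bar> + \<epsilon>) * \<bar>z - x\<bar>"
    unfolding eventually_at_filter
  proof eventually_elim
    case (elim z)
    then show ?case by (cases "z = x") auto
  qed
qed

lemma slope_leI_Lipschitz:
  assumes "\<And>z. \<bar>h z - h x\<bar> \<le> k * \<bar>z - x\<bar>"
  shows "slope_le h x k"
  unfolding slope_le_def
proof (intro allI impI always_eventually)
  fix \<epsilon> z :: real assume "\<epsilon> > 0"
  have "k * \<bar>z - x\<bar> \<le> (k + \<epsilon>) * \<bar>z - x\<bar>"
    using \<open>\<epsilon> > 0\<close> by (intro mult_right_mono) auto
  then show "\<bar>h z - h x\<bar> \<le> (k + \<epsilon>) * \<bar>z - x\<bar>" using assms[of z] by linarith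
qed

lemma slope_le_imp_isCont:
  assumes "slope_le h x k"
  shows "isCont h x"
proof -
  have ev: "\<forall>\<^sub>F z in at x. norm (h z - h x) \<le> (k + 1) * \<bar>z - x\<bar>"
    using assms[unfolded slope_le_def, rule_format, of 1] by (auto intro: eventually_nhds_x_imp_x eventually_at_filter[THEN iffD2] elim: eventually_mono)
  have "((\<lambda>z. (k + 1) * \<bar>z - x\<bar>) \<longlongrightarrow> (k + 1) * \<bar>x - x\<bar>) (at x)"
    by (intro tendsto_intros)
  then have "((\<lambda>z. (k + 1) * \<bar>z - x\<bar>) \<longlongrightarrow> 0) (at x)" by simp
  from Lim_null_comparison[OF ev this]
  show ?thesis unfolding isCont_def by (simp add: LIM_zero_iff)
qed

text \<open>Used to turn an error in the data of the product and chain rules into a prescribed final error.\<close>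
lemma small_perturbation:
  fixes P :: "real \<Rightarrow> real"
  assumes "isCont P 0" "\<epsilon> > 0"
  obtains \<delta> where "\<delta> > 0" "P \<delta> \<le> P 0 + \<epsilon>"
proof -
  have "(P \<longlongrightarrow> P 0) (at_right 0)"
    using assms(1) unfolding isCont_def by (rule tendsto_mono[OF at_within_le_at])
  then have "\<forall>\<^sub>F \<delta> in at_right 0. P \<delta> < P 0 + \<epsilon>"
    using assms(2) by (intro order_tendstoD(2)) auto
  then have "\<forall>\<^sub>F \<delta> in at_right 0. 0 < \<delta> \<and> P \<delta> \<le> P 0 + \<epsilon>"
    using eventually_at_right_less[of "0::real"] by eventually_elim auto
  then show ?thesis
    using that eventually_happens'[OF trivial_limit_at_right_real] by blast
qed

lemma slope_le_mult:
  assumes w: "slope_le w x W" and u: "slope_le u x k"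
  shows "slope_le (\<lambda>z. w z * u z) x (\<bar>w x\<bar> * k + W * \<bar>u x\<bar>)"
  unfolding slope_le_def
proof (intro allI impI)
  fix \<epsilon> :: real assume "\<epsilon> > 0"
  \<comment> \<open>The claimed slope after \<open>|w x|\<close> and both given slopes have grown by \<open>\<delta>\<close>.\<close>
  define P where "P \<delta> = (\<bar>w x\<bar> + \<delta>) * (k + \<delta>) + (W + \<delta>) * \<bar>u x\<bar>" for \<delta>
  obtain \<delta> where \<delta>: "\<delta> > 0" "P \<delta> \<le> P 0 + \<epsilon>"
  proof (rule small_perturbation[OF _ \<open>\<epsilon> > 0\<close>, of P])
    show "isCont P 0" unfolding P_def by (intro continuous_intros)
  qed
  have "\<forall>\<^sub>F z in nhds x. \<bar>w z\<bar> < \<bar>w x\<bar> + \<delta>"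
    using slope_le_imp_isCont[OF w] \<delta>(1)
    by (intro order_tendstoD(2)[OF tendsto_rabs]) (auto simp: continuous_at_imp_continuous_at_within isCont_def tendsto_at_iff_tendsto_nhds)
  moreover have "\<forall>\<^sub>F z in nhds x. \<bar>w z - w x\<bar> \<le> (W + \<delta>) * \<bar>z - x\<bar>" "\<forall>\<^sub>F z in nhds x. \<bar>u z - u x\<bar> \<le> (k + \<delta>) * \<bar>z - x\<bar>"
    using w u \<delta>(1) by (auto simp: slope_le_def)
  ultimately show "\<forall>\<^sub>F z in nhds x. \<bar>w z * u z - w x * u x\<bar> \<le> (\<bar>w x\<bar> * k + W * \<bar>u x\<bar> + \<epsilon>) * \<bar>z - x\<bar>"
  proof eventually_elim
    case (elim z)
    have "\<bar>w z * u z - w x * u x\<bar> = \<bar>w z * (u z - u x) + (w z - w x) * u x\<bar>"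
      by (simp add: algebra_simps)
    also have "\<dots> \<le> \<bar>w z\<bar> * \<bar>u z - u x\<bar> + \<bar>w z - w x\<bar> * \<bar>u x\<bar>"
      by (metis abs_mult abs_triangle_ineq)
    also have "\<dots> \<le> (\<bar>w x\<bar> + \<delta>) * ((k + \<delta>) * \<bar>z - x\<bar>) + ((W + \<delta>) * \<bar>z - x\<bar>) * \<bar>u x\<bar>"
      using elim \<delta> by (intro add_mono mult_mono) auto
    also have "\<dots> = P \<delta> * \<bar>z - x\<bar>" by (simp add: P_def algebra_simps)
    also have "\<dots> \<le> (P 0 + \<epsilon>) * \<bar>z - x\<bar>"
      using \<delta> by (intro mult_right_mono) auto
    finally show ?case by (simp add: P_def)
  qed
qed

lemma slope_le_compose:
  assumes \<phi>: "slope_le \<phi> (d x) k" and d: "slope_le d x m" and "k \<ge> 0"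
  shows "slope_le (\<lambda>z. \<phi> (d z)) x (k * m)"
  unfolding slope_le_def
proof (intro allI impI)
  fix \<epsilon> :: real assume "\<epsilon> > 0"
  obtain \<delta> where \<delta>: "\<delta> > 0" "(k + \<delta>) * (m + \<delta>) \<le> (k + 0) * (m + 0) + \<epsilon>"
    using small_perturbation[OF _ \<open>\<epsilon> > 0\<close>, of "\<lambda>\<delta>. (k + \<delta>) * (m + \<delta>)"] by auto
  have "filterlim d (nhds (d x)) (nhds x)"
    using slope_le_imp_isCont[OF d] by (simp add: isCont_def tendsto_at_iff_tendsto_nhds)
  then have "\<forall>\<^sub>F z in nhds x. \<bar>\<phi> (d z) - \<phi> (d x)\<bar> \<le> (k + \<delta>) * \<bar>d z - d x\<bar>"
    using \<phi> \<delta>(1) unfolding slope_le_def by (auto elim: eventually_compose_filterlim)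
  moreover have "\<forall>\<^sub>F z in nhds x. \<bar>d z - d x\<bar> \<le> (m + \<delta>) * \<bar>z - x\<bar>"
    using d \<delta>(1) by (auto simp: slope_le_def)
  ultimately show "\<forall>\<^sub>F z in nhds x. \<bar>\<phi> (d z) - \<phi> (d x)\<bar> \<le> (k * m + \<epsilon>) * \<bar>z - x\<bar>"
  proof eventually_elim
    case (elim z)
    have "\<bar>\<phi> (d z) - \<phi> (d x)\<bar> \<le> (k + \<delta>) * ((m + \<delta>) * \<bar>z - x\<bar>)"
      using elim \<delta> \<open>k \<ge> 0\<close> by (meson add_nonneg_nonneg less_imp_le mult_left_mono order_trans)
    also have "\<dots> = ((k + \<delta>) * (m + \<delta>)) * \<bar>z - x\<bar>" by simp
    also have "\<dots> \<le> (k * m + \<epsilon>) * \<bar>z - x\<bar>"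
      using \<delta> by (intro mult_right_mono) auto
    finally show ?case .
  qed
qed

lemma slope_le_powr:
  assumes "y > 0"
  shows "slope_le (\<lambda>z. z powr a) y \<bar>a * y powr (a - 1)\<bar>"
  using has_real_derivative_powr[OF assms, of a] by (rule slope_leI_DERIV)

text \<open>At \<open>y = 0\<close> the bound is \<open>0\<close>; this is where \<open>p > 1\<close> enters.\<close>
lemma slope_le_abs_powr:
  assumes "p > 1"
  shows "slope_le (\<lambda>z. \<bar>z\<bar> powr p) y (p * \<bar>y\<bar> powr (p - 1))"
proof (cases "y = 0")
  case True
  have "slope_le (\<lambda>z. \<bar>z\<bar> powr p) 0 0"
    unfolding slope_le_def
  proof (intro allI impI)
    fix \<epsilon> :: real assume "\<epsilon> > 0"
    have "((\<lambda>z::real. \<bar>z\<bar> powr (p - 1)) \<longlongrightarrow> 0) (nhds 0)"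
      using assms by (auto intro!: tendsto_eq_intros filterlim_ident)
    then have "\<forall>\<^sub>F z::real in nhds 0. \<bar>z\<bar> powr (p - 1) < \<epsilon>"
      using \<open>\<epsilon> > 0\<close> by (intro order_tendstoD(2)) auto
    then show "\<forall>\<^sub>F z in nhds 0. \<bar>\<bar>z\<bar> powr p - \<bar>0\<bar> powr p\<bar> \<le> (0 + \<epsilon>) * \<bar>z - 0\<bar>"
    proof eventually_elim
      case (elim z)
      have "\<bar>z\<bar> powr p = \<bar>z\<bar> powr (p - 1) * \<bar>z\<bar>"
        by (cases "z = 0") (auto simp: powr_diff)
      then show ?case using elim by (simp add: mult_right_mono)
    qed
  qed
  then show ?thesis using True by simp
next
  case False
  have "slope_le abs y 1"
    by (rule slope_leI_Lipschitz) (simp add: abs_triangle_ineq3)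
  moreover have "slope_le (\<lambda>z. z powr p) \<bar>y\<bar> (p * \<bar>y\<bar> powr (p - 1))"
    using slope_le_powr[of "\<bar>y\<bar>" p] False assms by (simp add: abs_mult)
  ultimately show ?thesis
    using slope_le_compose[of "\<lambda>z. z powr p" abs y _ 1] assms by simp
qed

text \<open>For every \<open>\<epsilon> > 0\<close> the slope bound and the differentiability of \<open>x \<mapsto> integral
  {a..x} K\<close> give the claim with an error \<open>2 * \<epsilon> * (z - y)\<close> on all short intervals \<open>[y,
  z]\<close> around a given point. This statement is additive in the interval, so the bisection principle carries it over to
  \<open>[a, b]\<close>.\<close>
lemma increment_le_integral_slope:
  fixes h K :: "real \<Rightarrow> real"
  assumes "a \<le> b" and K: "continuous_on {a..b} K"
    and slope: "\<And>x. x \<in> {a..b} \<Longrightarrow> slope_le h x (K x)"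
  shows "\<bar>h b - h a\<bar> \<le> integral {a..b} K"
proof -
  define F where "F x = integral {a..x} K" for x
  have F: "(F has_real_derivative K x) (at x within {a..b})" if "x \<in> {a..b}" for x
    unfolding F_def using K that by (rule integral_has_real_derivative)
  have "\<bar>h b - h a\<bar> \<le> F b - F a + 2 * \<epsilon> * (b - a)" if "\<epsilon> > 0" for \<epsilon>
  proof -
    \<comment> \<open>The bisection principle considers all intervals around a point, also those that reach beyond \<open>[a, b]\<close>.\<close>
    define P where "P y z \<longleftrightarrow> (a \<le> y \<longrightarrow> z \<le> b \<longrightarrow> \<bar>h z - h y\<bar> \<le> F z - F y + 2 * \<epsilon> * (z - y))" for y z
    have "P a b"
      using \<open>a \<le> b\<close>
    proof (induction rule: Bolzano)
      case (trans x y z)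
      then show ?case unfolding P_def by (auto simp: algebra_simps)
    next
      case (local x)
      then have x: "x \<in> {a..b}" by simp
      have "\<forall>\<^sub>F z in nhds x. \<bar>h z - h x\<bar> \<le> (K x + \<epsilon>) * \<bar>z - x\<bar>"
        using slope[OF x] \<open>\<epsilon> > 0\<close> by (simp add: slope_le_def)
      then obtain d1 where d1: "d1 > 0" "\<And>z. \<bar>z - x\<bar> < d1 \<Longrightarrow> \<bar>h z - h x\<bar> \<le> (K x + \<epsilon>) * \<bar>z - x\<bar>"
        by (auto simp: eventually_nhds_metric dist_real_def)
      have "\<exists>d>0. \<forall>y\<in>{a..b}. norm (y - x) < d \<longrightarrow> norm (F y - F x - K x * (y - x)) \<le> \<epsilon> * norm (y - x)"
        using F[OF x] \<open>\<epsilon> > 0\<close> unfolding has_field_derivative_def has_derivative_within_alt by auto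
      then obtain d2 where d2: "d2 > 0" "\<And>z. z \<in> {a..b} \<Longrightarrow> \<bar>z - x\<bar> < d2 \<Longrightarrow> \<bar>F z - F x - K x * (z - x)\<bar> \<le> \<epsilon> * \<bar>z - x\<bar>"
        by auto
      show ?case
      proof (intro exI[of _ "min d1 d2"] conjI allI impI)
        fix y z assume yz: "y \<le> x \<and> x \<le> z \<and> z - y < min d1 d2"
        show "P y z" unfolding P_def
        proof (intro impI)
          assume "a \<le> y" "z \<le> b"
          then have "\<bar>h z - h x\<bar> \<le> (K x + \<epsilon>) * (z - x)" "\<bar>h y - h x\<bar> \<le> (K x + \<epsilon>) * (x - y)"
            "\<bar>F z - F x - K x * (z - x)\<bar> \<le> \<epsilon> * (z - x)" "\<bar>F y - F x - K x * (y - x)\<bar> \<le> \<epsilon> * (x - y)"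
            using d1(2)[of z] d1(2)[of y] d2(2)[of z] d2(2)[of y] yz by auto
          then show "\<bar>h z - h y\<bar> \<le> F z - F y + 2 * \<epsilon> * (z - y)"
            by (simp add: algebra_simps abs_le_iff)
        qed
      qed (use d1 d2 in auto)
    qed
    then show ?thesis by (simp add: P_def)
  qed
  note * = this
  have "\<bar>h b - h a\<bar> \<le> F b - F a"
  proof (rule field_le_epsilon)
    fix e :: real assume "e > 0"
    have "2 * (e / (2 * (b - a + 1))) * (b - a) \<le> e"
      using \<open>a \<le> b\<close> \<open>e > 0\<close> by (simp add: field_simps)
    then show "\<bar>h b - h a\<bar> \<le> F b - F a + e"
      using *[of "e / (2 * (b - a + 1))"] \<open>a \<le> b\<close> \<open>e > 0\<close> by simp
  qed
  then show ?thesis by (simp add: F_def)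
qed

lemma increment_le_nn_integral_slope:
  fixes h K :: "real \<Rightarrow> real"
  assumes "a \<le> b" and K: "continuous_on {a..b} K" "\<And>x. x \<in> {a..b} \<Longrightarrow> K x \<ge> 0"
    and slope: "\<And>x. x \<in> {a..b} \<Longrightarrow> slope_le h x (K x)"
  shows "ennreal \<bar>h b - h a\<bar> \<le> (\<integral>\<^sup>+x. ennreal (K x) * indicator {a..b} x \<partial>lborel)"
proof -
  have "(K has_integral integral {a..b} K) {a..b}"
    using integrable_continuous_real[OF K(1)] by (rule integrable_integral)
  with K(2) have "(\<integral>\<^sup>+x. ennreal (K x) * indicator {a..b} x \<partial>lborel) = ennreal (integral {a..b} K)"
    by (rule nn_integral_has_integral_lebesgue')
  then show ?thesis
    using increment_le_integral_slope[OF assms(1) K(1) slope] by (simp add: ennreal_leI)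
qed

section \<open>The distance to a smooth boundary\<close>

lemma smooth_on_UNIV_derivative:
  assumes "smooth_on UNIV f"
  shows "(f has_derivative frechet_derivative f (at x)) (at x)"
    and "continuous_on UNIV (\<lambda>x. frechet_derivative f (at x) v)"
proof -
  have "C_n_on (Suc 0) UNIV f" using assms unfolding smooth_on_def by blast
  then show "(f has_derivative frechet_derivative f (at x)) (at x)"
    and "continuous_on UNIV (\<lambda>x. frechet_derivative f (at x) v)"
    by (auto simp: frechet_derivative_works[symmetric])
qed

lemma C1_imp_Lipschitz_on_cball:
  fixes f :: "'a::euclidean_space \<Rightarrow> real"
  assumes f: "\<And>x. (f has_derivative f' x) (at x)" and cont: "\<And>v. continuous_on UNIV (\<lambda>x. f' x v)"
  obtains L where "L \<ge> 0" "\<And>x y. x \<in> cball c R \<Longrightarrow> y \<in> cball c R \<Longrightarrow> \<bar>f x - f y\<bar> \<le> L * norm (x - y)"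
proof -
  define M where "M x = (\<Sum>b\<in>Basis. \<bar>f' x b\<bar>)" for x
  have "continuous_on (cball c R) M"
    unfolding M_def by (intro continuous_intros continuous_on_subset[OF cont]) auto
  then have "bounded (M ` cball c R)"
    by (intro compact_imp_bounded compact_continuous_image) auto
  then obtain B where B: "B > 0" "\<And>x. x \<in> cball c R \<Longrightarrow> norm (M x) \<le> B"
    by (auto simp: bounded_pos)
  have on: "onorm (f' x) \<le> B" if "x \<in> cball c R" for x
  proof (rule onorm_le)
    fix v :: 'a
    interpret bounded_linear "f' x" using f by (rule has_derivative_bounded_linear)
    have "f' x v = f' x (\<Sum>b\<in>Basis. (v \<bullet> b) *\<^sub>R b)" by (simp add: euclidean_representation)
    also have "\<dots> = (\<Sum>b\<in>Basis. (v \<bullet> b) * f' x b)" by (simp add: sum scaleR)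
    finally have "norm (f' x v) \<le> (\<Sum>b\<in>Basis. \<bar>v \<bullet> b\<bar> * \<bar>f' x b\<bar>)"
      using sum_abs[of "\<lambda>b. (v \<bullet> b) * f' x b" Basis] by (simp add: abs_mult)
    also have "\<dots> \<le> (\<Sum>b\<in>Basis. norm v * \<bar>f' x b\<bar>)"
      by (intro sum_mono mult_right_mono) (auto simp: Basis_le_norm)
    also have "\<dots> = norm v * M x" by (simp add: M_def sum_distrib_left)
    also have "\<dots> \<le> norm v * B" using B(2)[OF that] by (intro mult_left_mono) auto
    finally show "norm (f' x v) \<le> B * norm v" by (simp add: mult.commute)
  qed
  show ?thesis
  proof (rule that[of B])
    fix x y assume "x \<in> cball c R" "y \<in> cball c R"
    then show "\<bar>f x - f y\<bar> \<le> B * norm (x - y)"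
      using differentiable_bound[of "cball c R" f f' B x y] on f
      by (auto intro: has_derivative_at_withinI)
  qed (use B in auto)
qed

text \<open>The vertical height \<open>s\<close> above the graph. Three properties are all that is used of the smoothness of
  the boundary: the sign of \<open>s\<close> decides membership, \<open>s\<close> is Lipschitz, and \<open>s\<close> grows
  with unit speed in the vertical direction.\<close>
lemma boundary_height_function:
  fixes \<Omega> :: "'a::euclidean_space set"
  assumes "smooth_boundary \<Omega>" "q \<in> frontier \<Omega>"
  obtains r L :: real and e :: 'a and s :: "'a \<Rightarrow> real" where "r > 0" "L > 0" "norm e = 1"
    "\<And>x. x \<in> ball q r \<Longrightarrow> x \<in> \<Omega> \<longleftrightarrow> s x > 0"
    "\<And>x y. x \<in> ball q r \<Longrightarrow> y \<in> ball q r \<Longrightarrow> \<bar>s x - s y\<bar> \<le> L * norm (x - y)"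
    "\<And>x t. s (x + t *\<^sub>R e) = s x + t"
proof -
  from assms obtain r e and \<gamma> :: "'a \<Rightarrow> real" where r: "r > 0" and e: "norm e = 1" and \<gamma>: "smooth_on UNIV \<gamma>"
    and \<Omega>: "\<Omega> \<inter> ball q r = {x \<in> ball q r. \<gamma> (x - (x \<bullet> e) *\<^sub>R e) < x \<bullet> e}"
    unfolding smooth_boundary_def by blast
  define pr where "pr x = x - (x \<bullet> e) *\<^sub>R e" for x
  define s where "s x = x \<bullet> e - \<gamma> (pr x)" for x
  have ee: "e \<bullet> e = 1" using e by (simp add: dot_square_norm)
  have pr_norm: "norm (pr x) \<le> norm x" for x
  proof (rule power2_le_imp_le)
    have "(norm (pr x))\<^sup>2 = (norm x)\<^sup>2 - (x \<bullet> e)\<^sup>2"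
      unfolding power2_norm_eq_inner pr_def
      by (simp only: inner_diff_left inner_diff_right inner_scaleR_left inner_scaleR_right ee inner_commute[of e x]
        power2_eq_square mult_1_right) algebra
    then show "(norm (pr x))\<^sup>2 \<le> (norm x)\<^sup>2" by simp
  qed simp
  have pr_diff: "pr x - pr y = pr (x - y)" for x y
    by (simp add: pr_def inner_diff_left scaleR_diff_left)
  obtain L where L: "L \<ge> 0" "\<And>x y. x \<in> cball 0 (norm q + r) \<Longrightarrow> y \<in> cball 0 (norm q + r) \<Longrightarrow> \<bar>\<gamma> x - \<gamma> y\<bar> \<le> L * norm (x - y)"
    using C1_imp_Lipschitz_on_cball[OF smooth_on_UNIV_derivative[OF \<gamma>]] by blast
  have in_cball: "pr x \<in> cball 0 (norm q + r)" if "x \<in> ball q r" for x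
    using that pr_norm[of x] norm_triangle_ineq2[of x q] by (simp add: dist_norm norm_minus_commute)
  show ?thesis
  proof (rule that[of r "1 + L" e s])
    fix x assume "x \<in> ball q r"
    then have "x \<in> \<Omega> \<longleftrightarrow> \<gamma> (pr x) < x \<bullet> e" using \<Omega> unfolding pr_def by blast
    then show "x \<in> \<Omega> \<longleftrightarrow> s x > 0" by (simp add: s_def)
  next
    fix x y assume xy: "x \<in> ball q r" "y \<in> ball q r"
    have "\<bar>s x - s y\<bar> \<le> \<bar>(x - y) \<bullet> e\<bar> + \<bar>\<gamma> (pr x) - \<gamma> (pr y)\<bar>"
      by (simp add: s_def inner_diff_left)
    also have "\<bar>(x - y) \<bullet> e\<bar> \<le> norm (x - y)"
      using Cauchy_Schwarz_ineq2[of "x - y" e] e by simp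
    also have "\<bar>\<gamma> (pr x) - \<gamma> (pr y)\<bar> \<le> L * norm (pr x - pr y)"
      using xy in_cball by (intro L) auto
    also have "\<dots> \<le> L * norm (x - y)"
      using L(1) pr_norm[of "x - y"] by (simp add: pr_diff mult_left_mono)
    finally show "\<bar>s x - s y\<bar> \<le> (1 + L) * norm (x - y)" by (simp add: algebra_simps)
  next
    fix x t
    have "pr (x + t *\<^sub>R e) = pr x" by (simp add: pr_def inner_add_left ee algebra_simps)
    then show "s (x + t *\<^sub>R e) = s x + t" by (simp add: s_def inner_add_left ee)
  qed (use r e L in auto)
qed

text \<open>The nearest boundary point still lies in the larger ball, and \<open>s \<le> 0\<close> there; the Lipschitz bound
  does the rest.\<close>
lemma height_le_infdist_frontier:
  fixes \<Omega> :: "'a::euclidean_space set"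
  assumes "open \<Omega>" and q: "q \<in> frontier \<Omega>"
    and \<Omega>: "\<And>x. x \<in> ball q r \<Longrightarrow> x \<in> \<Omega> \<longleftrightarrow> s x > 0"
    and L: "\<And>x y. x \<in> ball q r \<Longrightarrow> y \<in> ball q r \<Longrightarrow> \<bar>s x - s y\<bar> \<le> L * norm (x - y)"
    and x: "x \<in> ball q (r / 2)"
  shows "s x \<le> L * infdist x (frontier \<Omega>)"
proof -
  obtain y where y: "y \<in> frontier \<Omega>" "infdist x (frontier \<Omega>) = dist x y"
    using infdist_attains_inf[OF frontier_closed, of \<Omega> x] q by blast
  have "dist x y \<le> dist x q" using infdist_le[OF q, of x] y by simp
  moreover have "dist q y \<le> dist x q + dist x y" by (metis dist_commute dist_triangle)
  ultimately have yb: "y \<in> ball q r" using x by (simp add: dist_commute)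
  have xb: "x \<in> ball q r" using x zero_le_dist[of q x] unfolding mem_ball by linarith
  have "y \<notin> \<Omega>" using y(1) \<open>open \<Omega>\<close> by (simp add: frontier_def interior_open)
  then have "s y \<le> 0" using \<Omega>[OF yb] by simp
  then show ?thesis using L[OF xb yb] y by (simp add: dist_norm)
qed

lemma nn_integral_powr_from_0:
  assumes "a > -1" "c \<ge> 0"
  shows "(\<integral>\<^sup>+t. ennreal (t powr a) * indicator {0..c} t \<partial>lborel) = ennreal (c powr (a + 1) / (a + 1))"
  using has_integral_powr_from_0[OF assms] by (intro nn_integral_has_integral_lebesgue') auto

lemma nn_integral_powr_to_0:
  assumes "a > -1" "c \<ge> 0"
  shows "(\<integral>\<^sup>+t. ennreal ((c - t) powr a) * indicator {0..c} t \<partial>lborel) = ennreal (c powr (a + 1) / (a + 1))"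
proof -
  have "(\<integral>\<^sup>+t. ennreal (t powr a) * indicator {0..c} t \<partial>lborel) =
    (\<integral>\<^sup>+t. ennreal ((c - t) powr a) * indicator {0..c} (c - t) \<partial>lborel)"
    by (subst nn_integral_real_affine[where c="-1" and t=c]) auto
  moreover have "indicator {0..c} (c - t) = (indicator {0..c} t :: ennreal)" for t
    by (auto simp: indicator_def)
  ultimately show ?thesis using nn_integral_powr_from_0[OF assms] by simp
qed

text \<open>This is Hardy's inequality in dual form: walking down from \<open>\<mu>\<close> in the vertical direction, the
  integral of \<open>d\<^sup>b\<^sup>-\<^sup>1\<close> until the boundary is reached is at most a multiple of
  \<open>d\<^sup>b\<close> at the starting point. After a walk of length \<open>t\<close> the distance is at least
  \<open>(\<sigma> - t) / L\<close>, where \<open>\<sigma>\<close> is the height of \<open>\<mu>\<close>, and at most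
  \<open>(1 + L) * d \<mu>\<close>. The upper estimate serves for \<open>b \<ge> 1\<close>, where the integrand is increasing
  in the distance, and the lower one for \<open>b < 1\<close>. Integrability of \<open>t\<^sup>b\<^sup>-\<^sup>1\<close> at
  \<open>0\<close> is the reason for \<open>b > 0\<close>.\<close>
lemma boundary_kernel_bound:
  fixes \<Omega> :: "'a::euclidean_space set" and b :: real
  defines "d \<equiv> \<lambda>x. infdist x (frontier \<Omega>)"
  assumes "open \<Omega>" "smooth_boundary \<Omega>" and q: "q \<in> frontier \<Omega>" and b: "b > 0"
  obtains \<rho> C :: real and e :: 'a where "\<rho> > 0" "C > 0" "norm e = 1"
    "\<And>\<mu>. \<mu> \<in> \<Omega> \<Longrightarrow> (\<integral>\<^sup>+t. indicator (\<Omega> \<inter> ball q \<rho>) (\<mu> - t *\<^sub>R e) * ennreal (d (\<mu> - t *\<^sub>R e) powr (b - 1)) *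
        indicator {0..\<rho>} t \<partial>lborel) \<le> ennreal C * ennreal (d \<mu> powr b)"
proof -
  obtain r L :: real and e s where r: "r > 0" and L: "L > 0" and e: "norm e = 1"
    and \<Omega>: "\<And>x. x \<in> ball q r \<Longrightarrow> x \<in> \<Omega> \<longleftrightarrow> s x > 0"
    and Lip: "\<And>x y. x \<in> ball q r \<Longrightarrow> y \<in> ball q r \<Longrightarrow> \<bar>s x - s y\<bar> \<le> L * norm (x - y)"
    and s: "\<And>x t. s (x + t *\<^sub>R e) = s x + t"
    using boundary_height_function[OF assms(3) q] by blast
  have sd: "s x \<le> L * d x" if "x \<in> ball q (r / 2)" for x
    unfolding d_def using height_le_infdist_frontier[OF assms(2) q \<Omega> Lip that] .
  \<comment> \<open>If \<open>\<mu> - t e\<close> lies in the ball of radius \<open>r / 4\<close> and \<open>t \<le> r / 4\<close>, then \<open>\<mu>\<close> lies in the ball of radius \<open>r / 2\<close>.\<close>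
  define \<rho> where "\<rho> = r / 4"
  define C where "C = (if b \<ge> 1 then (1 + L) powr (b - 1) * L else (1 / L) powr (b - 1) * (L powr b / b))"
  have "C > 0" using L b by (simp add: C_def)
  have dpos: "d x \<ge> 0" for x by (simp add: d_def infdist_nonneg)
  show ?thesis
  proof (rule that[of \<rho> C e])
    fix \<mu> assume \<mu>: "\<mu> \<in> \<Omega>"
    let ?S = "{t. t \<in> {0..\<rho>} \<and> \<mu> - t *\<^sub>R e \<in> \<Omega> \<inter> ball q \<rho>}"
    let ?lhs = "\<integral>\<^sup>+t. indicator (\<Omega> \<inter> ball q \<rho>) (\<mu> - t *\<^sub>R e) * ennreal (d (\<mu> - t *\<^sub>R e) powr (b - 1)) *
        indicator {0..\<rho>} t \<partial>lborel"
    show "?lhs \<le> ennreal C * ennreal (d \<mu> powr b)"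
    proof (cases "?S = {}")
      case True
      then have zero: "indicator (\<Omega> \<inter> ball q \<rho>) (\<mu> - t *\<^sub>R e) * ennreal (d (\<mu> - t *\<^sub>R e) powr (b - 1)) *
        indicator {0..\<rho>} t = 0" for t by (auto simp: indicator_def)
      show ?thesis unfolding zero by simp
    next
      case False
      then obtain t0 where t0: "0 \<le> t0" "t0 \<le> \<rho>" "\<mu> - t0 *\<^sub>R e \<in> ball q \<rho>" by auto
      have "dist q \<mu> \<le> dist q (\<mu> - t0 *\<^sub>R e) + dist (\<mu> - t0 *\<^sub>R e) \<mu>" by (rule dist_triangle)
      also have "dist (\<mu> - t0 *\<^sub>R e) \<mu> = t0" using t0 e by (simp add: dist_norm)
      finally have \<mu>b: "\<mu> \<in> ball q (r / 2)" using t0 by (simp add: \<rho>_def)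
      then have \<mu>b': "\<mu> \<in> ball q r" using r unfolding mem_ball by linarith
      define \<sigma> where "\<sigma> = s \<mu>"
      have \<sigma>: "\<sigma> > 0" "\<sigma> \<le> L * d \<mu>" using \<Omega>[OF \<mu>b'] \<mu> sd[OF \<mu>b] by (auto simp: \<sigma>_def)
      then have d\<mu>: "d \<mu> > 0" using L by (smt (verit) zero_less_mult_pos)
      have t: "0 \<le> t" "t < \<sigma>" "(\<sigma> - t) / L \<le> d (\<mu> - t *\<^sub>R e)" "d (\<mu> - t *\<^sub>R e) \<le> (1 + L) * d \<mu>" if "t \<in> ?S" for t
      proof -
        have tb: "\<mu> - t *\<^sub>R e \<in> ball q (r / 2)" "\<mu> - t *\<^sub>R e \<in> ball q r"
          using that r by (auto simp: \<rho>_def)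
        have st: "s (\<mu> - t *\<^sub>R e) = \<sigma> - t" using s[of \<mu> "- t"] by (simp add: \<sigma>_def)
        show "0 \<le> t" using that by simp
        show "t < \<sigma>" using \<Omega>[OF tb(2)] that st by auto
        show "(\<sigma> - t) / L \<le> d (\<mu> - t *\<^sub>R e)" using sd[OF tb(1)] st L by (simp add: field_simps)
        have "d (\<mu> - t *\<^sub>R e) \<le> d \<mu> + dist (\<mu> - t *\<^sub>R e) \<mu>"
          unfolding d_def using q by (intro infdist_triangle)
        also have "dist (\<mu> - t *\<^sub>R e) \<mu> = t" using that e by (simp add: dist_norm)
        also have "t \<le> L * d \<mu>" using \<open>t < \<sigma>\<close> \<sigma> by simp
        finally show "d (\<mu> - t *\<^sub>R e) \<le> (1 + L) * d \<mu>" by (simp add: algebra_simps)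
      qed
      show ?thesis
      proof (cases "b \<ge> 1")
        case True
        have "?lhs \<le> (\<integral>\<^sup>+t. ennreal (((1 + L) * d \<mu>) powr (b - 1)) * indicator {0..\<sigma>} t \<partial>lborel)"
        proof (rule nn_integral_mono)
          fix t
          show "indicator (\<Omega> \<inter> ball q \<rho>) (\<mu> - t *\<^sub>R e) * ennreal (d (\<mu> - t *\<^sub>R e) powr (b - 1)) *
            indicator {0..\<rho>} t \<le> ennreal (((1 + L) * d \<mu>) powr (b - 1)) * indicator {0..\<sigma>} t"
          proof (cases "t \<in> ?S")
            case t': True
            have "d (\<mu> - t *\<^sub>R e) powr (b - 1) \<le> ((1 + L) * d \<mu>) powr (b - 1)"
              using t[OF t'] True dpos by (intro powr_mono2) auto
            then show ?thesis using t[OF t'] t' by (auto simp: indicator_def intro!: ennreal_leI)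
          qed (auto simp: indicator_def)
        qed
        also have "\<dots> = ennreal (((1 + L) * d \<mu>) powr (b - 1)) * ennreal \<sigma>"
          using \<sigma> by (subst nn_integral_cmult_indicator) auto
        also have "\<dots> \<le> ennreal (((1 + L) * d \<mu>) powr (b - 1)) * ennreal (L * d \<mu>)"
          using \<sigma> by (intro mult_left_mono ennreal_leI) auto
        also have "\<dots> = ennreal (C * d \<mu> powr b)"
        proof -
          have "d \<mu> powr (b - 1) * d \<mu> = d \<mu> powr b"
            using d\<mu> by (simp add: powr_diff)
          then show ?thesis
            using True L d\<mu> by (simp add: ennreal_mult[symmetric] C_def powr_mult mult_ac)
        qed
        finally show ?thesis using \<open>C > 0\<close> by (simp add: ennreal_mult)
      next
        case False
        have "?lhs \<le> (\<integral>\<^sup>+t. ennreal ((1 / L) powr (b - 1)) * (ennreal ((\<sigma> - t) powr (b - 1)) * indicator {0..\<sigma>} t) \<partial>lborel)"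
        proof (rule nn_integral_mono)
          fix t
          show "indicator (\<Omega> \<inter> ball q \<rho>) (\<mu> - t *\<^sub>R e) * ennreal (d (\<mu> - t *\<^sub>R e) powr (b - 1)) *
            indicator {0..\<rho>} t \<le> ennreal ((1 / L) powr (b - 1)) * (ennreal ((\<sigma> - t) powr (b - 1)) * indicator {0..\<sigma>} t)"
          proof (cases "t \<in> ?S")
            case t': True
            have "d (\<mu> - t *\<^sub>R e) powr (b - 1) \<le> ((\<sigma> - t) / L) powr (b - 1)"
              using t[OF t'] False L by (intro powr_mono2') auto
            also have "\<dots> = (1 / L) powr (b - 1) * (\<sigma> - t) powr (b - 1)"
              using t[OF t'] L by (simp add: powr_mult[symmetric])
            finally show ?thesis using t[OF t'] t'
              by (auto simp: indicator_def ennreal_mult[symmetric] intro!: ennreal_leI)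
          qed (auto simp: indicator_def)
        qed
        also have "\<dots> = ennreal ((1 / L) powr (b - 1)) * ennreal (\<sigma> powr b / b)"
          using nn_integral_powr_to_0[of "b - 1" \<sigma>] \<sigma> b by (subst nn_integral_cmult) auto
        also have "\<dots> \<le> ennreal ((1 / L) powr (b - 1)) * ennreal ((L * d \<mu>) powr b / b)"
          using \<sigma> b by (intro mult_left_mono ennreal_leI divide_right_mono powr_mono2) auto
        also have "\<dots> = ennreal (C * d \<mu> powr b)"
          using False L d\<mu> b by (simp add: ennreal_mult[symmetric] C_def powr_mult mult_ac)
        finally show ?thesis using \<open>C > 0\<close> by (simp add: ennreal_mult)
      qed
    qed
  qed (use r e \<open>C > 0\<close> in \<open>auto simp: \<rho>_def\<close>)
qed

lemma nn_integral_lborel_shift: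
  fixes F :: "'a::euclidean_space \<Rightarrow> ennreal"
  assumes [measurable]: "F \<in> borel_measurable borel"
  shows "(\<integral>\<^sup>+x. F (x + c) \<partial>lborel) = (\<integral>\<^sup>+x. F x \<partial>lborel)"
proof -
  have "(\<integral>\<^sup>+x. F x \<partial>lborel) = (\<integral>\<^sup>+x. F x \<partial>distr lborel borel ((+) c))"
    by (simp add: lborel_distr_plus)
  also have "\<dots> = (\<integral>\<^sup>+x. F (c + x) \<partial>lborel)"
    by (rule nn_integral_distr) measurable
  finally show ?thesis by (simp add: add.commute)
qed

text \<open>Fubini's theorem and translation invariance. It transfers integration along segments in any direction
  \<open>v\<close> from \<open>k\<close> to the weight, without a rotation of coordinates.\<close>
lemma nn_integral_segment_shift:
  fixes w k :: "'a::euclidean_space \<Rightarrow> ennreal" and v :: 'a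
  assumes w [measurable]: "w \<in> borel_measurable borel" and k [measurable]: "k \<in> borel_measurable borel"
    and J [measurable]: "J \<in> sets borel"
  shows "(\<integral>\<^sup>+x. w x * (\<integral>\<^sup>+t. k (x + t *\<^sub>R v) * indicator J t \<partial>lborel) \<partial>lborel) =
    (\<integral>\<^sup>+y. k y * (\<integral>\<^sup>+t. w (y - t *\<^sub>R v) * indicator J t \<partial>lborel) \<partial>lborel)"
proof -
  have "(\<integral>\<^sup>+x. w x * (\<integral>\<^sup>+t. k (x + t *\<^sub>R v) * indicator J t \<partial>lborel) \<partial>lborel) =
    (\<integral>\<^sup>+x. (\<integral>\<^sup>+t. w x * (k (x + t *\<^sub>R v) * indicator J t) \<partial>lborel) \<partial>lborel)"
    by (intro nn_integral_cong nn_integral_cmult[symmetric]) measurable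
  also have "\<dots> = (\<integral>\<^sup>+t. (\<integral>\<^sup>+x. w x * (k (x + t *\<^sub>R v) * indicator J t) \<partial>lborel) \<partial>lborel)"
    by (rule lborel_pair.Fubini'[symmetric]) measurable
  also have "\<dots> = (\<integral>\<^sup>+t. (\<integral>\<^sup>+y. w (y - t *\<^sub>R v) * (k y * indicator J t) \<partial>lborel) \<partial>lborel)"
  proof (rule nn_integral_cong)
    fix t
    have "(\<lambda>y. w (y - t *\<^sub>R v) * (k y * indicator J t)) \<in> borel_measurable borel" by measurable
    from nn_integral_lborel_shift[OF this, of "t *\<^sub>R v"]
    show "(\<integral>\<^sup>+x. w x * (k (x + t *\<^sub>R v) * indicator J t) \<partial>lborel) =
      (\<integral>\<^sup>+y. w (y - t *\<^sub>R v) * (k y * indicator J t) \<partial>lborel)" by simp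
  qed
  also have "\<dots> = (\<integral>\<^sup>+y. (\<integral>\<^sup>+t. w (y - t *\<^sub>R v) * (k y * indicator J t) \<partial>lborel) \<partial>lborel)"
    by (rule lborel_pair.Fubini') measurable
  also have "\<dots> = (\<integral>\<^sup>+y. (\<integral>\<^sup>+t. k y * (w (y - t *\<^sub>R v) * indicator J t) \<partial>lborel) \<partial>lborel)"
    by (simp add: mult_ac)
  also have "\<dots> = (\<integral>\<^sup>+y. k y * (\<integral>\<^sup>+t. w (y - t *\<^sub>R v) * indicator J t \<partial>lborel) \<partial>lborel)"
    by (intro nn_integral_cong nn_integral_cmult) measurable
  finally show ?thesis .
qed

section \<open>Line integrals of compactly supported functions\<close>

lemma slope_le_shift:
  assumes "slope_le (\<lambda>t. F (t + c)) 0 k"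
  shows "slope_le F c k"
  unfolding slope_le_def
proof (intro allI impI)
  fix \<epsilon> :: real assume "\<epsilon> > 0"
  then have "\<forall>\<^sub>F z in nhds 0. \<bar>F (z + c) - F c\<bar> \<le> (k + \<epsilon>) * \<bar>z\<bar>"
    using assms by (auto simp: slope_le_def)
  moreover have "filterlim (\<lambda>z. z - c) (nhds 0) (nhds c)"
    by (auto intro!: tendsto_eq_intros filterlim_ident)
  ultimately show "\<forall>\<^sub>F z in nhds c. \<bar>F z - F c\<bar> \<le> (k + \<epsilon>) * \<bar>z - c\<bar>"
    by (auto dest: eventually_compose_filterlim)
qed

lemma slope_le_locally_zero:
  assumes "\<forall>\<^sub>F z in nhds x. h z = 0"
  shows "slope_le h x 0"
  unfolding slope_le_def
proof (intro allI impI)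
  fix \<epsilon> :: real assume "\<epsilon> > 0"
  have "h x = 0" using assms by (rule eventually_nhds_x_imp_x)
  show "\<forall>\<^sub>F z in nhds x. \<bar>h z - h x\<bar> \<le> (0 + \<epsilon>) * \<bar>z - x\<bar>"
    using assms by eventually_elim (use \<open>h x = 0\<close> \<open>\<epsilon> > 0\<close> in auto)
qed

lemma continuous_on_zero_extension:
  fixes g :: "'a::topological_space \<Rightarrow> real"
  assumes "open U" "closed K" "K \<subseteq> U" "continuous_on U g" "\<And>x. x \<notin> K \<Longrightarrow> g x = 0"
  shows "continuous_on UNIV g"
proof -
  have "continuous_on (- K) g"
    using assms(5) by (subst continuous_on_cong[where g="\<lambda>_. 0"]) auto
  then have "continuous_on (U \<union> - K) g"
    using assms by (intro continuous_on_open_Un) auto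
  moreover have "U \<union> - K = UNIV" using assms by auto
  ultimately show ?thesis by simp
qed

text \<open>The inequalities in \<open>L\<^sup>1\<close> are applied to the function \<open>|f|\<^sup>p\<close>. The set
  \<open>K\<close> contains the support of \<open>f\<close>, so that weights that are continuous and positive only in
  \<open>U\<close> do no harm.\<close>
locale C1_supported =
  fixes f :: "'a::euclidean_space \<Rightarrow> real" and Df :: "'a \<Rightarrow> 'a \<Rightarrow> real" and K U :: "'a set" and p :: real
  assumes Df: "(f has_derivative Df x) (at x)"
    and cont_Df: "continuous_on UNIV (\<lambda>x. Df x v)"
    and K: "compact K" "K \<subseteq> U" and U: "open U"
    and off: "x \<notin> K \<Longrightarrow> f x = 0"
    and p: "p > 1"
begin

lemma cont_f: "continuous_on A f"
  using Df by (meson continuous_at_imp_continuous_on has_derivative_continuous)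

lemma cont_Df': "continuous_on A (\<lambda>x. Df x v)"
  using cont_Df by (rule continuous_on_subset) auto

lemma borel_f [measurable]: "f \<in> borel_measurable borel"
  using cont_f by (rule borel_measurable_continuous_onI)

lemma closed_K: "closed K"
  using K by (simp add: compact_imp_closed)

text \<open>The modulus of the derivative of \<open>|f|\<^sup>p\<close> in direction \<open>v\<close>.\<close>
definition pow_slope :: "'a \<Rightarrow> 'a \<Rightarrow> real" where
  "pow_slope v x = p * \<bar>f x\<bar> powr (p - 1) * \<bar>Df x v\<bar>"

lemma pow_slope_nonneg: "pow_slope v x \<ge> 0"
  using p by (simp add: pow_slope_def)

lemma pow_slope_off: "x \<notin> K \<Longrightarrow> pow_slope v x = 0"
  using p off by (simp add: pow_slope_def)

lemma cont_abs_powr: "q > 0 \<Longrightarrow> continuous_on A (\<lambda>x. \<bar>f x\<bar> powr q)"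
  by (intro continuous_on_powr' continuous_intros cont_f) auto

lemma cont_pow_slope: "continuous_on A (pow_slope v)"
  unfolding pow_slope_def using p by (intro continuous_intros cont_abs_powr cont_Df') auto

lemma slope_pow_on_line: "slope_le (\<lambda>t. \<bar>f (x + t *\<^sub>R v)\<bar> powr p) 0 (pow_slope v x)"
proof -
  have lin: "Df x (t *\<^sub>R v) = t * Df x v" for t
    using has_derivative_bounded_linear[OF Df[of x]] by (simp add: bounded_linear.linear linear_cmul)
  have "((\<lambda>t. f (x + t *\<^sub>R v)) has_derivative (\<lambda>t. Df x (t *\<^sub>R v))) (at 0)"
    by (rule has_derivative_compose[where f="\<lambda>t. x + t *\<^sub>R v" and g=f, simplified])
      (auto intro!: derivative_eq_intros Df)
  then have "((\<lambda>t. f (x + t *\<^sub>R v)) has_real_derivative Df x v) (at 0)"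
    unfolding has_field_derivative_def lin by (simp add: mult.commute[of _ "Df x v"])
  from slope_le_compose[OF slope_le_abs_powr[OF p] slope_leI_DERIV[OF this]]
  show ?thesis using p by (simp add: pow_slope_def)
qed

lemma slope_weighted:
  assumes "x \<in> U \<Longrightarrow> slope_le (\<lambda>t. w (x + t *\<^sub>R v)) 0 (W x)" "x \<in> U \<Longrightarrow> w x \<ge> 0"
  shows "slope_le (\<lambda>t. w (x + t *\<^sub>R v) * \<bar>f (x + t *\<^sub>R v)\<bar> powr p) 0 (w x * pow_slope v x + W x * \<bar>f x\<bar> powr p)"
proof (cases "x \<in> U")
  case True
  show ?thesis
    using slope_le_mult[OF assms(1)[OF True] slope_pow_on_line[of x v]] assms(2)[OF True] by simp
next
  case False
  then have "x \<in> - K" using K by auto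
  moreover have "filterlim (\<lambda>t. x + t *\<^sub>R v) (nhds x) (nhds 0)"
    by (auto intro!: tendsto_eq_intros filterlim_ident)
  ultimately have "\<forall>\<^sub>F t in nhds 0. x + t *\<^sub>R v \<in> - K"
    using closed_K by (metis open_Compl topological_tendstoD)
  then have "\<forall>\<^sub>F t in nhds 0. w (x + t *\<^sub>R v) * \<bar>f (x + t *\<^sub>R v)\<bar> powr p = 0"
    by eventually_elim (simp add: off)
  from slope_le_locally_zero[OF this]
  show ?thesis using \<open>x \<in> - K\<close> pow_slope_off off by simp
qed

lemma cont_weighted:
  assumes "continuous_on U w" "continuous_on U W"
  shows "continuous_on UNIV (\<lambda>x. w x * pow_slope v x + W x * \<bar>f x\<bar> powr p)"
  using p by (intro continuous_on_zero_extension[OF U closed_K K(2)] continuous_intros assms cont_pow_slope cont_abs_powr)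
    (auto simp: pow_slope_off off)

text \<open>The function \<open>w * |f|\<^sup>p\<close> vanishes at parameter \<open>a\<close> of the line, so its value at
  parameter \<open>0\<close> is an increment. Here \<open>W\<close> bounds the slope of the weight in direction
  \<open>v\<close>.\<close>
lemma weighted_le_line_integral:
  assumes w: "continuous_on U w" "\<And>x. x \<in> U \<Longrightarrow> w x \<ge> 0"
    and W: "continuous_on U W" "\<And>x. x \<in> U \<Longrightarrow> W x \<ge> 0"
    and slope: "\<And>x. x \<in> U \<Longrightarrow> slope_le (\<lambda>t. w (x + t *\<^sub>R v)) 0 (W x)"
    and a: "a \<le> 0" "f (x + a *\<^sub>R v) = 0"
  shows "ennreal (w x * \<bar>f x\<bar> powr p) \<le>
    (\<integral>\<^sup>+t. ennreal (w (x + t *\<^sub>R v) * pow_slope v (x + t *\<^sub>R v) + W (x + t *\<^sub>R v) * \<bar>f (x + t *\<^sub>R v)\<bar> powr p) *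
       indicator {a..0} t \<partial>lborel)"
proof -
  define k where "k x = w x * pow_slope v x + W x * \<bar>f x\<bar> powr p" for x
  define h where "h t = w (x + t *\<^sub>R v) * \<bar>f (x + t *\<^sub>R v)\<bar> powr p" for t
  have "ennreal \<bar>h 0 - h a\<bar> \<le> (\<integral>\<^sup>+t. ennreal (k (x + t *\<^sub>R v)) * indicator {a..0} t \<partial>lborel)"
  proof (rule increment_le_nn_integral_slope[OF a(1)])
    show "continuous_on {a..0} (\<lambda>t. k (x + t *\<^sub>R v))"
      using cont_weighted[OF w(1) W(1), of v, folded k_def]
      by (rule continuous_on_compose2) (auto intro!: continuous_intros)
    fix t :: real
    show "k (x + t *\<^sub>R v) \<ge> 0"
    proof (cases "x + t *\<^sub>R v \<in> U")
      case True
      then show ?thesis using w W pow_slope_nonneg by (simp add: k_def)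
    next
      case False
      then have "x + t *\<^sub>R v \<notin> K" using K by auto
      then show ?thesis by (simp add: k_def pow_slope_off off)
    qed
    have "slope_le (\<lambda>u. h (u + t)) 0 (k (x + t *\<^sub>R v))"
      using slope_weighted[where x="x + t *\<^sub>R v" and v=v and w=w and W=W, OF slope w(2)]
      unfolding h_def k_def by (simp add: add.commute[of _ t] scaleR_add_left add.assoc)
    then show "slope_le h t (k (x + t *\<^sub>R v))" by (rule slope_le_shift)
  qed
  moreover have "\<bar>h 0 - h a\<bar> \<ge> w x * \<bar>f x\<bar> powr p" using a p by (simp add: h_def)
  ultimately show ?thesis
    unfolding k_def by (meson ennreal_leI order_trans)
qed

text \<open>Follow \<open>|f|\<^sup>p\<close> along the segment, multiplied by the factor \<open>1 - t / \<rho>\<close> that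
  vanishes at its far end. This localises Hardy's inequality with no condition on \<open>f\<close> away from the
  boundary.\<close>
lemma abs_powr_le_cutoff_line_integral:
  assumes "\<rho> > 0"
  shows "ennreal (\<bar>f x\<bar> powr p) \<le>
    (\<integral>\<^sup>+t. ennreal (pow_slope v (x + t *\<^sub>R v) + (1 / \<rho>) * \<bar>f (x + t *\<^sub>R v)\<bar> powr p) * indicator {0..\<rho>} t \<partial>lborel)"
proof -
  define k where "k t = \<bar>1 - t / \<rho>\<bar> * pow_slope v (x + t *\<^sub>R v) + (1 / \<rho>) * \<bar>f (x + t *\<^sub>R v)\<bar> powr p" for t
  define h where "h t = (1 - t / \<rho>) * \<bar>f (x + t *\<^sub>R v)\<bar> powr p" for t
  have "ennreal \<bar>h \<rho> - h 0\<bar> \<le> (\<integral>\<^sup>+t. ennreal (k t) * indicator {0..\<rho>} t \<partial>lborel)"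
  proof (rule increment_le_nn_integral_slope)
    show "continuous_on {0..\<rho>} k"
      unfolding k_def using p \<open>\<rho> > 0\<close>
      by (intro continuous_intros continuous_on_compose2[OF cont_pow_slope[of UNIV v]] continuous_on_compose2[OF cont_abs_powr[of p UNIV]]) auto
    fix t :: real
    show "k t \<ge> 0" using \<open>\<rho> > 0\<close> pow_slope_nonneg by (simp add: k_def)
    have eq: "x + t *\<^sub>R v + u *\<^sub>R v = x + (u + t) *\<^sub>R v" for u
      by (simp add: algebra_simps)
    have u: "slope_le (\<lambda>u. \<bar>f (x + u *\<^sub>R v)\<bar> powr p) t (pow_slope v (x + t *\<^sub>R v))"
      using slope_pow_on_line[of "x + t *\<^sub>R v" v] unfolding eq by (rule slope_le_shift)
    have w: "slope_le (\<lambda>t. 1 - t / \<rho>) t (1 / \<rho>)"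
    proof (rule slope_leI_Lipschitz)
      fix z
      have "1 - z / \<rho> - (1 - t / \<rho>) = (t - z) / \<rho>" by (simp add: diff_divide_distrib)
      then show "\<bar>1 - z / \<rho> - (1 - t / \<rho>)\<bar> \<le> 1 / \<rho> * \<bar>z - t\<bar>"
        using \<open>\<rho> > 0\<close> by (simp add: abs_minus_commute)
    qed
    show "slope_le h t (k t)"
      using slope_le_mult[OF w u] unfolding h_def k_def by simp
  qed (use \<open>\<rho> > 0\<close> in auto)
  also have "\<dots> \<le> (\<integral>\<^sup>+t. ennreal (pow_slope v (x + t *\<^sub>R v) + (1 / \<rho>) * \<bar>f (x + t *\<^sub>R v)\<bar> powr p) * indicator {0..\<rho>} t \<partial>lborel)"
  proof (rule nn_integral_mono)
    fix t
    show "ennreal (k t) * indicator {0..\<rho>} t \<le>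
      ennreal (pow_slope v (x + t *\<^sub>R v) + (1 / \<rho>) * \<bar>f (x + t *\<^sub>R v)\<bar> powr p) * indicator {0..\<rho>} t"
    proof (cases "t \<in> {0..\<rho>}")
      case True
      then have "\<bar>1 - t / \<rho>\<bar> \<le> 1" using \<open>\<rho> > 0\<close> by (auto simp: abs_le_iff)
      then have "\<bar>1 - t / \<rho>\<bar> * pow_slope v (x + t *\<^sub>R v) \<le> 1 * pow_slope v (x + t *\<^sub>R v)"
        by (intro mult_right_mono pow_slope_nonneg)
      then show ?thesis by (intro mult_right_mono ennreal_leI) (auto simp: k_def)
    qed auto
  qed
  also have "\<bar>h \<rho> - h 0\<bar> = \<bar>f x\<bar> powr p"
    using \<open>\<rho> > 0\<close> by (simp add: h_def)
  finally show ?thesis .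
qed

end

section \<open>Hardy's inequality at the boundary and Poincare's inequality in the ball\<close>

lemma powr_le_mult_powr_on_interval:
  assumes "0 < \<delta>"
  obtains M :: real where "M > 0" "\<And>t. \<delta> \<le> t \<Longrightarrow> t \<le> R \<Longrightarrow> t powr a \<le> M * t powr b"
proof (rule that[of "\<delta> powr (a - b) + R powr (a - b) + 1"])
  fix t assume t: "\<delta> \<le> t" "t \<le> R"
  have "t powr (a - b) \<le> \<delta> powr (a - b) + R powr (a - b) + 1"
  proof (cases "a \<ge> b")
    case True
    then have "t powr (a - b) \<le> R powr (a - b)" using t assms by (intro powr_mono2) auto
    then show ?thesis using powr_ge_zero[of \<delta> "a - b"] by linarith
  next
    case False
    then have "t powr (a - b) \<le> \<delta> powr (a - b)" using t assms by (intro powr_mono2') auto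
    then show ?thesis using powr_ge_zero[of R "a - b"] by linarith
  qed
  then have "t powr (a - b) * t powr b \<le> (\<delta> powr (a - b) + R powr (a - b) + 1) * t powr b"
    by (intro mult_right_mono) auto
  then show "t powr a \<le> (\<delta> powr (a - b) + R powr (a - b) + 1) * t powr b"
    by (simp add: powr_add[symmetric])
qed (simp add: add_nonneg_pos)

lemma frontier_nonempty:
  fixes \<Omega> :: "'a::euclidean_space set"
  assumes "smooth_bounded_domain \<Omega>"
  shows "frontier \<Omega> \<noteq> {}"
proof -
  have "\<Omega> \<noteq> UNIV" using assms not_bounded_UNIV unfolding smooth_bounded_domain_def by metis
  then show ?thesis using assms frontier_not_empty[of \<Omega>] by (simp add: smooth_bounded_domain_def)
qed

lemma infdist_frontier_pos:
  assumes "smooth_bounded_domain \<Omega>" "x \<in> \<Omega>"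
  shows "infdist x (frontier \<Omega>) > 0"
proof -
  have "x \<notin> frontier \<Omega>"
    using assms by (simp add: smooth_bounded_domain_def frontier_def interior_open)
  then show ?thesis
    using in_closed_iff_infdist_zero[OF frontier_closed frontier_nonempty[OF assms(1)], of x]
      infdist_nonneg[of x "frontier \<Omega>"] by linarith
qed

lemma infdist_frontier_bounded:
  fixes \<Omega> :: "'a::euclidean_space set"
  assumes "smooth_bounded_domain \<Omega>"
  obtains R where "\<And>x. x \<in> \<Omega> \<Longrightarrow> infdist x (frontier \<Omega>) \<le> R"
proof -
  obtain q where q: "q \<in> frontier \<Omega>" using frontier_nonempty[OF assms] by auto
  have "bounded \<Omega>" using assms by (simp add: smooth_bounded_domain_def)
  then obtain R where "\<And>x. x \<in> \<Omega> \<Longrightarrow> dist q x \<le> R" by (auto simp: bounded_any_center[of _ q])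
  then show ?thesis using infdist_le[OF q] by (intro that[of R]) (metis dist_commute order_trans)
qed

text \<open>Compactness of the boundary: finitely many of the balls with a kernel bound cover a neighbourhood of it. The
  functions \<open>\<rho>\<close> and \<open>C\<close> are positive everywhere by assigning them the value \<open>1\<close>
  off \<open>F\<close>.\<close>
lemma boundary_layer_cover:
  fixes \<Omega> :: "'a::euclidean_space set" and b :: real
  defines "d \<equiv> \<lambda>x. infdist x (frontier \<Omega>)"
  assumes \<Omega>: "smooth_bounded_domain \<Omega>" and b: "b > 0"
  obtains F :: "'a set" and \<rho> C :: "'a \<Rightarrow> real" and e :: "'a \<Rightarrow> 'a" and \<delta> :: real where
    "finite F" "\<delta> > 0" "\<And>q. \<rho> q > 0" "\<And>q. C q > 0" "\<And>q. q \<in> F \<Longrightarrow> norm (e q) = 1"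
    "\<And>x. x \<in> \<Omega> \<Longrightarrow> d x < \<delta> \<Longrightarrow> \<exists>q\<in>F. x \<in> ball q (\<rho> q)"
    "\<And>q \<mu>. q \<in> F \<Longrightarrow> \<mu> \<in> \<Omega> \<Longrightarrow>
       (\<integral>\<^sup>+t. indicator (\<Omega> \<inter> ball q (\<rho> q)) (\<mu> - t *\<^sub>R e q) * ennreal (d (\<mu> - t *\<^sub>R e q) powr (b - 1)) *
        indicator {0..\<rho> q} t \<partial>lborel) \<le> ennreal (C q) * ennreal (d \<mu> powr b)"
proof -
  define good where "good q \<rho> C e \<longleftrightarrow> \<rho> > 0 \<and> C > 0 \<and> norm e = 1 \<and> (\<forall>\<mu>\<in>\<Omega>.
       (\<integral>\<^sup>+t. indicator (\<Omega> \<inter> ball q \<rho>) (\<mu> - t *\<^sub>R e) * ennreal (d (\<mu> - t *\<^sub>R e) powr (b - 1)) *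
        indicator {0..\<rho>} t \<partial>lborel) \<le> ennreal C * ennreal (d \<mu> powr b))" for q e :: 'a and \<rho> C :: real
  have "\<exists>\<rho> C e. good q \<rho> C e" if q: "q \<in> frontier \<Omega>" for q
  proof -
    have \<Omega>': "open \<Omega>" "smooth_boundary \<Omega>" using \<Omega> by (auto simp: smooth_bounded_domain_def)
    show ?thesis
    proof (rule boundary_kernel_bound[OF \<Omega>' q b])
      fix \<rho> C e
      assume "\<rho> > 0" "C > 0" "norm e = 1" and
        "\<And>\<mu>. \<mu> \<in> \<Omega> \<Longrightarrow> (\<integral>\<^sup>+t. indicator (\<Omega> \<inter> ball q \<rho>) (\<mu> - t *\<^sub>R e) *
          ennreal (infdist (\<mu> - t *\<^sub>R e) (frontier \<Omega>) powr (b - 1)) * indicator {0..\<rho>} t \<partial>lborel)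
          \<le> ennreal C * ennreal (infdist \<mu> (frontier \<Omega>) powr b)"
      then have "good q \<rho> C e" by (simp add: good_def d_def)
      then show ?thesis by blast
    qed
  qed
  then obtain \<rho> C e where good: "\<And>q. q \<in> frontier \<Omega> \<Longrightarrow> good q (\<rho> q) (C q) (e q)" by metis
  have "compact (frontier \<Omega>)"
    using \<Omega> by (simp add: smooth_bounded_domain_def compact_frontier_bounded)
  moreover have "frontier \<Omega> \<subseteq> (\<Union>q\<in>frontier \<Omega>. ball q (\<rho> q))"
    using good by (auto simp: good_def)
  ultimately obtain F where F: "F \<subseteq> frontier \<Omega>" "finite F" "frontier \<Omega> \<subseteq> (\<Union>q\<in>F. ball q (\<rho> q))"
    using compactE_image[of "frontier \<Omega>" "frontier \<Omega>" "\<lambda>q. ball q (\<rho> q)"] by (metis open_ball)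
  obtain \<delta> where \<delta>: "\<delta> > 0" "{x. infdist x (frontier \<Omega>) \<le> \<delta>} \<subseteq> (\<Union>q\<in>F. ball q (\<rho> q))"
    using compact_in_open_separated[OF frontier_nonempty[OF \<Omega>] \<open>compact (frontier \<Omega>)\<close>, of "\<Union>q\<in>F. ball q (\<rho> q)"] F(3)
    by (metis open_UN open_ball)
  show ?thesis
  proof (rule that[of F \<delta> "\<lambda>q. if q \<in> F then \<rho> q else 1" "\<lambda>q. if q \<in> F then C q else 1" e])
    fix x assume "d x < \<delta>"
    then have "x \<in> {x. infdist x (frontier \<Omega>) \<le> \<delta>}" by (simp add: d_def)
    then have "x \<in> (\<Union>q\<in>F. ball q (\<rho> q))" using \<delta>(2) by blast
    then show "\<exists>q\<in>F. x \<in> ball q (if q \<in> F then \<rho> q else 1)" by auto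
  next
    fix q
    have good': "good q (\<rho> q) (C q) (e q)" if "q \<in> F" using that F(1) good by blast
    then show "(if q \<in> F then \<rho> q else 1) > 0" "(if q \<in> F then C q else 1) > 0"
      by (simp_all add: good_def)
    assume q: "q \<in> F"
    then show "norm (e q) = 1" using good' by (simp add: good_def)
    fix \<mu> assume "\<mu> \<in> \<Omega>"
    then show "(\<integral>\<^sup>+t. indicator (\<Omega> \<inter> ball q (if q \<in> F then \<rho> q else 1)) (\<mu> - t *\<^sub>R e q) *
        ennreal (d (\<mu> - t *\<^sub>R e q) powr (b - 1)) * indicator {0..if q \<in> F then \<rho> q else 1} t \<partial>lborel)
      \<le> ennreal (if q \<in> F then C q else 1) * ennreal (d \<mu> powr b)"
      using good'[OF q] q unfolding good_def by simp
  qed (use F \<delta> in auto)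
qed

locale weighted_C1_supported = C1_supported f Df K "ball 0 1 \<times> \<Omega>" p
  for f :: "'a::euclidean_space \<times> 'b::euclidean_space \<Rightarrow> real" and Df K \<Omega> p +
  assumes \<Omega>: "smooth_bounded_domain \<Omega>"
begin

definition d :: "'a \<times> 'b \<Rightarrow> real" where "d x = infdist (snd x) (frontier \<Omega>)"

lemma cont_d: "continuous_on A d"
  unfolding d_def by (intro continuous_intros)

lemma borel_d [measurable]: "d \<in> borel_measurable borel"
  using cont_d by (rule borel_measurable_continuous_onI)

lemma borel_snd [measurable]: "(snd :: 'a \<times> 'b \<Rightarrow> 'b) \<in> borel_measurable borel"
  by (intro borel_measurable_continuous_onI continuous_intros)

lemma d_pos: "x \<in> ball 0 1 \<times> \<Omega> \<Longrightarrow> d x > 0"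
  using infdist_frontier_pos[OF \<Omega>] by (auto simp: d_def)

lemma cont_d_powr: "continuous_on (ball 0 1 \<times> \<Omega>) (\<lambda>x. d x powr a)"
  by (intro continuous_intros cont_d) (use d_pos in fastforce)

lemma borel_pow_slope [measurable]: "pow_slope v \<in> borel_measurable borel"
  using cont_pow_slope by (rule borel_measurable_continuous_onI)

text \<open>On the compact set \<open>K\<close> the distance is bounded away from zero, so a power with any exponent is
  bounded there. Finiteness is needed wherever an integral is absorbed into the other side of an inequality.\<close>
lemma finite_weighted:
  assumes "continuous_on UNIV g" "\<And>x. x \<notin> K \<Longrightarrow> g x = 0"
  shows "(\<integral>\<^sup>+x. ennreal (d x powr a * g x) \<partial>lborel) < \<infinity>"
proof -
  have "continuous_on K (\<lambda>x. d x powr a * g x)"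
    using K(2) by (intro continuous_intros continuous_on_subset[OF cont_d_powr] continuous_on_subset[OF assms(1)]) auto
  then have "bounded ((\<lambda>x. d x powr a * g x) ` K)"
    using K(1) by (intro compact_imp_bounded compact_continuous_image)
  then obtain M where M: "M > 0" "\<And>x. x \<in> K \<Longrightarrow> \<bar>d x powr a * g x\<bar> \<le> M"
    by (auto simp: bounded_pos)
  have "(\<integral>\<^sup>+x. ennreal (d x powr a * g x) \<partial>lborel) \<le> (\<integral>\<^sup>+x. ennreal M * indicator K x \<partial>lborel)"
  proof (rule nn_integral_mono)
    fix x show "ennreal (d x powr a * g x) \<le> ennreal M * indicator K x"
      using M(2)[of x] assms(2)[of x] by (cases "x \<in> K") (auto intro!: ennreal_leI simp: abs_le_iff)
  qed
  also have "\<dots> = ennreal M * emeasure lborel K"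
    using closed_K by (intro nn_integral_cmult_indicator) auto
  also have "\<dots> < \<infinity>"
    using emeasure_compact_finite[OF K(1)] by (simp add: ennreal_mult_less_top)
  finally show ?thesis .
qed

text \<open>A step of length \<open>2\<close> in the direction \<open>a\<close> leaves the unit ball, and the weight is
  constant in that direction.\<close>
lemma Poincare_fst:
  fixes a :: 'a
  assumes "norm a = 1"
  shows "(\<integral>\<^sup>+x. ennreal (d x powr \<alpha> * \<bar>f x\<bar> powr p) \<partial>lborel) \<le> 2 * (\<integral>\<^sup>+x. ennreal (d x powr \<alpha> * pow_slope (a, 0) x) \<partial>lborel)"
proof -
  let ?k = "\<lambda>x. ennreal (d x powr \<alpha> * pow_slope (a, 0) x)"
  have "(\<integral>\<^sup>+x. ennreal (d x powr \<alpha> * \<bar>f x\<bar> powr p) \<partial>lborel) \<le>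
    (\<integral>\<^sup>+x. 1 * (\<integral>\<^sup>+t. ?k (x + t *\<^sub>R (a, 0)) * indicator {-2..0} t \<partial>lborel) \<partial>lborel)"
  proof (rule nn_integral_mono)
    fix x
    show "ennreal (d x powr \<alpha> * \<bar>f x\<bar> powr p) \<le> 1 * (\<integral>\<^sup>+t. ?k (x + t *\<^sub>R (a, 0)) * indicator {-2..0} t \<partial>lborel)"
    proof (cases "f x = 0")
      case False
      then have "x \<in> ball 0 1 \<times> \<Omega>" using off K(2) by blast
      then have "norm (fst x) < 1" by (auto simp: mem_Times_iff)
      moreover have "norm (2 *\<^sub>R a) \<le> norm (fst x) + norm (fst x - 2 *\<^sub>R a)"
        by (metis norm_minus_commute norm_triangle_sub)
      ultimately have "x + (-2) *\<^sub>R (a, 0) \<notin> ball 0 1 \<times> \<Omega>"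
        using assms by (auto simp: mem_Times_iff)
      then have "x + (-2) *\<^sub>R (a, 0) \<notin> K" using K(2) by blast
      then have "f (x + (-2) *\<^sub>R (a, 0)) = 0" by (rule off)
      then have "ennreal (d x powr \<alpha> * \<bar>f x\<bar> powr p) \<le> (\<integral>\<^sup>+t. ennreal (d (x + t *\<^sub>R (a, 0)) powr \<alpha> * pow_slope (a, 0) (x + t *\<^sub>R (a, 0)) +
          0 * \<bar>f (x + t *\<^sub>R (a, 0))\<bar> powr p) * indicator {-2..0} t \<partial>lborel)"
        by (intro weighted_le_line_integral cont_d_powr)
          (auto intro!: continuous_intros slope_leI_Lipschitz simp: d_def)
      then show ?thesis by simp
    qed simp
  qed
  also have "\<dots> = (\<integral>\<^sup>+y. ?k y * (\<integral>\<^sup>+t. 1 * indicator {-2..0::real} t \<partial>lborel) \<partial>lborel)"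
    by (rule nn_integral_segment_shift) measurable
  also have "\<dots> = 2 * (\<integral>\<^sup>+x. ?k x \<partial>lborel)"
    by (subst nn_integral_multc) (auto simp: mult.commute)
  finally show ?thesis .
qed

text \<open>The cutoff estimate along vertical segments, integrated against \<open>d\<^sup>b\<^sup>-\<^sup>1\<close>; after
  exchanging the order of integration the kernel bound applies.\<close>
lemma local_Hardy:
  assumes "\<rho> > 0" and A: "A = \<Omega> \<inter> ball q \<rho>"
    and kernel: "\<And>\<mu>. \<mu> \<in> \<Omega> \<Longrightarrow> (\<integral>\<^sup>+t. indicator A (\<mu> - t *\<^sub>R e) * ennreal (infdist (\<mu> - t *\<^sub>R e) (frontier \<Omega>) powr (b - 1)) *
        indicator {0..\<rho>} t \<partial>lborel) \<le> ennreal C * ennreal (infdist \<mu> (frontier \<Omega>) powr b)"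
  shows "(\<integral>\<^sup>+x. indicator A (snd x) * ennreal (d x powr (b - 1) * \<bar>f x\<bar> powr p) \<partial>lborel) \<le>
    ennreal C * ((\<integral>\<^sup>+x. ennreal (d x powr b * pow_slope (0, e) x) \<partial>lborel) +
      ennreal (1 / \<rho>) * (\<integral>\<^sup>+x. ennreal (d x powr b * \<bar>f x\<bar> powr p) \<partial>lborel))"
proof -
  define w where "w x = indicator A (snd x) * ennreal (d x powr (b - 1))" for x :: "'a \<times> 'b"
  define k where "k x = ennreal (pow_slope (0, e) x + (1 / \<rho>) * \<bar>f x\<bar> powr p)" for x
  have "open \<Omega>" using \<Omega> by (simp add: smooth_bounded_domain_def)
  then have A_borel [measurable]: "A \<in> sets borel" by (auto simp: A)
  have [measurable]: "w \<in> borel_measurable borel" "k \<in> borel_measurable borel"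
    unfolding w_def k_def by measurable
  have "(\<integral>\<^sup>+x. indicator A (snd x) * ennreal (d x powr (b - 1) * \<bar>f x\<bar> powr p) \<partial>lborel) =
    (\<integral>\<^sup>+x. w x * ennreal (\<bar>f x\<bar> powr p) \<partial>lborel)"
    by (simp add: w_def ennreal_mult mult.assoc)
  also have "\<dots> \<le> (\<integral>\<^sup>+x. w x * (\<integral>\<^sup>+t. k (x + t *\<^sub>R (0, e)) * indicator {0..\<rho>} t \<partial>lborel) \<partial>lborel)"
    unfolding k_def by (intro nn_integral_mono mult_left_mono abs_powr_le_cutoff_line_integral \<open>\<rho> > 0\<close>) simp
  also have "\<dots> = (\<integral>\<^sup>+y. k y * (\<integral>\<^sup>+t. w (y - t *\<^sub>R (0, e)) * indicator {0..\<rho>} t \<partial>lborel) \<partial>lborel)"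
    by (rule nn_integral_segment_shift) measurable
  also have "\<dots> \<le> (\<integral>\<^sup>+y. ennreal C * (ennreal (d y powr b * pow_slope (0, e) y) + ennreal (1 / \<rho>) * ennreal (d y powr b * \<bar>f y\<bar> powr p)) \<partial>lborel)"
  proof (rule nn_integral_mono)
    fix y
    show "k y * (\<integral>\<^sup>+t. w (y - t *\<^sub>R (0, e)) * indicator {0..\<rho>} t \<partial>lborel) \<le>
      ennreal C * (ennreal (d y powr b * pow_slope (0, e) y) + ennreal (1 / \<rho>) * ennreal (d y powr b * \<bar>f y\<bar> powr p))"
    proof (cases "y \<in> K")
      case True
      then have "snd y \<in> \<Omega>" using K(2) by auto
      then have "(\<integral>\<^sup>+t. w (y - t *\<^sub>R (0, e)) * indicator {0..\<rho>} t \<partial>lborel) \<le> ennreal C * ennreal (d y powr b)"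
        using kernel[of "snd y"] by (simp add: w_def d_def)
      then have "k y * (\<integral>\<^sup>+t. w (y - t *\<^sub>R (0, e)) * indicator {0..\<rho>} t \<partial>lborel) \<le> k y * (ennreal C * ennreal (d y powr b))"
        by (rule mult_left_mono) simp
      also have "\<dots> = ennreal C * (ennreal (d y powr b) * k y)" by (simp add: mult_ac)
      also have "ennreal (d y powr b) * k y = ennreal (d y powr b * (pow_slope (0, e) y + (1 / \<rho>) * \<bar>f y\<bar> powr p))"
        unfolding k_def by (rule ennreal_mult[symmetric]) (use \<open>\<rho> > 0\<close> pow_slope_nonneg in auto)
      also have "d y powr b * (pow_slope (0, e) y + (1 / \<rho>) * \<bar>f y\<bar> powr p) =
          d y powr b * pow_slope (0, e) y + (1 / \<rho>) * (d y powr b * \<bar>f y\<bar> powr p)"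
        by (simp add: algebra_simps)
      also have "ennreal \<dots> = ennreal (d y powr b * pow_slope (0, e) y) + ennreal ((1 / \<rho>) * (d y powr b * \<bar>f y\<bar> powr p))"
        by (rule ennreal_plus) (use \<open>\<rho> > 0\<close> pow_slope_nonneg in auto)
      also have "ennreal ((1 / \<rho>) * (d y powr b * \<bar>f y\<bar> powr p)) = ennreal (1 / \<rho>) * ennreal (d y powr b * \<bar>f y\<bar> powr p)"
        by (rule ennreal_mult) (use \<open>\<rho> > 0\<close> in auto)
      finally show ?thesis .
    next
      case False
      then show ?thesis by (simp add: k_def pow_slope_off off)
    qed
  qed
  also have "\<dots> = ennreal C * ((\<integral>\<^sup>+x. ennreal (d x powr b * pow_slope (0, e) x) \<partial>lborel) +
      ennreal (1 / \<rho>) * (\<integral>\<^sup>+x. ennreal (d x powr b * \<bar>f x\<bar> powr p) \<partial>lborel))"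
    by (simp add: nn_integral_cmult nn_integral_add)
  finally show ?thesis .
qed

end

lemma ennreal_absorb_half:
  fixes Z W :: ennreal
  assumes "Z \<le> ennreal (1/2) * Z + W" "Z < \<infinity>"
  shows "Z \<le> 2 * W"
proof (cases W)
  case (real w)
  obtain z where z: "Z = ennreal z" "z \<ge> 0" using assms(2) by (cases Z) auto
  have "ennreal (1/2 * z + w) = ennreal (1/2 * z) + ennreal w"
    by (rule ennreal_plus) (use z real in auto)
  also have "ennreal (1/2 * z) = ennreal (1/2) * ennreal z"
    by (rule ennreal_mult) (use z in auto)
  finally have "ennreal z \<le> ennreal (1/2 * z + w)"
    using assms(1) z real by simp
  then have "z \<le> 1/2 * z + w" using z real by (subst (asm) ennreal_le_iff) auto
  then have "ennreal z \<le> ennreal (2 * w)" by (intro ennreal_leI) simp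
  then show ?thesis using z real by (simp add: ennreal_mult)
qed (simp add: ennreal_mult_top)

text \<open>Summing the local inequalities over the cover bounds \<open>\<integral> d\<^sup>b\<^sup>-\<^sup>1
  |f|\<^sup>p\<close> by \<open>X\<close>, the integral of \<open>d\<^sup>b |f|\<^sup>p\<close>, and the contribution of the
  interior. Since \<open>d\<^sup>b = d d\<^sup>b\<^sup>-\<^sup>1\<close>, the second of these is at most a small multiple of
  the left side where \<open>d\<close> is small, and is absorbed. Where \<open>d\<close> is bounded below all powers of
  \<open>d\<close> are comparable, so what remains is a multiple of the integral of \<open>d\<^sup>\<alpha>
  |f|\<^sup>p\<close>. The constant depends on the domain and the exponents only, not on \<open>f\<close>.\<close>
theorem Hardy_uniform:
  fixes \<Omega> :: "'b::euclidean_space set" and b \<alpha> :: real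
  defines "d \<equiv> weighted_C1_supported.d \<Omega> :: 'a::euclidean_space \<times> 'b \<Rightarrow> real"
  assumes \<Omega>: "smooth_bounded_domain \<Omega>" and b: "b > 0"
  obtains H :: real where "H > 0"
    "\<And>f Df K p X. weighted_C1_supported (f :: 'a \<times> 'b \<Rightarrow> real) Df K \<Omega> p \<Longrightarrow>
      (\<And>v. norm v = 1 \<Longrightarrow> (\<integral>\<^sup>+x. ennreal (d x powr b * C1_supported.pow_slope f Df p (0, v) x) \<partial>lborel) \<le> X) \<Longrightarrow>
      (\<integral>\<^sup>+x. ennreal (d x powr (b - 1) * \<bar>f x\<bar> powr p) \<partial>lborel) \<le>
        ennreal H * (X + (\<integral>\<^sup>+x. ennreal (d x powr \<alpha> * \<bar>f x\<bar> powr p) \<partial>lborel))"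
proof (rule boundary_layer_cover[OF \<Omega> b])
  fix F and \<rho> C and e :: "'b \<Rightarrow> 'b" and \<delta> :: real
  assume F: "finite F" "\<delta> > 0" "\<And>q. \<rho> q > 0" "\<And>q. C q > 0" "\<And>q. q \<in> F \<Longrightarrow> norm (e q) = 1"
    and cover: "\<And>x. x \<in> \<Omega> \<Longrightarrow> infdist x (frontier \<Omega>) < \<delta> \<Longrightarrow> \<exists>q\<in>F. x \<in> ball q (\<rho> q)"
    and kernel: "\<And>q \<mu>. q \<in> F \<Longrightarrow> \<mu> \<in> \<Omega> \<Longrightarrow>
       (\<integral>\<^sup>+t. indicator (\<Omega> \<inter> ball q (\<rho> q)) (\<mu> - t *\<^sub>R e q) * ennreal (infdist (\<mu> - t *\<^sub>R e q) (frontier \<Omega>) powr (b - 1)) *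
        indicator {0..\<rho> q} t \<partial>lborel) \<le> ennreal (C q) * ennreal (infdist \<mu> (frontier \<Omega>) powr b)"
  obtain R where R: "\<And>x. x \<in> \<Omega> \<Longrightarrow> infdist x (frontier \<Omega>) \<le> R"
    using infdist_frontier_bounded[OF \<Omega>] by blast
  define c where "c q = C q * (1 + 1 / \<rho> q)" for q
  define C1 where "C1 = 1 + (\<Sum>q\<in>F. c q)"
  have c: "c q > 0" for q using F(3,4)[of q] by (simp add: c_def add_pos_pos)
  have C1: "C1 \<ge> 1" "(\<Sum>q\<in>F. c q) \<le> C1" using c by (auto simp: C1_def sum_nonneg less_imp_le)
  \<comment> \<open>For \<open>d < \<eta>\<close> the term with \<open>d\<^sup>b\<close> is at most half of the left side.\<close>
  define \<eta> where "\<eta> = 1 / (2 * C1)"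
  have \<eta>: "\<eta> > 0" using C1 by (simp add: \<eta>_def)
  obtain M1 where M1: "M1 > 0" "\<And>t. \<eta> \<le> t \<Longrightarrow> t \<le> R \<Longrightarrow> t powr b \<le> M1 * t powr \<alpha>"
    using powr_le_mult_powr_on_interval[OF \<eta>, of R b \<alpha>] by blast
  obtain M2 where M2: "M2 > 0" "\<And>t. \<delta> \<le> t \<Longrightarrow> t \<le> R \<Longrightarrow> t powr (b - 1) \<le> M2 * t powr \<alpha>"
    using powr_le_mult_powr_on_interval[OF F(2), of R "b - 1" \<alpha>] by blast
  show ?thesis
  proof (rule that[of "2 * (C1 + C1 * M1 + M2)"])
    show "2 * (C1 + C1 * M1 + M2) > 0" using C1 M1 M2 by (simp add: add_pos_pos)
    fix f :: "'a \<times> 'b \<Rightarrow> real" and Df K p X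
    assume "weighted_C1_supported f Df K \<Omega> p"
    then interpret W: weighted_C1_supported f Df K \<Omega> p .
    assume X: "\<And>v. norm v = 1 \<Longrightarrow> (\<integral>\<^sup>+x. ennreal (d x powr b * W.pow_slope (0, v) x) \<partial>lborel) \<le> X"
    note [measurable] = W.borel_d W.borel_f W.borel_pow_slope W.borel_snd
    have d_eq: "d = W.d" by (simp add: d_def)
    have dW: "W.d x = infdist (snd x) (frontier \<Omega>)" for x by (simp add: W.d_def)
    define z v y where "z x = ennreal (W.d x powr (b - 1) * \<bar>f x\<bar> powr p)"
      and "v x = ennreal (W.d x powr b * \<bar>f x\<bar> powr p)"
      and "y x = ennreal (W.d x powr \<alpha> * \<bar>f x\<bar> powr p)" for x
    define Z V Y where "Z = (\<integral>\<^sup>+x. z x \<partial>lborel)" and "V = (\<integral>\<^sup>+x. v x \<partial>lborel)" and "Y = (\<integral>\<^sup>+x. y x \<partial>lborel)"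
    have [measurable]: "z \<in> borel_measurable borel" "v \<in> borel_measurable borel" "y \<in> borel_measurable borel"
      unfolding z_def v_def y_def by measurable
    have "open \<Omega>" using \<Omega> by (simp add: smooth_bounded_domain_def)
    then have [measurable]: "\<Omega> \<inter> ball q (\<rho> q) \<in> sets borel" for q by auto
    have "Z \<le> (\<integral>\<^sup>+x. (\<Sum>q\<in>F. indicator (\<Omega> \<inter> ball q (\<rho> q)) (snd x) * z x) + ennreal M2 * y x \<partial>lborel)"
      unfolding Z_def
    proof (rule nn_integral_mono)
      fix x
      show "z x \<le> (\<Sum>q\<in>F. indicator (\<Omega> \<inter> ball q (\<rho> q)) (snd x) * z x) + ennreal M2 * y x"
      proof (cases "x \<in> K")
        case True
        then have x: "snd x \<in> \<Omega>" using W.K(2) by auto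
        show ?thesis
        proof (cases "W.d x < \<delta>")
          case True
          then obtain q where q: "q \<in> F" "snd x \<in> ball q (\<rho> q)" using cover[OF x] by (auto simp: dW)
          then have "z x = indicator (\<Omega> \<inter> ball q (\<rho> q)) (snd x) * z x" using x by simp
          also have "\<dots> \<le> (\<Sum>q\<in>F. indicator (\<Omega> \<inter> ball q (\<rho> q)) (snd x) * z x)"
            using q F(1) by (intro member_le_sum[where f="\<lambda>q. indicator (\<Omega> \<inter> ball q (\<rho> q)) (snd x) * z x"]) auto
          finally show ?thesis by (meson add_increasing2 order_trans zero_le)
        next
          case False
          then have "W.d x powr (b - 1) * \<bar>f x\<bar> powr p \<le> (M2 * W.d x powr \<alpha>) * \<bar>f x\<bar> powr p"
            using R[OF x] by (intro mult_right_mono M2) (auto simp: dW)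
          then have "z x \<le> ennreal M2 * y x"
            unfolding z_def y_def using M2(1) by (simp add: ennreal_mult[symmetric] mult.assoc ennreal_leI)
          then show ?thesis by (meson add_increasing zero_le)
        qed
      next
        case False
        then show ?thesis by (simp add: z_def W.off)
      qed
    qed
    also have "\<dots> = (\<Sum>q\<in>F. (\<integral>\<^sup>+x. indicator (\<Omega> \<inter> ball q (\<rho> q)) (snd x) * z x \<partial>lborel)) + ennreal M2 * Y"
      by (simp add: nn_integral_add nn_integral_sum nn_integral_cmult Y_def)
    also have "(\<Sum>q\<in>F. (\<integral>\<^sup>+x. indicator (\<Omega> \<inter> ball q (\<rho> q)) (snd x) * z x \<partial>lborel)) \<le> (\<Sum>q\<in>F. ennreal (c q) * (X + V))"
    proof (rule sum_mono)
      fix q assume q: "q \<in> F"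
      have "(\<integral>\<^sup>+x. indicator (\<Omega> \<inter> ball q (\<rho> q)) (snd x) * z x \<partial>lborel) \<le>
        ennreal (C q) * ((\<integral>\<^sup>+x. ennreal (W.d x powr b * W.pow_slope (0, e q) x) \<partial>lborel) + ennreal (1 / \<rho> q) * V)"
        unfolding z_def V_def v_def using F(3) kernel[OF q] by (intro W.local_Hardy) auto
      also have "\<dots> \<le> ennreal (C q) * (ennreal (1 + 1 / \<rho> q) * X + ennreal (1 + 1 / \<rho> q) * V)"
      proof (intro mult_left_mono add_mono)
        have "(\<integral>\<^sup>+x. ennreal (W.d x powr b * W.pow_slope (0, e q) x) \<partial>lborel) \<le> 1 * X"
          using X[OF F(5)[OF q]] by (simp add: d_eq)
        also have "\<dots> \<le> ennreal (1 + 1 / \<rho> q) * X"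
          using F(3)[of q] by (intro mult_right_mono) (auto simp: ennreal_ge_1)
        finally show "(\<integral>\<^sup>+x. ennreal (W.d x powr b * W.pow_slope (0, e q) x) \<partial>lborel) \<le> ennreal (1 + 1 / \<rho> q) * X" .
        show "ennreal (1 / \<rho> q) * V \<le> ennreal (1 + 1 / \<rho> q) * V"
          by (intro mult_right_mono ennreal_leI) auto
      qed auto
      also have "\<dots> = ennreal (C q) * ennreal (1 + 1 / \<rho> q) * (X + V)"
        by (simp only: distrib_left mult.assoc)
      also have "ennreal (C q) * ennreal (1 + 1 / \<rho> q) = ennreal (c q)"
        unfolding c_def by (rule ennreal_mult[symmetric]) (use F(3,4)[of q] in auto)
      finally show "(\<integral>\<^sup>+x. indicator (\<Omega> \<inter> ball q (\<rho> q)) (snd x) * z x \<partial>lborel) \<le> ennreal (c q) * (X + V)" .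
    qed
    also have "(\<Sum>q\<in>F. ennreal (c q) * (X + V)) = ennreal (\<Sum>q\<in>F. c q) * (X + V)"
    proof -
      have "(\<Sum>q\<in>F. ennreal (c q)) = ennreal (\<Sum>q\<in>F. c q)"
        using c by (intro sum_ennreal) (simp add: less_imp_le)
      then show ?thesis by (metis sum_distrib_right)
    qed
    also have "\<dots> \<le> ennreal C1 * (X + V)"
      using C1 by (intro mult_right_mono ennreal_leI) auto
    finally have Z1: "Z \<le> ennreal C1 * (X + V) + ennreal M2 * Y" by (simp add: add_mono)
    have "V \<le> (\<integral>\<^sup>+x. ennreal \<eta> * z x + ennreal M1 * y x \<partial>lborel)"
      unfolding V_def
    proof (rule nn_integral_mono)
      fix x
      show "v x \<le> ennreal \<eta> * z x + ennreal M1 * y x"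
      proof (cases "x \<in> K")
        case True
        then have x: "snd x \<in> \<Omega>" using W.K(2) by auto
        have dpos: "W.d x > 0" using True W.K(2) by (intro W.d_pos) auto
        show ?thesis
        proof (cases "W.d x < \<eta>")
          case True
          have "W.d x powr b = W.d x * W.d x powr (b - 1)" using dpos by (simp add: powr_diff)
          also have "\<dots> \<le> \<eta> * W.d x powr (b - 1)" using True by (intro mult_right_mono) auto
          finally have "W.d x powr b * \<bar>f x\<bar> powr p \<le> \<eta> * W.d x powr (b - 1) * \<bar>f x\<bar> powr p"
            by (intro mult_right_mono) auto
          then have "v x \<le> ennreal \<eta> * z x"
            unfolding z_def v_def using \<eta> by (simp add: ennreal_mult[symmetric] mult.assoc ennreal_leI)
          then show ?thesis by (meson add_increasing2 zero_le)
        next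
          case False
          then have "W.d x powr b * \<bar>f x\<bar> powr p \<le> (M1 * W.d x powr \<alpha>) * \<bar>f x\<bar> powr p"
            using R[OF x] by (intro mult_right_mono M1) (auto simp: dW)
          then have "v x \<le> ennreal M1 * y x"
            unfolding v_def y_def using M1(1) by (simp add: ennreal_mult[symmetric] mult.assoc ennreal_leI)
          then show ?thesis by (meson add_increasing zero_le)
        qed
      next
        case False
        then show ?thesis by (simp add: v_def W.off)
      qed
    qed
    also have "\<dots> = ennreal \<eta> * Z + ennreal M1 * Y"
      by (simp add: nn_integral_add nn_integral_cmult Y_def Z_def)
    finally have V: "V \<le> ennreal \<eta> * Z + ennreal M1 * Y" .
    have "Z \<le> ennreal C1 * (X + (ennreal \<eta> * Z + ennreal M1 * Y)) + ennreal M2 * Y"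
      using Z1 V by (meson add_left_mono add_right_mono mult_left_mono order_trans zero_le)
    also have "\<dots> = ennreal (C1 * \<eta>) * Z + (ennreal C1 * X + ennreal (C1 * M1 + M2) * Y)"
      using C1 \<eta> M1 M2 by (simp add: ennreal_mult distrib_left distrib_right ac_simps)
    also have "C1 * \<eta> = 1 / 2" using C1 by (simp add: \<eta>_def)
    finally have "Z \<le> ennreal (1/2) * Z + (ennreal C1 * X + ennreal (C1 * M1 + M2) * Y)" .
    moreover have "Z < \<infinity>"
      unfolding Z_def z_def using W.p W.off by (intro W.finite_weighted W.cont_abs_powr) auto
    ultimately have "Z \<le> 2 * (ennreal C1 * X + ennreal (C1 * M1 + M2) * Y)"
      by (rule ennreal_absorb_half)
    also have "\<dots> \<le> 2 * (ennreal (C1 + C1 * M1 + M2) * X + ennreal (C1 + C1 * M1 + M2) * Y)"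
      using C1 M1 M2 by (intro mult_left_mono add_mono mult_right_mono ennreal_leI) auto
    also have "\<dots> = ennreal (2 * (C1 + C1 * M1 + M2)) * (X + Y)"
    proof -
      have "ennreal (2 * (C1 + C1 * M1 + M2)) = ennreal 2 * ennreal (C1 + C1 * M1 + M2)"
        by (rule ennreal_mult) (use C1 M1 M2 in auto)
      then show ?thesis by (simp only: ennreal_numeral distrib_left mult.assoc)
    qed
    finally show "(\<integral>\<^sup>+x. ennreal (d x powr (b - 1) * \<bar>f x\<bar> powr p) \<partial>lborel) \<le>
        ennreal (2 * (C1 + C1 * M1 + M2)) * (X + (\<integral>\<^sup>+x. ennreal (d x powr \<alpha> * \<bar>f x\<bar> powr p) \<partial>lborel))"
      by (simp add: Z_def z_def Y_def y_def d_eq)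
  qed
qed

section \<open>A weighted Gagliardo--Nirenberg inequality\<close>

lemma prod_Basis_powr:
  fixes t s \<alpha> \<beta> w :: real
  assumes "t > 0" "s > 0"
  shows "(\<Prod>b\<in>(Basis :: ('a::euclidean_space \<times> 'b::euclidean_space) set). (t powr (if snd b = 0 then \<alpha> else \<beta>) * s) powr w) =
    t powr ((DIM('a) * \<alpha> + DIM('b) * \<beta>) * w) * s powr ((DIM('a) + DIM('b)) * w)"
proof -
  have "(\<Prod>b\<in>(Basis :: ('a \<times> 'b) set). (t powr (if snd b = 0 then \<alpha> else \<beta>) * s) powr w) =
    (\<Prod>b\<in>(Basis :: ('a \<times> 'b) set). t powr ((if snd b = 0 then \<alpha> else \<beta>) * w)) * (\<Prod>b\<in>(Basis :: ('a \<times> 'b) set). s powr w)"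
    using assms by (simp add: powr_mult powr_powr prod.distrib)
  also have "(\<Prod>b\<in>(Basis :: ('a \<times> 'b) set). t powr ((if snd b = 0 then \<alpha> else \<beta>) * w)) =
      t powr (\<Sum>b\<in>(Basis :: ('a \<times> 'b) set). (if snd b = 0 then \<alpha> else \<beta>) * w)"
    using assms by (subst powr_sum) auto
  also have "(\<Sum>b\<in>(Basis :: ('a \<times> 'b) set). (if snd b = 0 then \<alpha> else \<beta>) * w) = (DIM('a) * \<alpha> + DIM('b) * \<beta>) * w"
  proof -
    have "(\<Sum>b\<in>(Basis :: ('a \<times> 'b) set). if snd b = 0 then \<alpha> else \<beta>) =
        (\<Sum>b\<in>(\<lambda>i. (i, 0 :: 'b)) ` (Basis :: 'a set). if snd b = 0 then \<alpha> else \<beta>) +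
        (\<Sum>b\<in>(\<lambda>j. (0 :: 'a, j)) ` (Basis :: 'b set). if snd b = 0 then \<alpha> else \<beta>)"
      unfolding Basis_prod_def by (rule sum.union_disjoint) auto
    also have "\<dots> = DIM('a) * \<alpha> + DIM('b) * \<beta>"
      by (simp add: sum.reindex inj_on_def nonzero_Basis)
    finally show ?thesis by (simp add: sum_distrib_right[symmetric])
  qed
  also have "(\<Prod>b\<in>(Basis :: ('a \<times> 'b) set). s powr w) = s powr ((DIM('a) + DIM('b)) * w)"
    using assms by (simp add: powr_realpow[symmetric] powr_powr mult.commute)
  finally show ?thesis .
qed

lemma powr_product_regroup:
  fixes t s :: real
  assumes "t > 0" "s > 0"
  shows "(t powr a1 * s powr b1) powr c1 * (t powr a2 * s powr b2) powr c2 * (t powr a3 * (s powr b3) powr c3) =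
    t powr (a1 * c1 + a2 * c2 + a3) * s powr (b1 * c1 + b2 * c2 + b3 * c3)"
  using assms by (simp add: powr_mult powr_powr powr_add mult_ac)

lemma epow_of_nat: "epow x (real k) = x ^ k"
proof (induction k)
  case (Suc k)
  have "epow x (real (Suc k)) = epow x (1 + real k)" by (simp add: add.commute)
  also have "\<dots> = x * x ^ k" using Suc by (subst epow_add) auto
  finally show ?case by simp
qed simp

lemma nn_integral_Holder2:
  assumes "u \<in> borel_measurable M" "v \<in> borel_measurable M" "0 \<le> a" "a \<le> 1"
  shows "(\<integral>\<^sup>+x. epow (u x) a * epow (v x) (1 - a) \<partial>M) \<le> epow (\<integral>\<^sup>+x. u x \<partial>M) a * epow (\<integral>\<^sup>+x. v x \<partial>M) (1 - a)"
  using nn_integral_Holder[of "UNIV :: bool set" "\<lambda>i. if i then a else 1 - a" "\<lambda>i. if i then u else v" M] assms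
  by (simp add: UNIV_bool mult.commute)

context weighted_C1_supported
begin

lemma exists_zero_on_line:
  assumes "v \<noteq> 0"
  obtains a where "a \<le> 0" "f (x + a *\<^sub>R v) = 0"
proof -
  obtain M where M: "\<And>y. y \<in> K \<Longrightarrow> norm y \<le> M"
    using compact_imp_bounded[OF K(1)] by (auto simp: bounded_iff)
  define a where "a = - ((\<bar>M\<bar> + norm x + 1) / norm v)"
  have "\<bar>a\<bar> * norm v = \<bar>M\<bar> + norm x + 1" using assms by (simp add: a_def)
  then have "norm (a *\<^sub>R v) = \<bar>M\<bar> + norm x + 1" by simp
  moreover have "norm (a *\<^sub>R v) \<le> norm (x + a *\<^sub>R v) + norm x"
    by (metis add_diff_cancel_left' norm_triangle_ineq4)
  ultimately have "norm (x + a *\<^sub>R v) > M" by linarith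
  then have "x + a *\<^sub>R v \<notin> K" using M by (meson not_le)
  moreover have "a \<le> 0" by (simp add: a_def)
  ultimately show ?thesis using that off by blast
qed

text \<open>A line leaves the compact set \<open>K\<close>, hence contains a zero of \<open>f\<close> on either side.\<close>
lemma weighted_le_full_line_integral:
  assumes "v \<noteq> 0" and w: "continuous_on (ball 0 1 \<times> \<Omega>) w" "\<And>x. x \<in> ball 0 1 \<times> \<Omega> \<Longrightarrow> w x \<ge> 0"
    and W: "continuous_on (ball 0 1 \<times> \<Omega>) W" "\<And>x. x \<in> ball 0 1 \<times> \<Omega> \<Longrightarrow> W x \<ge> 0"
    and slope: "\<And>x. x \<in> ball 0 1 \<times> \<Omega> \<Longrightarrow> slope_le (\<lambda>t. w (x + t *\<^sub>R v)) 0 (W x)"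
  shows "ennreal (w x * \<bar>f x\<bar> powr p) \<le>
    (\<integral>\<^sup>+t. ennreal (w (x + t *\<^sub>R v) * pow_slope v (x + t *\<^sub>R v) + W (x + t *\<^sub>R v) * \<bar>f (x + t *\<^sub>R v)\<bar> powr p) \<partial>lborel)"
proof -
  obtain a where "a \<le> 0" "f (x + a *\<^sub>R v) = 0" using exists_zero_on_line[OF assms(1)] .
  from weighted_le_line_integral[OF w W slope this]
  show ?thesis
    by (rule order_trans) (auto intro!: nn_integral_mono simp: indicator_def)
qed

lemma slope_d_powr:
  assumes "x \<in> ball 0 1 \<times> \<Omega>" "norm v = 1" "\<beta> > 0"
  shows "slope_le (\<lambda>t. d (x + t *\<^sub>R v) powr \<beta>) 0 (\<beta> * d x powr (\<beta> - 1))"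
proof -
  have "slope_le (\<lambda>t. d (x + t *\<^sub>R v)) 0 1"
  proof (rule slope_leI_Lipschitz)
    fix t
    have "\<bar>d (x + t *\<^sub>R v) - d (x + 0 *\<^sub>R v)\<bar> \<le> dist (snd (x + t *\<^sub>R v)) (snd x)"
      by (simp add: d_def infdist_triangle_abs)
    also have "\<dots> \<le> dist (x + t *\<^sub>R v) x" by (rule dist_snd_le)
    also have "\<dots> = \<bar>t\<bar>" using assms by (simp add: dist_norm)
    finally show "\<bar>d (x + t *\<^sub>R v) - d (x + 0 *\<^sub>R v)\<bar> \<le> 1 * \<bar>t - 0\<bar>" by simp
  qed
  moreover have "slope_le (\<lambda>z. z powr \<beta>) (d (x + 0 *\<^sub>R v)) (\<beta> * d x powr (\<beta> - 1))"
    using slope_le_powr[OF d_pos[OF assms(1)], of \<beta>] assms(3) by (simp add: abs_mult)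
  ultimately show ?thesis
    using slope_le_compose[of "\<lambda>z. z powr \<beta>" "\<lambda>t. d (x + t *\<^sub>R v)" 0 _ 1] assms(3) by simp
qed

text \<open>Here \<open>d\<^sup>\<alpha> |f|\<^sup>p\<close> is bounded by a line integral in each direction of the first
  factor, and \<open>d\<^sup>\<beta> |f|\<^sup>p\<close> in each direction of the second. The relations \<open>exp_d\<close>
  and \<open>exp_f\<close> between the exponents say exactly that \<open>h = d\<^sup>\<alpha> |f|\<^sup>Q\<close> is the
  product of \<open>h\<^sup>1\<^sup>/\<^sup>D\<close>, of the power with exponent \<open>(D - n) / D\<close> of the Hardy
  integrand \<open>z = d\<^sup>\<beta>\<^sup>-\<^sup>1 |f|\<^sup>p\<close>, and of the \<open>n\<close> bounded quantities to
  the power \<open>1/D\<close>. So the Finner inequality with exponent \<open>1/D\<close> for the line integrals applies,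
  although \<open>D\<close> need not be an integer: the Hardy term makes up for the missing \<open>D - n\<close>
  dimensions.\<close>
theorem weighted_Gagliardo_Nirenberg:
  fixes D Q \<alpha> \<beta> :: real
  defines "I \<equiv> \<integral>\<^sup>+x. ennreal (d x powr \<alpha> * \<bar>f x\<bar> powr Q) \<partial>lborel"
  assumes \<beta>: "\<beta> > 0" and D: "D \<ge> real (DIM('a) + DIM('b))"
    and exp_d: "\<alpha> + (\<beta> - 1) * (D - real (DIM('a) + DIM('b))) + (real DIM('a) * \<alpha> + real DIM('b) * \<beta>) = D * \<alpha>"
    and exp_f: "Q + p * D = D * Q" and Q: "Q > 0"
    and T0: "(\<integral>\<^sup>+x. ennreal (d x powr (\<beta> - 1) * \<bar>f x\<bar> powr p) \<partial>lborel) \<le> T"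
    and T1: "\<And>i. i \<in> Basis \<Longrightarrow> (\<integral>\<^sup>+x. ennreal (d x powr \<alpha> * pow_slope (i, 0) x) \<partial>lborel) \<le> T"
    and T2: "\<And>j. j \<in> Basis \<Longrightarrow> (\<integral>\<^sup>+x. ennreal (d x powr \<beta> * pow_slope (0, j) x + \<beta> * d x powr (\<beta> - 1) * \<bar>f x\<bar> powr p) \<partial>lborel) \<le> T"
  shows "I \<le> epow I (1 / D) * T"
proof -
  define n where "n = real (DIM('a) + DIM('b))"
  have "DIM('a) + DIM('b) \<ge> 2" using DIM_positive[where 'a='a] DIM_positive[where 'a='b] by linarith
  then have n: "n \<ge> 2" "D \<ge> n" using D unfolding n_def by linarith+
  \<comment> \<open>\<open>G\<close> collects the factors which are not line integrals; \<open>r / D\<close> is the exponent that the \<open>n\<close> exponents \<open>1/D\<close> leave to it.\<close>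
  define r where "r = D - n + 1"
  have r: "r \<ge> 1" using n by (simp add: r_def)
  define h where "h x = ennreal (d x powr \<alpha> * \<bar>f x\<bar> powr Q)" for x
  define z where "z x = ennreal (d x powr (\<beta> - 1) * \<bar>f x\<bar> powr p)" for x
  define G where "G x = epow (h x) (1 / r) * epow (z x) ((D - n) / r)" for x
  define u where "u b x = (if snd b = 0 then ennreal (d x powr \<alpha> * pow_slope b x)
      else ennreal (d x powr \<beta> * pow_slope b x + \<beta> * d x powr (\<beta> - 1) * \<bar>f x\<bar> powr p))" for b x
  have [measurable]: "h \<in> borel_measurable borel" "z \<in> borel_measurable borel"
    unfolding h_def z_def by measurable
  then have [measurable]: "G \<in> borel_measurable borel" unfolding G_def by measurable
  have um: "u b \<in> borel_measurable borel" for b unfolding u_def by measurable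
  have line: "ennreal (d x powr (if snd b = 0 then \<alpha> else \<beta>) * \<bar>f x\<bar> powr p) \<le> (\<integral>\<^sup>+t. u b (x + t *\<^sub>R b) \<partial>lborel)"
    if b: "b \<in> Basis" for b x
  proof (cases "snd b = 0")
    case True
    have "ennreal (d x powr \<alpha> * \<bar>f x\<bar> powr p) \<le>
      (\<integral>\<^sup>+t. ennreal (d (x + t *\<^sub>R b) powr \<alpha> * pow_slope b (x + t *\<^sub>R b) + 0 * \<bar>f (x + t *\<^sub>R b)\<bar> powr p) \<partial>lborel)"
      using b True nonzero_Basis[OF b]
      by (intro weighted_le_full_line_integral cont_d_powr)
        (auto intro!: slope_leI_Lipschitz simp: d_def)
    then show ?thesis using True by (simp add: u_def)
  next
    case False
    have "ennreal (d x powr \<beta> * \<bar>f x\<bar> powr p) \<le>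
      (\<integral>\<^sup>+t. ennreal (d (x + t *\<^sub>R b) powr \<beta> * pow_slope b (x + t *\<^sub>R b) + (\<beta> * d (x + t *\<^sub>R b) powr (\<beta> - 1)) * \<bar>f (x + t *\<^sub>R b)\<bar> powr p) \<partial>lborel)"
      using b nonzero_Basis[OF b] \<beta> by (intro weighted_le_full_line_integral cont_d_powr continuous_intros slope_d_powr) auto
    then show ?thesis using False by (simp add: u_def)
  qed
  have pointwise: "h x \<le> epow (G x) (r / D) * (\<Prod>b\<in>Basis. epow (\<integral>\<^sup>+t. u b (x + t *\<^sub>R b) \<partial>lborel) (1 / D))" for x
  proof (cases "f x = 0")
    case False
    then have "x \<in> K" using off by blast
    then have dx: "d x > 0" using d_pos K(2) by blast
    define s where "s = \<bar>f x\<bar>"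
    have s: "s > 0" using False by (simp add: s_def)
    have "(d x powr \<alpha> * s powr Q) powr (1 / D) * (d x powr (\<beta> - 1) * s powr p) powr ((D - n) / D) *
       (d x powr ((DIM('a) * \<alpha> + DIM('b) * \<beta>) * (1 / D)) * (s powr p) powr ((DIM('a) + DIM('b)) * (1 / D))) =
      d x powr (\<alpha> * (1 / D) + (\<beta> - 1) * ((D - n) / D) + (DIM('a) * \<alpha> + DIM('b) * \<beta>) * (1 / D)) *
      s powr (Q * (1 / D) + p * ((D - n) / D) + p * (n * (1 / D)))"
      using powr_product_regroup[OF dx s] by (simp add: n_def)
    also have "\<alpha> * (1 / D) + (\<beta> - 1) * ((D - n) / D) + (DIM('a) * \<alpha> + DIM('b) * \<beta>) * (1 / D) =
      (\<alpha> + (\<beta> - 1) * (D - n) + (real DIM('a) * \<alpha> + real DIM('b) * \<beta>)) / D"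
      by (simp add: add_divide_distrib)
    also have "\<dots> = \<alpha>"
      using exp_d n by (simp add: n_def)
    also have "Q * (1 / D) + p * ((D - n) / D) + p * (n * (1 / D)) = (Q + p * D) / D"
      using n by (simp add: field_simps)
    also have "\<dots> = Q"
      using exp_f n by simp
    finally have "h x = ennreal ((d x powr \<alpha> * s powr Q) powr (1 / D) * (d x powr (\<beta> - 1) * s powr p) powr ((D - n) / D) *
       (\<Prod>b\<in>(Basis :: ('a \<times> 'b) set). (d x powr (if snd b = 0 then \<alpha> else \<beta>) * s powr p) powr (1 / D)))"
      using dx s by (simp add: prod_Basis_powr h_def s_def)
    also have "\<dots> = epow (h x) (1 / D) * epow (z x) ((D - n) / D) *
       (\<Prod>b\<in>(Basis :: ('a \<times> 'b) set). epow (ennreal (d x powr (if snd b = 0 then \<alpha> else \<beta>) * s powr p)) (1 / D))"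
      using dx s unfolding h_def z_def s_def[symmetric]
      by (simp add: epow_ennreal_pos prod_ennreal ennreal_mult[symmetric] prod_nonneg)
    also have "\<dots> \<le> epow (h x) (1 / D) * epow (z x) ((D - n) / D) *
       (\<Prod>b\<in>Basis. epow (\<integral>\<^sup>+t. u b (x + t *\<^sub>R b) \<partial>lborel) (1 / D))"
      using n by (intro mult_left_mono prod_mono_ennreal epow_mono) (auto simp: s_def line)
    also have "epow (h x) (1 / D) * epow (z x) ((D - n) / D) = epow (G x) (r / D)"
      using n r by (simp add: G_def epow_mult epow_epow)
    finally show ?thesis .
  qed (use Q in \<open>simp add: h_def\<close>)
  have "I \<le> (\<integral>\<^sup>+x. epow (G x) (r / D) * (\<Prod>b\<in>Basis. epow (\<integral>\<^sup>+t. u b (x + t *\<^sub>R b) \<partial>lborel) (1 / D)) \<partial>lborel)"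
    unfolding I_def h_def[symmetric] by (intro nn_integral_mono pointwise)
  also have "\<dots> \<le> epow (\<integral>\<^sup>+x. G x \<partial>lborel) (r / D) * (\<Prod>b\<in>Basis. epow (\<integral>\<^sup>+x. u b x \<partial>lborel) (1 / D))"
    using n r by (intro Loomis_Whitney_Finner_lborel um) (auto simp: r_def n_def field_simps)
  also have "\<dots> \<le> (epow I (1 / D) * epow T ((D - n) / D)) * (\<Prod>b\<in>(Basis :: ('a \<times> 'b) set). epow T (1 / D))"
  proof (intro mult_mono prod_mono_ennreal epow_mono)
    have "(\<integral>\<^sup>+x. G x \<partial>lborel) \<le> epow I (1 / r) * epow (\<integral>\<^sup>+x. z x \<partial>lborel) (1 - 1 / r)"
    proof -
      have "(D - n) / r = 1 - 1 / r" using r by (simp add: r_def field_simps)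
      then show ?thesis
        unfolding G_def I_def h_def[symmetric] using r by (simp only:) (intro nn_integral_Holder2; simp)
    qed
    then have "epow (\<integral>\<^sup>+x. G x \<partial>lborel) (r / D) \<le> epow (epow I (1 / r) * epow (\<integral>\<^sup>+x. z x \<partial>lborel) (1 - 1 / r)) (r / D)"
      using r n by (intro epow_mono) auto
    also have "\<dots> = epow I (1 / D) * epow (\<integral>\<^sup>+x. z x \<partial>lborel) ((D - n) / D)"
    proof -
      have "(1 - 1 / r) * r = D - n" using r by (simp add: left_diff_distrib) (simp add: r_def)
      then have "(1 - 1 / r) * (r / D) = (D - n) / D" by (simp add: times_divide_eq_right)
      then show ?thesis using r n by (simp add: epow_mult epow_epow)
    qed
    also have "\<dots> \<le> epow I (1 / D) * epow T ((D - n) / D)"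
      using T0 n unfolding z_def by (intro mult_left_mono epow_mono) auto
    finally show "epow (\<integral>\<^sup>+x. G x \<partial>lborel) (r / D) \<le> epow I (1 / D) * epow T ((D - n) / D)" .
    fix b :: "'a \<times> 'b" assume "b \<in> Basis"
    then consider i where "b = (i, 0)" "i \<in> Basis" | j where "b = (0, j)" "j \<in> Basis"
      by (auto simp: Basis_prod_def)
    then show "(\<integral>\<^sup>+x. u b x \<partial>lborel) \<le> T"
      using T1 T2 by cases (auto simp: u_def nonzero_Basis)
  qed (use n in auto)
  also have "\<dots> = epow I (1 / D) * (epow T ((D - n) / D) * epow (epow T (1 / D)) n)"
  proof -
    have "(\<Prod>b\<in>(Basis :: ('a \<times> 'b) set). epow T (1 / D)) = epow (epow T (1 / D)) n"
      by (simp add: n_def epow_of_nat[symmetric])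
    then show ?thesis by (simp add: mult.assoc)
  qed
  also have "epow T ((D - n) / D) * epow (epow T (1 / D)) n = T"
  proof -
    have "(D - n) / D + n / D = 1" using n by (simp add: field_simps)
    then show ?thesis using n by (simp add: epow_epow epow_add[symmetric])
  qed
  finally show ?thesis .
qed

end

section \<open>The weighted Sobolev inequality\<close>

lemma absorb_power:
  fixes I E :: ennreal and c \<kappa> :: real
  assumes le: "I \<le> ennreal c * (epow I \<kappa> * epow E (1 / 2))" and "I < \<infinity>" and c: "c > 0" and \<kappa>: "\<kappa> \<ge> 0" "\<kappa> < 1"
  shows "epow I (2 * (1 - \<kappa>)) \<le> ennreal (c\<^sup>2) * E"
proof -
  consider "I = 0" | "E = top" | "I \<noteq> 0" "E \<noteq> top" by blast
  then show ?thesis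
  proof cases
    case 1
    then show ?thesis using \<kappa> by (simp add: epow_0_left)
  next
    case 2
    then show ?thesis using c by (simp add: ennreal_mult_top)
  next
    case 3
    obtain i where i: "I = ennreal i" "i > 0" using 3(1) assms(2) by (cases I) (auto simp: less_le)
    obtain e where e: "E = ennreal e" "e \<ge> 0" using 3(2) by (cases E) auto
    have "ennreal i \<le> ennreal (c * (i powr \<kappa> * e powr (1 / 2)))"
      using le i e c by (simp add: epow_ennreal_pos epow_ennreal ennreal_mult)
    then have le': "i \<le> c * (i powr \<kappa> * e powr (1 / 2))"
      using c by (subst (asm) ennreal_le_iff) auto
    have "i powr (1 - \<kappa>) = i / i powr \<kappa>" using i by (simp add: powr_diff)
    also have "\<dots> \<le> c * e powr (1 / 2)"
      using le' i by (simp add: divide_simps mult_ac)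
    finally have "(i powr (1 - \<kappa>))\<^sup>2 \<le> (c * e powr (1 / 2))\<^sup>2"
      by (intro power_mono) auto
    moreover have "(i powr (1 - \<kappa>))\<^sup>2 = i powr (2 * (1 - \<kappa>))"
      by (simp add: power2_eq_square powr_add[symmetric])
    moreover have "(c * e powr (1 / 2))\<^sup>2 = c\<^sup>2 * e"
      using e by (simp add: power_mult_distrib powr_half_sqrt)
    ultimately show ?thesis
      using i e by (simp add: epow_ennreal_pos ennreal_mult[symmetric] ennreal_leI)
  qed
qed

lemma powr_interpolate:
  fixes t s :: real
  assumes "t > 0" "s > 0"
  shows "(t powr a * s powr q) powr \<theta> * (t powr a * s powr r) powr (1 - \<theta>) = t powr a * s powr (q * \<theta> + r * (1 - \<theta>))"
proof -
  have "(t powr a * s powr q) powr \<theta> * (t powr a * s powr r) powr (1 - \<theta>) =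
      t powr (a * \<theta> + a * (1 - \<theta>)) * s powr (q * \<theta> + r * (1 - \<theta>))"
    using assms by (simp add: powr_mult powr_powr powr_add mult_ac)
  also have "a * \<theta> + a * (1 - \<theta>) = a" by (simp add: algebra_simps)
  finally show ?thesis .
qed

context weighted_C1_supported
begin

text \<open>Split \<open>d\<^sup>\<gamma> |f|\<^sup>p\<^sup>-\<^sup>1 |\<partial>\<^sub>v f|\<close> into
  \<open>d\<^sup>\<alpha>\<^sup>/\<^sup>2 |f|\<^sup>p\<^sup>-\<^sup>1\<close> and \<open>d\<^sup>\<tau>\<^sup>/\<^sup>2
  |\<partial>\<^sub>v f|\<close>. The cases of interest are \<open>\<tau> = \<alpha>\<close> for the first factor of the
  space and \<open>\<tau> = \<alpha> + \<sigma>\<close> for the second.\<close>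
lemma Cauchy_Schwarz_energy:
  assumes \<gamma>: "\<gamma> = (\<alpha> + \<tau>) / 2" and [measurable]: "\<epsilon> \<in> borel_measurable borel"
    and \<epsilon>: "\<And>x. d x powr \<tau> * (Df x v)\<^sup>2 \<le> \<epsilon> x"
  shows "(\<integral>\<^sup>+x. ennreal (d x powr \<gamma> * pow_slope v x) \<partial>lborel) \<le> ennreal p *
    (epow (\<integral>\<^sup>+x. ennreal (d x powr \<alpha> * \<bar>f x\<bar> powr (2 * p - 2)) \<partial>lborel) (1 / 2) * epow (\<integral>\<^sup>+x. ennreal (\<epsilon> x) \<partial>lborel) (1 / 2))"
proof -
  define u where "u x = ennreal (d x powr \<alpha> * \<bar>f x\<bar> powr (2 * p - 2))" for x
  have [measurable]: "u \<in> borel_measurable borel" unfolding u_def by measurable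
  have "(\<integral>\<^sup>+x. ennreal (d x powr \<gamma> * pow_slope v x) \<partial>lborel) \<le>
    (\<integral>\<^sup>+x. ennreal p * (epow (u x) (1 / 2) * epow (ennreal (\<epsilon> x)) (1 - 1 / 2)) \<partial>lborel)"
  proof (rule nn_integral_mono)
    fix x
    have "d x powr \<gamma> * pow_slope v x = p * (d x powr (\<alpha> / 2) * \<bar>f x\<bar> powr (p - 1)) * (d x powr (\<tau> / 2) * \<bar>Df x v\<bar>)"
      by (simp add: \<gamma> pow_slope_def add_divide_distrib powr_add)
    also have "d x powr (\<tau> / 2) * \<bar>Df x v\<bar> = (d x powr \<tau> * (Df x v)\<^sup>2) powr (1 / 2)"
      by (simp add: powr_mult powr_powr powr_half_sqrt)
    also have "d x powr (\<alpha> / 2) * \<bar>f x\<bar> powr (p - 1) = (d x powr \<alpha> * \<bar>f x\<bar> powr (2 * p - 2)) powr (1 / 2)"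
      by (simp add: powr_mult powr_powr diff_divide_distrib)
    finally have "ennreal (d x powr \<gamma> * pow_slope v x) = ennreal p * (epow (u x) (1 / 2) * epow (ennreal (d x powr \<tau> * (Df x v)\<^sup>2)) (1 / 2))"
      unfolding u_def using p by (subst (1 2) epow_ennreal) (auto simp: ennreal_mult mult.assoc)
    also have "\<dots> \<le> ennreal p * (epow (u x) (1 / 2) * epow (ennreal (\<epsilon> x)) (1 / 2))"
      by (intro mult_left_mono epow_mono ennreal_leI \<epsilon>) auto
    finally show "ennreal (d x powr \<gamma> * pow_slope v x) \<le> ennreal p * (epow (u x) (1 / 2) * epow (ennreal (\<epsilon> x)) (1 - 1 / 2))"
      by simp
  qed
  also have "\<dots> = ennreal p * (\<integral>\<^sup>+x. epow (u x) (1 / 2) * epow (ennreal (\<epsilon> x)) (1 - 1 / 2) \<partial>lborel)"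
    by (rule nn_integral_cmult) measurable
  also have "\<dots> \<le> ennreal p * (epow (\<integral>\<^sup>+x. u x \<partial>lborel) (1 / 2) * epow (\<integral>\<^sup>+x. ennreal (\<epsilon> x) \<partial>lborel) (1 - 1 / 2))"
    by (intro mult_left_mono nn_integral_Holder2) auto
  finally show ?thesis by (simp add: u_def)
qed

end

text \<open>\<open>A\<close> and \<open>B\<close> stand for the lengths of the two partial gradients.\<close>
locale energy_bounded = weighted_C1_supported f Df K \<Omega> p
  for f :: "'a::euclidean_space \<times> 'b::euclidean_space \<Rightarrow> real" and Df K \<Omega> p +
  fixes A B :: "'a \<times> 'b \<Rightarrow> real" and \<alpha> \<sigma> :: real
  assumes A: "A \<in> borel_measurable borel" "\<And>x a. norm a = 1 \<Longrightarrow> \<bar>Df x (a, 0)\<bar> \<le> A x"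
    and B: "B \<in> borel_measurable borel" "\<And>x v. norm v = 1 \<Longrightarrow> \<bar>Df x (0, v)\<bar> \<le> B x"
begin

definition energy :: ennreal where
  "energy = (\<integral>\<^sup>+x. ennreal (d x powr \<alpha> * ((A x)\<^sup>2 + d x powr \<sigma> * (B x)\<^sup>2)) \<partial>lborel)"

definition weighted_power_integral :: "real \<Rightarrow> ennreal" where
  "weighted_power_integral Q = (\<integral>\<^sup>+x. ennreal (d x powr \<alpha> * \<bar>f x\<bar> powr Q) \<partial>lborel)"

lemma weighted_power_integral_finite: "Q > 0 \<Longrightarrow> weighted_power_integral Q < \<infinity>"
  unfolding weighted_power_integral_def by (intro finite_weighted cont_abs_powr) (auto simp: off)

text \<open>With \<open>Q = 2 * p - 2\<close> this is the product of the square roots of \<open>\<integral> d\<^sup>\<alpha>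
  |f|\<^sup>Q\<close> and of the energy, in terms of which all the \<open>L\<^sup>1\<close> quantities for
  \<open>|f|\<^sup>p\<close> are bounded.\<close>
abbreviation CS_bound :: ennreal where
  "CS_bound \<equiv> epow (weighted_power_integral (2 * p - 2)) (1 / 2) * epow energy (1 / 2)"

lemma integral_fst_le:
  assumes "norm a = 1"
  shows "(\<integral>\<^sup>+x. ennreal (d x powr \<alpha> * pow_slope (a, 0) x) \<partial>lborel) \<le> ennreal p * CS_bound"
  unfolding weighted_power_integral_def energy_def
proof (rule Cauchy_Schwarz_energy)
  note [measurable] = A(1) B(1)
  show "(\<lambda>x. d x powr \<alpha> * ((A x)\<^sup>2 + d x powr \<sigma> * (B x)\<^sup>2)) \<in> borel_measurable borel" by measurable
  fix x
  have "(Df x (a, 0))\<^sup>2 \<le> (A x)\<^sup>2" using A(2)[OF assms] by (rule power2_le_iff_abs_le[THEN iffD2, rotated]) (use A(2)[OF assms, of x] in linarith)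
  also have "\<dots> \<le> (A x)\<^sup>2 + d x powr \<sigma> * (B x)\<^sup>2" by simp
  finally show "d x powr \<alpha> * (Df x (a, 0))\<^sup>2 \<le> d x powr \<alpha> * ((A x)\<^sup>2 + d x powr \<sigma> * (B x)\<^sup>2)"
    by (rule mult_left_mono) simp
qed simp

lemma integral_snd_le:
  assumes "norm v = 1"
  shows "(\<integral>\<^sup>+x. ennreal (d x powr (\<alpha> + \<sigma> / 2) * pow_slope (0, v) x) \<partial>lborel) \<le> ennreal p * CS_bound"
  unfolding weighted_power_integral_def energy_def
proof (rule Cauchy_Schwarz_energy)
  note [measurable] = A(1) B(1)
  show "(\<lambda>x. d x powr \<alpha> * ((A x)\<^sup>2 + d x powr \<sigma> * (B x)\<^sup>2)) \<in> borel_measurable borel" by measurable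
  show "\<alpha> + \<sigma> / 2 = (\<alpha> + (\<alpha> + \<sigma>)) / 2" by simp
  fix x
  have "(Df x (0, v))\<^sup>2 \<le> (B x)\<^sup>2" using B(2)[OF assms] by (rule power2_le_iff_abs_le[THEN iffD2, rotated]) (use B(2)[OF assms, of x] in linarith)
  then have "d x powr \<sigma> * (Df x (0, v))\<^sup>2 \<le> (A x)\<^sup>2 + d x powr \<sigma> * (B x)\<^sup>2" 
    by (intro add_increasing mult_left_mono) auto
  then have "d x powr \<alpha> * (d x powr \<sigma> * (Df x (0, v))\<^sup>2) \<le> d x powr \<alpha> * ((A x)\<^sup>2 + d x powr \<sigma> * (B x)\<^sup>2)"
    by (rule mult_left_mono) simp
  then show "d x powr (\<alpha> + \<sigma>) * (Df x (0, v))\<^sup>2 \<le> d x powr \<alpha> * ((A x)\<^sup>2 + d x powr \<sigma> * (B x)\<^sup>2)"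
    by (simp add: powr_add mult.assoc)
qed

lemma weighted_power_integral_p_le: "weighted_power_integral p \<le> ennreal (2 * p) * CS_bound"
proof -
  obtain a :: 'a where a: "norm a = 1" using norm_Basis nonempty_Basis by blast
  have "weighted_power_integral p \<le> 2 * (ennreal p * CS_bound)"
    unfolding weighted_power_integral_def
    by (rule order_trans[OF Poincare_fst[OF a] mult_left_mono[OF integral_fst_le[OF a, unfolded weighted_power_integral_def]]]) simp
  also have "\<dots> = ennreal (2 * p) * CS_bound"
    using p by (simp add: ennreal_mult mult.assoc)
  finally show ?thesis .
qed

text \<open>Poincare's inequality for \<open>f\<^sup>2\<close>; the integral itself reappears on the right and is
  absorbed.\<close>
lemma L2_bound:
  assumes "p = 2"
  shows "weighted_power_integral 2 \<le> ennreal 16 * energy"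
proof -
  have "weighted_power_integral 2 \<le> ennreal 4 * (epow (weighted_power_integral 2) (1 / 2) * epow energy (1 / 2))"
    using weighted_power_integral_p_le assms by simp
  from absorb_power[OF this weighted_power_integral_finite] show ?thesis by simp
qed

text \<open>Hoelder's inequality between the exponents \<open>2\<close> and \<open>R\<close>; both end points carry the same
  weight, so the weight is not affected.\<close>
lemma interpolate:
  assumes "0 \<le> \<theta>" "\<theta> \<le> 1" and Q: "Q = 2 * (1 - \<theta>) + R * \<theta>" "R > 0" "Q > 0"
    and c: "c \<ge> 0" and b2: "weighted_power_integral 2 \<le> ennreal c * energy" and bR: "epow (weighted_power_integral R) (2 / R) \<le> ennreal c * energy"
  shows "epow (weighted_power_integral Q) (2 / Q) \<le> ennreal c * energy"
proof -
  let ?u = "\<lambda>q x. ennreal (d x powr \<alpha> * \<bar>f x\<bar> powr q)"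
  let ?M = "ennreal c * energy"
  have "weighted_power_integral Q \<le> (\<integral>\<^sup>+x. epow (?u R x) \<theta> * epow (?u 2 x) (1 - \<theta>) \<partial>lborel)"
    unfolding weighted_power_integral_def
  proof (rule nn_integral_mono)
    fix x
    show "?u Q x \<le> epow (?u R x) \<theta> * epow (?u 2 x) (1 - \<theta>)"
    proof (cases "f x = 0")
      case False
      then have dx: "d x > 0" using off K(2) d_pos by blast
      have "d x powr \<alpha> * \<bar>f x\<bar> powr Q = (d x powr \<alpha> * \<bar>f x\<bar> powr R) powr \<theta> * (d x powr \<alpha> * \<bar>f x\<bar> powr 2) powr (1 - \<theta>)"
        unfolding Q(1) using dx False by (subst powr_interpolate) (auto simp: add.commute)
      then show ?thesis using dx False by (simp add: epow_ennreal_pos ennreal_mult[symmetric])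
    qed (use Q in simp)
  qed
  also have "\<dots> \<le> epow (weighted_power_integral R) \<theta> * epow (weighted_power_integral 2) (1 - \<theta>)"
    unfolding weighted_power_integral_def using assms by (intro nn_integral_Holder2) auto
  finally have "epow (weighted_power_integral Q) (2 / Q) \<le> epow (epow (weighted_power_integral R) \<theta> * epow (weighted_power_integral 2) (1 - \<theta>)) (2 / Q)"
    using Q by (intro epow_mono) auto
  also have "\<dots> = epow (epow (weighted_power_integral R) (2 / R)) (R * \<theta> / Q) * epow (weighted_power_integral 2) (2 * (1 - \<theta>) / Q)"
    using assms by (simp add: epow_mult epow_epow field_simps)
  also have "\<dots> \<le> epow ?M (R * \<theta> / Q) * epow ?M (2 * (1 - \<theta>) / Q)"
    using assms by (intro mult_mono epow_mono) auto
  also have "\<dots> = epow ?M (R * \<theta> / Q + 2 * (1 - \<theta>) / Q)"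
    using assms by (intro epow_add[symmetric]) auto
  also have "R * \<theta> / Q + 2 * (1 - \<theta>) / Q = 1"
    using Q by (simp add: add_divide_distrib[symmetric] add.commute)
  finally show ?thesis by simp
qed

end

text \<open>The choice \<open>p = Q / 2 + 1\<close> satisfies both \<open>2 * p - 2 = Q\<close>, as the Cauchy--Schwarz
  inequality requires, and \<open>Q + p * D = D * Q\<close>, as the Gagliardo--Nirenberg inequality requires. With
  \<open>\<beta> = \<alpha> + \<sigma> / 2\<close>, the value of \<open>D\<close> is the one for which the powers of
  \<open>d\<close> match. Hence \<open>I = \<integral> d\<^sup>\<alpha> |f|\<^sup>Q\<close> is at most a multiple of
  \<open>I\<^sup>1\<^sup>/\<^sup>D\<close> times \<open>I\<^sup>1\<^sup>/\<^sup>2\<close> times the square root of the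
  energy, and dividing by the powers of \<open>I\<close> finishes the proof.\<close>
theorem critical_bound:
  fixes \<Omega> :: "'b::euclidean_space set" and \<alpha> \<sigma> D :: real
  defines "n \<equiv> real (DIM('a::euclidean_space) + DIM('b))" and "Q \<equiv> 2 * D / (D - 2)"
  assumes \<Omega>: "smooth_bounded_domain \<Omega>" and pos: "\<alpha> + \<sigma> / 2 > 0" and D: "D \<ge> n" "D > 2"
    and D_eq: "(2 - \<sigma>) * (D - n) = 2 * \<alpha> + \<sigma> * DIM('b)"
  obtains C :: real where "C > 0"
    "\<And>(f :: 'a \<times> 'b \<Rightarrow> real) Df K A B. energy_bounded f Df K \<Omega> (Q / 2 + 1) A B \<Longrightarrow>
      epow (energy_bounded.weighted_power_integral f \<Omega> \<alpha> Q) (2 / Q) \<le> ennreal C * energy_bounded.energy \<Omega> A B \<alpha> \<sigma>"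
proof -
  define \<beta> where "\<beta> = \<alpha> + \<sigma> / 2"
  define p where "p = Q / 2 + 1"
  have Q: "Q > 0" using D by (simp add: Q_def)
  then have p: "p > 1" "2 * p - 2 = Q" by (auto simp: p_def)
  show ?thesis
  proof (rule Hardy_uniform[OF \<Omega>, of \<beta> \<alpha>, where 'a='a])
    show "\<beta> > 0" using pos by (simp add: \<beta>_def)
    fix H :: real
    assume H: "H > 0" and Hardy: "\<And>f Df K p X. weighted_C1_supported (f :: 'a \<times> 'b \<Rightarrow> real) Df K \<Omega> p \<Longrightarrow>
      (\<And>v. norm v = 1 \<Longrightarrow> (\<integral>\<^sup>+x. ennreal (weighted_C1_supported.d \<Omega> x powr \<beta> * C1_supported.pow_slope f Df p (0, v) x) \<partial>lborel) \<le> X) \<Longrightarrow>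
      (\<integral>\<^sup>+x. ennreal (weighted_C1_supported.d \<Omega> x powr (\<beta> - 1) * \<bar>f x\<bar> powr p) \<partial>lborel) \<le>
        ennreal H * (X + (\<integral>\<^sup>+x. ennreal (weighted_C1_supported.d \<Omega> x powr \<alpha> * \<bar>f x\<bar> powr p) \<partial>lborel))"
    \<comment> \<open>The sum of the constants for the derivatives, for the Hardy term, and for the Hardy term times the factor \<open>\<beta>\<close> that comes from differentiating \<open>d\<^sup>\<beta>\<close>.\<close>
    define c where "c = p + 3 * H * p + \<beta> * (3 * H * p)"
    have c: "c > 0" using p H \<open>\<beta> > 0\<close> by (simp add: c_def add_pos_pos)
    show ?thesis
    proof (rule that[of "c\<^sup>2"])
      show "c\<^sup>2 > 0" using c by simp
      fix f :: "'a \<times> 'b \<Rightarrow> real" and Df K A B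
      assume "energy_bounded f Df K \<Omega> (Q / 2 + 1) A B"
      then interpret W: energy_bounded f Df K \<Omega> p A B \<alpha> \<sigma> unfolding p_def .
      note [measurable] = W.borel_d W.borel_f W.borel_pow_slope
      let ?S = "W.CS_bound" and ?Z = "\<integral>\<^sup>+x. ennreal (W.d x powr (\<beta> - 1) * \<bar>f x\<bar> powr p) \<partial>lborel"
      have Z: "?Z \<le> ennreal (3 * H * p) * ?S"
      proof -
        have "(\<integral>\<^sup>+x. ennreal (W.d x powr \<beta> * W.pow_slope (0, v) x) \<partial>lborel) \<le> ennreal p * ?S" if "norm v = 1" for v
          using W.integral_snd_le[OF that] by (simp add: \<beta>_def)
        from Hardy[OF W.weighted_C1_supported_axioms this]
        have "?Z \<le> ennreal H * (ennreal p * ?S + W.weighted_power_integral p)"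
          by (simp only: W.weighted_power_integral_def[of p])
        also have "\<dots> \<le> ennreal H * (ennreal p * ?S + ennreal (2 * p) * ?S)"
          by (intro mult_left_mono add_left_mono W.weighted_power_integral_p_le) auto
        also have "\<dots> = ennreal H * (ennreal p + ennreal (2 * p)) * ?S"
          by (simp only: distrib_right mult.assoc)
        also have "ennreal p + ennreal (2 * p) = ennreal (3 * p)"
          using p by (simp add: ennreal_plus[symmetric])
        also have "ennreal H * ennreal (3 * p) = ennreal (3 * H * p)"
          using H p by (simp add: ennreal_mult[symmetric] mult_ac)
        finally show ?thesis .
      qed
      have le_c: "ennreal k * ?S \<le> ennreal c * ?S" if "k \<le> c" for k
        using that by (intro mult_right_mono ennreal_leI) auto
      have nonneg: "0 \<le> 3 * H * p" "0 \<le> \<beta> * (3 * H * p)" using H p \<open>\<beta> > 0\<close> by auto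
      have "W.weighted_power_integral Q \<le> epow (W.weighted_power_integral Q) (1 / D) * (ennreal c * ?S)"
        unfolding W.weighted_power_integral_def[of Q]
      proof (rule W.weighted_Gagliardo_Nirenberg[OF \<open>\<beta> > 0\<close>])
        show "D \<ge> real (DIM('a) + DIM('b))" using D by (simp add: n_def)
        have "2 * ((\<beta> - 1) * (D - n)) = - (2 - \<sigma>) * (D - n) + 2 * \<alpha> * (D - n)"
        proof -
          have "2 * (\<beta> - 1) = - (2 - \<sigma>) + 2 * \<alpha>" by (simp add: \<beta>_def)
          then show ?thesis by (simp only: mult.assoc[symmetric] distrib_right)
        qed
        also have "\<dots> = - (2 * \<alpha> + \<sigma> * DIM('b)) + 2 * \<alpha> * (D - n)"
          unfolding mult_minus_left D_eq by (rule refl)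
        finally have eq: "2 * ((\<beta> - 1) * (D - n)) = - (2 * \<alpha> + \<sigma> * DIM('b)) + 2 * \<alpha> * (D - n)" .
        have "2 * (\<alpha> + (\<beta> - 1) * (D - n) + (real DIM('a) * \<alpha> + real DIM('b) * \<beta>)) =
            2 * \<alpha> + 2 * ((\<beta> - 1) * (D - n)) + 2 * (real DIM('a) * \<alpha> + real DIM('b) * \<beta>)"
          by (simp only: distrib_left)
        also have "\<dots> = 2 * (D * \<alpha>)"
          unfolding eq by (simp add: n_def \<beta>_def algebra_simps)
        finally show "\<alpha> + (\<beta> - 1) * (D - real (DIM('a) + DIM('b))) + (real DIM('a) * \<alpha> + real DIM('b) * \<beta>) = D * \<alpha>"
          by (simp add: n_def)
        have "Q * (D - 2) = 2 * D" using D by (simp add: Q_def)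
        then show "Q + p * D = D * Q" by (simp add: p_def algebra_simps)
        show "?Z \<le> ennreal c * ?S"
          by (rule order_trans[OF Z le_c]) (use nonneg p in \<open>simp add: c_def\<close>)
        fix i :: 'a assume "i \<in> Basis"
        then show "(\<integral>\<^sup>+x. ennreal (W.d x powr \<alpha> * W.pow_slope (i, 0) x) \<partial>lborel) \<le> ennreal c * ?S"
          by (intro order_trans[OF W.integral_fst_le le_c]) (use nonneg p in \<open>auto simp: c_def\<close>)
      next
        fix j :: 'b assume "j \<in> Basis"
        then have j: "norm j = 1" by simp
        have "(\<integral>\<^sup>+x. ennreal (W.d x powr \<beta> * W.pow_slope (0, j) x + \<beta> * W.d x powr (\<beta> - 1) * \<bar>f x\<bar> powr p) \<partial>lborel) =
          (\<integral>\<^sup>+x. ennreal (W.d x powr \<beta> * W.pow_slope (0, j) x) + ennreal \<beta> * ennreal (W.d x powr (\<beta> - 1) * \<bar>f x\<bar> powr p) \<partial>lborel)"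
          using \<open>\<beta> > 0\<close> W.pow_slope_nonneg by (intro nn_integral_cong) (simp add: ennreal_plus ennreal_mult[symmetric] mult.assoc)
        also have "\<dots> = (\<integral>\<^sup>+x. ennreal (W.d x powr \<beta> * W.pow_slope (0, j) x) \<partial>lborel) + ennreal \<beta> * ?Z"
          by (simp add: nn_integral_add nn_integral_cmult)
        also have "\<dots> \<le> ennreal p * ?S + ennreal \<beta> * (ennreal (3 * H * p) * ?S)"
          using W.integral_snd_le[OF j] Z by (intro add_mono mult_left_mono) (auto simp: \<beta>_def)
        also have "\<dots> = ennreal (p + \<beta> * (3 * H * p)) * ?S"
          using p nonneg \<open>\<beta> > 0\<close> by (simp add: ennreal_plus ennreal_mult distrib_right mult.assoc)
        also have "\<dots> \<le> ennreal c * ?S"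
          by (rule le_c) (use nonneg in \<open>simp add: c_def\<close>)
        finally show "(\<integral>\<^sup>+x. ennreal (W.d x powr \<beta> * W.pow_slope (0, j) x + \<beta> * W.d x powr (\<beta> - 1) * \<bar>f x\<bar> powr p) \<partial>lborel) \<le> ennreal c * ?S" .
      qed (rule Q)
      also have "\<dots> = ennreal c * (epow (W.weighted_power_integral Q) (1 / D + 1 / 2) * epow W.energy (1 / 2))"
        unfolding p(2) using D by (simp add: epow_add mult_ac)
      finally have "epow (W.weighted_power_integral Q) (2 * (1 - (1 / D + 1 / 2))) \<le> ennreal (c\<^sup>2) * W.energy"
        using W.weighted_power_integral_finite[OF Q] c D by (intro absorb_power) (auto simp: field_simps)
      also have "2 * (1 - (1 / D + 1 / 2)) = 2 / Q"
        using D by (simp add: Q_def field_simps)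
      finally show "epow (W.weighted_power_integral Q) (2 / Q) \<le> ennreal (c\<^sup>2) * W.energy" .
    qed
  qed
qed

section \<open>Test functions and the inequality with gradients\<close>

lemma GDERIV_of_coordinates:
  fixes f :: "'a::euclidean_space \<Rightarrow> real"
  assumes "(f has_derivative L) (at x)"
  shows "GDERIV f x :> (\<Sum>i\<in>Basis. L i *\<^sub>R i)"
proof -
  interpret bounded_linear L using assms by (rule has_derivative_bounded_linear)
  have "L h = h \<bullet> (\<Sum>i\<in>Basis. L i *\<^sub>R i)" for h
  proof -
    have "L h = L (\<Sum>i\<in>Basis. (h \<bullet> i) *\<^sub>R i)" by (simp add: euclidean_representation)
    also have "\<dots> = h \<bullet> (\<Sum>i\<in>Basis. L i *\<^sub>R i)"
      by (simp add: sum scaleR inner_sum_right mult.commute)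
    finally show ?thesis .
  qed
  then have "L = (\<lambda>h. h \<bullet> (\<Sum>i\<in>Basis. L i *\<^sub>R i))" by (rule ext)
  then show ?thesis using assms unfolding gderiv_def by simp
qed

lemma partial_gradients:
  fixes f :: "'a::euclidean_space \<times> 'b::euclidean_space \<Rightarrow> real"
  assumes "(f has_derivative L) (at x)"
  shows "grad_fst f x = (\<Sum>i\<in>Basis. L (i, 0) *\<^sub>R i)" "\<And>a. L (a, 0) = a \<bullet> grad_fst f x"
    and "grad_snd f x = (\<Sum>j\<in>Basis. L (0, j) *\<^sub>R j)" "\<And>b. L (0, b) = b \<bullet> grad_snd f x"
proof -
  have f: "(f has_derivative L) (at (fst x, snd x))" using assms by simp
  have 1: "((\<lambda>y. f (y, snd x)) has_derivative (\<lambda>a. L (a, 0))) (at (fst x))"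
    by (rule has_derivative_compose[where f="\<lambda>y. (y, snd x)" and g=f, OF _ f]) (auto intro!: derivative_eq_intros)
  have 2: "((\<lambda>y. f (fst x, y)) has_derivative (\<lambda>b. L (0, b))) (at (snd x))"
    by (rule has_derivative_compose[where f="\<lambda>y. (fst x, y)" and g=f, OF _ f]) (auto intro!: derivative_eq_intros)
  note G = GDERIV_of_coordinates[OF 1] GDERIV_of_coordinates[OF 2]
  show g1: "grad_fst f x = (\<Sum>i\<in>Basis. L (i, 0) *\<^sub>R i)"
    unfolding grad_fst_def by (rule grad_eq[OF G(1)])
  show g2: "grad_snd f x = (\<Sum>j\<in>Basis. L (0, j) *\<^sub>R j)"
    unfolding grad_snd_def by (rule grad_eq[OF G(2)])
  show "L (a, 0) = a \<bullet> grad_fst f x" for a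
    using has_derivative_unique[OF 1 G(1)[unfolded gderiv_def]] unfolding g1 by metis
  show "L (0, b) = b \<bullet> grad_snd f x" for b
    using has_derivative_unique[OF 2 G(2)[unfolded gderiv_def]] unfolding g2 by metis
qed

lemma has_derivative_zero_off_support:
  fixes f :: "'a::real_normed_vector \<Rightarrow> real"
  assumes "(f has_derivative L) (at x)" "x \<notin> closure (support_on UNIV f)"
  shows "L v = 0"
proof -
  have "((\<lambda>_. 0 :: real) has_derivative (\<lambda>_. 0)) (at x)" by simp
  then have "(f has_derivative (\<lambda>_. 0)) (at x)"
  proof (rule has_derivative_transform_within_open)
    show "open (- closure (support_on UNIV f))" by auto
    fix y assume "y \<in> - closure (support_on UNIV f)"
    then show "0 = f y" using closure_subset[of "support_on UNIV f"] by (auto simp: support_on_def)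
  qed (use assms in auto)
  then show ?thesis using has_derivative_unique[OF assms(1)] by metis
qed

lemma test_function_energy_bounded:
  fixes f :: "'a::euclidean_space \<times> 'b::euclidean_space \<Rightarrow> real"
  assumes f: "f \<in> test_functions (ball 0 1 \<times> \<Omega>)" and \<Omega>: "smooth_bounded_domain \<Omega>" and p: "p > 1"
  shows "energy_bounded f (\<lambda>x. frechet_derivative f (at x)) (closure (support_on UNIV f)) \<Omega> p
    (\<lambda>x. norm (grad_fst f x)) (\<lambda>x. norm (grad_snd f x))"
    and "(\<lambda>x. norm (grad_fst f x)) \<in> borel_measurable borel" "(\<lambda>x. norm (grad_snd f x)) \<in> borel_measurable borel"
    and "energy_bounded.energy \<Omega> (\<lambda>x. norm (grad_fst f x)) (\<lambda>x. norm (grad_snd f x)) \<alpha> \<sigma> < \<infinity>"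
proof -
  let ?K = "closure (support_on UNIV f)" and ?L = "\<lambda>x. frechet_derivative f (at x)"
  have smooth: "smooth_on UNIV f" and K: "compact ?K" "?K \<subseteq> ball 0 1 \<times> \<Omega>"
    using f by (auto simp: test_functions_def)
  note D = smooth_on_UNIV_derivative(1)[OF smooth]
  note cont = smooth_on_UNIV_derivative(2)[OF smooth]
  have W: "weighted_C1_supported f ?L ?K \<Omega> p"
  proof
    have "open \<Omega>" using \<Omega> by (simp add: smooth_bounded_domain_def)
    then show "open (ball (0::'a) 1 \<times> \<Omega>)" by (intro open_Times) auto
    show "f x = 0" if "x \<notin> ?K" for x
      using that closure_subset[of "support_on UNIV f"] by (auto simp: support_on_def)
  qed (use D cont K \<Omega> p in auto)
  then interpret W: weighted_C1_supported f ?L ?K \<Omega> p .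
  have cA: "continuous_on UNIV (\<lambda>x. norm (grad_fst f x))" and cB: "continuous_on UNIV (\<lambda>x. norm (grad_snd f x))"
    unfolding partial_gradients(1)[OF D] partial_gradients(3)[OF D]
    by (intro continuous_intros cont)+
  show A: "(\<lambda>x. norm (grad_fst f x)) \<in> borel_measurable borel" and B: "(\<lambda>x. norm (grad_snd f x)) \<in> borel_measurable borel"
    using cA cB by (auto intro: borel_measurable_continuous_onI)
  show E: "energy_bounded f ?L ?K \<Omega> p (\<lambda>x. norm (grad_fst f x)) (\<lambda>x. norm (grad_snd f x))"
  proof (intro energy_bounded.intro W energy_bounded_axioms.intro A B)
    show "\<bar>?L x (a, 0)\<bar> \<le> norm (grad_fst f x)" if "norm a = 1" for x a
      using Cauchy_Schwarz_ineq2[of a "grad_fst f x"] that by (simp add: partial_gradients(2)[OF D])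
    show "\<bar>?L x (0, v)\<bar> \<le> norm (grad_snd f x)" if "norm v = 1" for x v
      using Cauchy_Schwarz_ineq2[of v "grad_snd f x"] that by (simp add: partial_gradients(4)[OF D])
  qed
  interpret E: energy_bounded f ?L ?K \<Omega> p "\<lambda>x. norm (grad_fst f x)" "\<lambda>x. norm (grad_snd f x)" \<alpha> \<sigma>
    by (rule E)
  note [measurable] = A B W.borel_d
  have zero: "grad_fst f x = 0" "grad_snd f x = 0" if "x \<notin> ?K" for x
    using has_derivative_zero_off_support[OF D that] by (simp_all add: partial_gradients(1,3)[OF D])
  have "E.energy = (\<integral>\<^sup>+x. ennreal (W.d x powr \<alpha> * (norm (grad_fst f x))\<^sup>2) + ennreal (W.d x powr (\<alpha> + \<sigma>) * (norm (grad_snd f x))\<^sup>2) \<partial>lborel)"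
    unfolding E.energy_def by (intro nn_integral_cong) (simp add: powr_add distrib_left mult.assoc)
  also have "\<dots> = (\<integral>\<^sup>+x. ennreal (W.d x powr \<alpha> * (norm (grad_fst f x))\<^sup>2) \<partial>lborel) +
     (\<integral>\<^sup>+x. ennreal (W.d x powr (\<alpha> + \<sigma>) * (norm (grad_snd f x))\<^sup>2) \<partial>lborel)"
    by (rule nn_integral_add) measurable
  also have "\<dots> < \<infinity>"
  proof -
    have "(\<integral>\<^sup>+x. ennreal (W.d x powr \<alpha> * (norm (grad_fst f x))\<^sup>2) \<partial>lborel) < \<infinity>"
      by (rule W.finite_weighted) (auto intro!: continuous_intros cA simp: zero)
    moreover have "(\<integral>\<^sup>+x. ennreal (W.d x powr (\<alpha> + \<sigma>) * (norm (grad_snd f x))\<^sup>2) \<partial>lborel) < \<infinity>"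
      by (rule W.finite_weighted) (auto intro!: continuous_intros cB simp: zero)
    ultimately show ?thesis by simp
  qed
  finally show "E.energy < \<infinity>" .
qed

text \<open>Integrands that vanish off \<open>S\<close> need no indicator, and Bochner integrals of nonnegative functions are
  nonnegative extended integrals.\<close>
lemma set_integral_eq_enn2real:
  fixes g :: "'a::euclidean_space \<Rightarrow> real"
  assumes "g \<in> borel_measurable borel" "\<And>x. g x \<ge> 0" "\<And>x. x \<notin> S \<Longrightarrow> g x = 0"
  shows "(LINT x : S | lborel. g x) = enn2real (\<integral>\<^sup>+x. ennreal (g x) \<partial>lborel)"
proof -
  have "(LINT x : S | lborel. g x) = (LINT x | lborel. g x)"
    unfolding set_lebesgue_integral_def
    by (intro Bochner_Integration.integral_cong) (auto simp: indicator_def assms(3))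
  also have "\<dots> = enn2real (\<integral>\<^sup>+x. ennreal (g x) \<partial>lborel)"
    using assms by (intro integral_eq_nn_integral) auto
  finally show ?thesis .
qed

text \<open>\<open>D\<close> is the homogeneous dimension of the energy and \<open>R\<close> the critical exponent. The
  constants at the two end points \<open>2\<close> and \<open>R\<close> do not depend on the test function, hence neither
  does the one obtained by interpolation.\<close>
theorem theorem1p6:
  fixes N k :: nat and \<Omega> :: "(real ^ 'k) set" and \<alpha> \<sigma> Q :: real
  assumes "N \<ge> 3" and "1 < k" and "k < N"
    and "CARD('m::finite) = N - k" and "CARD('k) = k"
    and "smooth_bounded_domain \<Omega>"
    and "\<alpha> > -1" and "-2 * \<alpha> < \<sigma>" and "\<sigma> < 2" and "2 * \<alpha> + \<sigma> * real k \<ge> 0"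
    and "2 \<le> Q" and "Q \<le> Q_cr N k \<alpha> \<sigma>"
  shows "\<exists>C>0. \<forall>f \<in> test_functions ((ball 0 1 :: (real ^ 'm) set) \<times> \<Omega>).
    (LINT x : ball 0 1 \<times> \<Omega> | lborel.
       infdist (snd x) (frontier \<Omega>) powr \<alpha> * \<bar>f x\<bar> powr Q) powr (2 / Q)
    \<le> C * (LINT x : ball 0 1 \<times> \<Omega> | lborel.
       infdist (snd x) (frontier \<Omega>) powr \<alpha> *
         ((norm (grad_fst f x))\<^sup>2 + infdist (snd x) (frontier \<Omega>) powr \<sigma> * (norm (grad_snd f x))\<^sup>2))"
proof -
  note \<Omega> = assms(6)
  define D where "D = real N + (2 * \<alpha> + \<sigma> * real k) / (2 - \<sigma>)"
  define R where "R = 2 * D / (D - 2)"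
  have N: "real N = real (DIM(real ^ 'm) + DIM(real ^ 'k))" using assms by simp
  have "(2 * \<alpha> + \<sigma> * real k) / (2 - \<sigma>) \<ge> 0" using assms by simp
  then have D: "D \<ge> real N" "D > 2" using assms(1) unfolding D_def by linarith+
  have D_eq: "(2 - \<sigma>) * (D - real (DIM(real ^ 'm) + DIM(real ^ 'k))) = 2 * \<alpha> + \<sigma> * DIM(real ^ 'k)"
    unfolding N[symmetric] using assms by (simp add: D_def)
  have R: "R > 2" "Q \<le> R" using D assms(12) by (auto simp: R_def Q_cr_def D_def divide_simps)
  define \<theta> where "\<theta> = (Q - 2) / (R - 2)"
  have \<theta>: "0 \<le> \<theta>" "\<theta> \<le> 1" "Q = 2 * (1 - \<theta>) + R * \<theta>"
  proof -
    show "0 \<le> \<theta>" "\<theta> \<le> 1" using R assms(11) by (auto simp: \<theta>_def)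
    have "\<theta> * (R - 2) = Q - 2" using R by (simp add: \<theta>_def)
    then show "Q = 2 * (1 - \<theta>) + R * \<theta>" by (simp add: algebra_simps)
  qed
  show ?thesis
  proof (rule critical_bound[OF \<Omega>, of \<alpha> \<sigma> D, where 'a="real ^ 'm"])
    show "0 < \<alpha> + \<sigma> / 2" using assms by simp
    show "real (DIM(real ^ 'm) + DIM(real ^ 'k)) \<le> D" using D N by simp
    show "2 < D" by fact
    show "(2 - \<sigma>) * (D - real (DIM(real ^ 'm) + DIM(real ^ 'k))) = 2 * \<alpha> + \<sigma> * real DIM(real ^ 'k)"
      by (rule D_eq)
    fix C1 :: real
    assume C1: "C1 > 0" and crit: "\<And>(f :: (real ^ 'm) \<times> (real ^ 'k) \<Rightarrow> real) Df K A B.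
      energy_bounded f Df K \<Omega> (2 * D / (D - 2) / 2 + 1) A B \<Longrightarrow>
      epow (energy_bounded.weighted_power_integral f \<Omega> \<alpha> (2 * D / (D - 2))) (2 / (2 * D / (D - 2))) \<le> ennreal C1 * energy_bounded.energy \<Omega> A B \<alpha> \<sigma>"
    define C where "C = max C1 16"
    show ?thesis
    proof (intro exI[of _ C] conjI ballI)
      show "C > 0" by (simp add: C_def)
      fix f :: "(real ^ 'm) \<times> (real ^ 'k) \<Rightarrow> real"
      assume f: "f \<in> test_functions (ball 0 1 \<times> \<Omega>)"
      let ?A = "\<lambda>x. norm (grad_fst f x)" and ?B = "\<lambda>x. norm (grad_snd f x)"
      let ?K = "closure (support_on UNIV f)"
      have "R / 2 + 1 > 1" using R by simp
      note ER = test_function_energy_bounded[OF f \<Omega> this]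
      note E2 = test_function_energy_bounded[OF f \<Omega>, of 2]
      interpret W: energy_bounded f "\<lambda>x. frechet_derivative f (at x)" ?K \<Omega> 2 ?A ?B \<alpha> \<sigma>
        using E2(1) by simp
      have le_C: "ennreal c * W.energy \<le> ennreal C * W.energy" if "c \<le> C" for c
        using that by (intro mult_right_mono ennreal_leI) auto
      have "epow (W.weighted_power_integral Q) (2 / Q) \<le> ennreal C * W.energy"
      proof (rule W.interpolate[OF \<theta>])
        show "W.weighted_power_integral 2 \<le> ennreal C * W.energy"
          by (rule order_trans[OF W.L2_bound le_C]) (auto simp: C_def)
        show "epow (W.weighted_power_integral R) (2 / R) \<le> ennreal C * W.energy"
          using order_trans[OF crit[OF ER(1)[unfolded R_def]] le_C] by (simp add: C_def R_def)
      qed (use R assms(11) C1 in \<open>auto simp: C_def\<close>)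
      moreover have "W.energy < \<infinity>" by (rule E2(4)) simp
      moreover have "W.weighted_power_integral Q < \<infinity>" using assms(11) by (intro W.weighted_power_integral_finite) simp
      ultimately have main: "enn2real (W.weighted_power_integral Q) powr (2 / Q) \<le> C * enn2real W.energy"
        using \<open>C > 0\<close> assms(11)
        by (cases "W.weighted_power_integral Q"; cases W.energy) (auto simp: epow_ennreal ennreal_mult[symmetric])
      have off: "f x = 0" "grad_fst f x = 0" "grad_snd f x = 0" if "x \<notin> ball 0 1 \<times> \<Omega>" for x
      proof -
        have x: "x \<notin> ?K" using W.K(2) that by blast
        show "f x = 0" by (rule W.off[OF x])
        show "grad_fst f x = 0" "grad_snd f x = 0"
          using has_derivative_zero_off_support[OF W.Df x] by (simp_all add: partial_gradients(1,3)[OF W.Df])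
      qed
      note [measurable] = W.borel_d W.borel_f W.A(1) W.B(1)
      have "(LINT x : ball 0 1 \<times> \<Omega> | lborel. W.d x powr \<alpha> * \<bar>f x\<bar> powr Q) = enn2real (W.weighted_power_integral Q)"
        unfolding W.weighted_power_integral_def using assms(11) by (intro set_integral_eq_enn2real) (auto simp: off)
      moreover have "(LINT x : ball 0 1 \<times> \<Omega> | lborel. W.d x powr \<alpha> * ((?A x)\<^sup>2 + W.d x powr \<sigma> * (?B x)\<^sup>2)) = enn2real W.energy"
        unfolding W.energy_def by (intro set_integral_eq_enn2real) (auto simp: off)
      ultimately show "(LINT x : ball 0 1 \<times> \<Omega> | lborel. infdist (snd x) (frontier \<Omega>) powr \<alpha> * \<bar>f x\<bar> powr Q) powr (2 / Q)
        \<le> C * (LINT x : ball 0 1 \<times> \<Omega> | lborel. infdist (snd x) (frontier \<Omega>) powr \<alpha> *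
         ((norm (grad_fst f x))\<^sup>2 + infdist (snd x) (frontier \<Omega>) powr \<sigma> * (norm (grad_snd f x))\<^sup>2))"
        using main by (simp add: W.d_def)
    qed
  qed
qed

end
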